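(* Let $\Sigma$ be an orientable $(n-1)$-dimensional compact submanifold of a geodesic sphere $S(a,\varrho)$ of hyperbolic space $\mathbb H^{n+1}$ with center $a\in\mathbb H^{n+1}$ and geodesic radius $\varrho$, and let $\psi:M^n\to\mathbb H^{n+1}$ be an immersed orientable compact minimal hypersurface with boundary $\Sigma=\psi(\partial M)\subset S(a,\varrho)$. Then $$\mathrm{vol}(M)\le\frac{\sinh\varrho}{n}\,\mathrm{vol}(\partial M).$$
   Context: $\mathbb H^{n+1}$ is the hyperbolic space of constant sectional curvature $-1$. A hypersurface is an isometric immersion of a connected orientable manifold $M^n$ with smooth boundary $\partial M$; it has boundary $\Sigma$ if $\psi|_{\partial M}$ is a diffeomorphism onto $\Sigma$. Minimal means that the mean curvature vanishes identically. $\mathrm{vol}(M)$ is $n$-dimensional and $\mathrm{vol}(\partial M)$ is $(n-1)$-dimensional volume. *)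

theory Defs
  imports "HOL-Analysis.Analysis"
begin

section \<open>Smooth maps\<close>

text \<open>\<open>Ck_on k f S\<close> is used for open \<open>S\<close> in a Euclidean space only.\<close>

primrec Ck_on :: "nat \<Rightarrow> ('a::euclidean_space \<Rightarrow> 'b::real_normed_vector) \<Rightarrow> 'a set \<Rightarrow> bool" where
  "Ck_on 0 f S \<longleftrightarrow> continuous_on S f"
| "Ck_on (Suc k) f S \<longleftrightarrow>
     f differentiable_on S \<and> (\<forall>v. Ck_on k (\<lambda>x. frechet_derivative f (at x) v) S)"

text \<open>On an arbitrary subset of a Euclidean space, smooth (\<open>C\<^sup>\<infinity>\<close>) means that the map has
  local smooth extensions to open sets.\<close>

definition smooth_on :: "'a::euclidean_space set \<Rightarrow> ('a \<Rightarrow> 'b::real_normed_vector) \<Rightarrow> bool" where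
  "smooth_on S f \<longleftrightarrow>
     (\<forall>x\<in>S. \<exists>W g. open W \<and> x \<in> W \<and> (\<forall>k. Ck_on k g W) \<and> (\<forall>y\<in>S \<inter> W. f y = g y))"

text \<open>The \<open>i\<close>-th partial derivative relative to \<open>S\<close>. The sets \<open>S\<close> that occur are relatively open
  in a half space or in a coordinate hyperplane, and \<open>i\<close> is a direction of that half space or
  hyperplane; the value is then uniquely determined, also at boundary points.\<close>

definition coord_deriv ::
  "(real^'n) set \<Rightarrow> (real^'n \<Rightarrow> 'b::real_normed_vector) \<Rightarrow> 'n::finite \<Rightarrow> real^'n \<Rightarrow> 'b" where
  "coord_deriv S f i x = frechet_derivative f (at x within S) (axis i 1)"

section \<open>Manifolds with boundary\<close>

text \<open>An \<open>n\<close>-manifold with boundary has charts in a closed half space of \<open>real^'n\<close>, where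
  \<open>n = CARD('n)\<close>. An \<open>(n-1)\<close>-manifold without boundary has charts in the bounding hyperplane,
  whose coordinates are indexed by \<open>- {bd_index}\<close>. This allows \<open>n = 1\<close>, where the hyperplane is a
  point. Definitions for both cases take the model space \<open>H\<close> or its coordinate set \<open>I\<close> as a
  parameter.\<close>

definition bd_index :: "'n::finite" where
  "bd_index = (SOME i. True)"

definition half_space :: "(real^'n) set" where
  "half_space = {x. 0 \<le> x $ bd_index}"

definition hyperplane :: "(real^'n) set" where
  "hyperplane = {x. x $ bd_index = 0}"

type_synonym ('m, 'n) chart = "'m set \<times> ('m \<Rightarrow> real^'n)"

definition chart_img :: "('m, 'n::finite) chart \<Rightarrow> (real^'n) set" where
  "chart_img c = snd c ` fst c"

definition chart_inv :: "('m, 'n::finite) chart \<Rightarrow> real^'n \<Rightarrow> 'm" where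
  "chart_inv c = inv_into (fst c) (snd c)"

text \<open>The manifold is a subset \<open>M\<close> of a Hausdorff space, with the subspace topology.\<close>

definition smooth_atlas ::
  "(real^'n) set \<Rightarrow> 'm::t2_space set \<Rightarrow> ('m, 'n::finite) chart set \<Rightarrow> bool" where
  "smooth_atlas H M A \<longleftrightarrow>
     M = (\<Union>c\<in>A. fst c) \<and>
     (\<forall>c\<in>A. openin (top_of_set M) (fst c) \<and> openin (top_of_set H) (chart_img c) \<and>
            homeomorphism (fst c) (chart_img c) (snd c) (chart_inv c)) \<and>
     (\<forall>c\<in>A. \<forall>d\<in>A. smooth_on (snd c ` (fst c \<inter> fst d)) (snd d \<circ> chart_inv c))"

definition boundary :: "('m, 'n::finite) chart set \<Rightarrow> 'm set" where
  "boundary A = {p. \<exists>c\<in>A. p \<in> fst c \<and> snd c p $ bd_index = 0}"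

definition boundary_atlas :: "('m, 'n::finite) chart set \<Rightarrow> ('m, 'n) chart set" where
  "boundary_atlas A = (\<lambda>c. (fst c \<inter> boundary A, snd c)) ` A"

text \<open>The block of \<open>G\<close> with indices in \<open>I\<close>, completed by the identity: its determinant is the
  principal minor of \<open>G\<close> on \<open>I\<close>, and it is \<open>G\<close> for \<open>I = UNIV\<close>.\<close>

definition block :: "'n::finite set \<Rightarrow> real^'n^'n \<Rightarrow> real^'n^'n" where
  "block I G = (\<chi> i j. if i \<in> I \<and> j \<in> I then G $ i $ j else of_bool (i = j))"

definition transition_jacobian ::
  "'n set \<Rightarrow> ('m, 'n::finite) chart \<Rightarrow> ('m, 'n) chart \<Rightarrow> 'm \<Rightarrow> real" where
  "transition_jacobian I c d p =
     det (block I (\<chi> i j.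
       coord_deriv (snd c ` (fst c \<inter> fst d)) (snd d \<circ> chart_inv c) j (snd c p) $ i))"

text \<open>A continuous choice of orientations of the tangent spaces: \<open>\<epsilon> c p\<close> is the sign of the
  coordinate basis of the chart \<open>c\<close> at \<open>p\<close>. (Asking for an atlas with positive Jacobians would
  wrongly exclude the compact interval, since only one half space is used for charts.)\<close>

definition orientable ::
  "'n set \<Rightarrow> ('m::topological_space, 'n::finite) chart set \<Rightarrow> bool" where
  "orientable I A \<longleftrightarrow> (\<exists>\<epsilon>::('m, 'n) chart \<Rightarrow> 'm \<Rightarrow> real.
     (\<forall>c\<in>A. continuous_on (fst c) (\<epsilon> c) \<and> (\<forall>p\<in>fst c. \<epsilon> c p \<in> {1, -1})) \<and>
     (\<forall>c\<in>A. \<forall>d\<in>A. \<forall>p\<in>fst c \<inter> fst d. \<epsilon> d p = sgn (transition_jacobian I c d p) * \<epsilon> c p))"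

definition smooth_map ::
  "'m::topological_space set \<Rightarrow> ('m, 'n::finite) chart set \<Rightarrow>
   'k::topological_space set \<Rightarrow> ('k, 'n) chart set \<Rightarrow> ('m \<Rightarrow> 'k) \<Rightarrow> bool" where
  "smooth_map M A N B f \<longleftrightarrow> f ` M \<subseteq> N \<and> continuous_on M f \<and>
     (\<forall>c\<in>A. \<forall>d\<in>B. smooth_on (snd c ` (fst c \<inter> f -` fst d)) (snd d \<circ> f \<circ> chart_inv c))"

definition diffeomorphism ::
  "'m::topological_space set \<Rightarrow> ('m, 'n::finite) chart set \<Rightarrow>
   'k::topological_space set \<Rightarrow> ('k, 'n) chart set \<Rightarrow> ('m \<Rightarrow> 'k) \<Rightarrow> bool" where
  "diffeomorphism M A N B f \<longleftrightarrow>
     bij_betw f M N \<and> smooth_map M A N B f \<and> smooth_map N B M A (inv_into M f)"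

text \<open>A (boundaryless) submanifold \<open>S\<close> of a Euclidean space is a subset that is locally
  diffeomorphic to the model \<open>H\<close>. For \<open>S\<close> contained in another submanifold of the Euclidean space
  this is the same as being a submanifold of the latter.\<close>

definition submanifold ::
  "(real^'n) set \<Rightarrow> 'v::euclidean_space set \<Rightarrow> ('v, 'n::finite) chart set \<Rightarrow> bool" where
  "submanifold H S A \<longleftrightarrow> smooth_atlas H S A \<and>
     (\<forall>c\<in>A. smooth_on (fst c) (snd c) \<and> smooth_on (chart_img c) (chart_inv c))"

section \<open>Hyperbolic space\<close>

text \<open>The hyperboloid model in \<open>'e \<times> real\<close> with the Lorentz form; its dimension is \<open>DIM('e)\<close>,
  and \<open>cosh (dist x y) = - lorentz x y\<close> for its geodesic distance.\<close>

definition lorentz :: "'e::euclidean_space \<times> real \<Rightarrow> 'e \<times> real \<Rightarrow> real" where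
  "lorentz u v = fst u \<bullet> fst v - snd u * snd v"

definition hyperbolic_space :: "('e::euclidean_space \<times> real) set" where
  "hyperbolic_space = {x. lorentz x x = -1 \<and> 0 < snd x}"

definition hyp_dist :: "'e::euclidean_space \<times> real \<Rightarrow> 'e \<times> real \<Rightarrow> real" where
  "hyp_dist x y = arcosh (- lorentz x y)"

definition geodesic_sphere ::
  "'e::euclidean_space \<times> real \<Rightarrow> real \<Rightarrow> ('e \<times> real) set" where
  "geodesic_sphere a r = {x \<in> hyperbolic_space. hyp_dist a x = r}"

section \<open>Immersions into hyperbolic space\<close>

definition immersion_hyp ::
  "('m, 'n::finite) chart set \<Rightarrow> 'm set \<Rightarrow> ('m \<Rightarrow> 'e::euclidean_space \<times> real) \<Rightarrow> bool" where
  "immersion_hyp A M \<psi> \<longleftrightarrow> \<psi> ` M \<subseteq> hyperbolic_space \<and>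
     (\<forall>c\<in>A. smooth_on (chart_img c) (\<psi> \<circ> chart_inv c) \<and>
       (\<forall>x\<in>chart_img c. inj (frechet_derivative (\<psi> \<circ> chart_inv c) (at x within chart_img c))))"

text \<open>The metric of \<open>M\<close> is the one induced by \<open>\<psi>\<close>, in the chart \<open>c\<close>.\<close>

definition induced_metric ::
  "('m \<Rightarrow> 'e::euclidean_space \<times> real) \<Rightarrow> ('m, 'n::finite) chart \<Rightarrow> real^'n \<Rightarrow> real^'n^'n" where
  "induced_metric \<psi> c x =
     (\<chi> i j. lorentz (coord_deriv (chart_img c) (\<psi> \<circ> chart_inv c) i x)
                     (coord_deriv (chart_img c) (\<psi> \<circ> chart_inv c) j x))"

text \<open>The tangent space of the hyperboloid at \<open>p\<close> is the Lorentz complement of \<open>p\<close>.\<close>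

definition unit_normal ::
  "('m \<Rightarrow> 'e::euclidean_space \<times> real) \<Rightarrow> ('m, 'n::finite) chart \<Rightarrow> real^'n \<Rightarrow> 'e \<times> real \<Rightarrow> bool" where
  "unit_normal \<psi> c x N \<longleftrightarrow> lorentz N N = 1 \<and> lorentz N (\<psi> (chart_inv c x)) = 0 \<and>
     (\<forall>i. lorentz N (coord_deriv (chart_img c) (\<psi> \<circ> chart_inv c) i x) = 0)"

text \<open>The Levi-Civita connection of the hyperboloid is the tangential part of the flat derivative,
  and \<open>N\<close> is tangent to the hyperboloid, so that the coefficients of the second fundamental form
  are \<open>lorentz (\<partial>\<^sub>i \<partial>\<^sub>j \<psi>) N\<close>.\<close>

definition second_fundamental_form ::
  "('m \<Rightarrow> 'e::euclidean_space \<times> real) \<Rightarrow> ('m, 'n::finite) chart \<Rightarrow> 'e \<times> real \<Rightarrow> real^'n \<Rightarrow> real^'n^'n"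
  where
  "second_fundamental_form \<psi> c N x =
     (\<chi> i j. lorentz (coord_deriv (chart_img c)
                        (coord_deriv (chart_img c) (\<psi> \<circ> chart_inv c) j) i x) N)"

definition mean_curvature ::
  "('m \<Rightarrow> 'e::euclidean_space \<times> real) \<Rightarrow> ('m, 'n::finite) chart \<Rightarrow> 'e \<times> real \<Rightarrow> real^'n \<Rightarrow> real" where
  "mean_curvature \<psi> c N x =
     trace (matrix_inv (induced_metric \<psi> c x) ** second_fundamental_form \<psi> c N x) / real CARD('n)"

definition minimal ::
  "('m, 'n::finite) chart set \<Rightarrow> ('m \<Rightarrow> 'e::euclidean_space \<times> real) \<Rightarrow> bool" where
  "minimal A \<psi> \<longleftrightarrow>
     (\<forall>c\<in>A. \<forall>x\<in>chart_img c. \<forall>N. unit_normal \<psi> c x N \<longrightarrow> mean_curvature \<psi> c N x = 0)"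

section \<open>Riemannian volume\<close>

text \<open>Lebesgue measure of the coordinate subspace \<open>{x. \<forall>i. i \<notin> I \<longrightarrow> x $ i = 0}\<close>, as a measure
  on \<open>real^'n\<close>; it is \<open>lborel\<close> for \<open>I = UNIV\<close> and the unit point mass at \<open>0\<close> for \<open>I = {}\<close>.\<close>

definition coord_lborel :: "'n::finite set \<Rightarrow> (real^'n) measure" where
  "coord_lborel I =
     distr (Pi\<^sub>M I (\<lambda>_. lborel)) borel (\<lambda>y. \<chi> i. if i \<in> I then y i else 0)"

definition volume_density ::
  "'n set \<Rightarrow> ('m \<Rightarrow> 'e::euclidean_space \<times> real) \<Rightarrow> ('m, 'n::finite) chart \<Rightarrow> real^'n \<Rightarrow> real" where
  "volume_density I \<psi> c x = sqrt (det (block I (induced_metric \<psi> c x)))"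

text \<open>The Riemannian measure of \<open>(M, \<psi>\<^sup>* lorentz)\<close>: the unique Borel measure that has the density
  \<open>sqrt (det g)\<close> in every chart. The dimension is \<open>card I\<close>.\<close>

definition riemannian_measure ::
  "'n set \<Rightarrow> 'm::t2_space set \<Rightarrow> ('m, 'n::finite) chart set \<Rightarrow>
   ('m \<Rightarrow> 'e::euclidean_space \<times> real) \<Rightarrow> 'm measure" where
  "riemannian_measure I M A \<psi> = (THE \<mu>.
     sets \<mu> = sets (restrict_space borel M) \<and>
     (\<forall>c\<in>A. \<forall>B\<in>sets \<mu>. B \<subseteq> fst c \<longrightarrow>
        emeasure \<mu> B = (\<integral>\<^sup>+x\<in>snd c ` B. ennreal (volume_density I \<psi> c x) \<partial>coord_lborel I)))"

definition riemannian_volume ::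
  "'n set \<Rightarrow> 'm::t2_space set \<Rightarrow> ('m, 'n::finite) chart set \<Rightarrow>
   ('m \<Rightarrow> 'e::euclidean_space \<times> real) \<Rightarrow> real" where
  "riemannian_volume I M A \<psi> = measure (riemannian_measure I M A \<psi>) M"

end

theory Submission
  imports Defs
begin

text \<open>Let \<open>f = - lorentz a \<psi>\<close>, the hyperbolic cosine of the distance from \<open>a\<close>. Since \<open>\<psi>\<close> is
  minimal, its Laplacian is \<open>n \<psi>\<close>: it is orthogonal to the tangent vectors and, by minimality, to the
  unit normal, and its component along \<open>\<psi>\<close> follows from \<open>lorentz \<psi> \<psi> = -1\<close>. Hence \<open>\<Delta> f = n f\<close>, and
  the divergence theorem expresses the integral of \<open>n f\<close> over \<open>M\<close> as the flux of the gradient of \<open>f\<close>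
  through the boundary. As \<open>f \<ge> 1\<close> on \<open>M\<close>, while on the boundary the gradient, a projection of \<open>- a\<close>,
  has length at most \<open>sqrt (f\<^sup>2 - 1) = sinh \<rho>\<close>, the inequality follows. The flux in a chart is
  bounded by the Cauchy-Schwarz inequality, because the \<open>b\<close>-th diagonal entry of the inverse metric
  is the quotient of the boundary minor and the determinant of the metric.\<close>

section \<open>Change of variables\<close>

text \<open>No connection is introduced: vector fields are multiplied by
  \<open>sqrt (det g)\<close>, so that a divergence is a plain sum of partial derivatives. The
  tangential part of the Laplacian then vanishes by Jacobi's formula for determinants and the
  symmetry of second derivatives. Charts take values in a half space, so derivatives are taken
  within sets that have boundary points; they are unique because each coordinate direction can be
  followed a little way inside the set. The Riemannian volume is a definite description and must
  first be shown to denote a measure. This requires a change of variables not only in full dimension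
  but also on the coordinate hyperplane of the boundary charts. The divergence theorem is proved
  chart by chart for the gradient of \<open>f\<close> multiplied by a member \<open>u\<close> of a
  partition of unity. Only one derivative of \<open>u\<close> occurs, so squared truncated
  paraboloids serve as bump functions, and the terms with derivatives of \<open>u\<close> cancel in
  the sum. The flux density is bounded in absolute value, component by component, so that no
  conormal field has to be constructed.\<close>

text \<open>The library's change-of-variables theorem needs a well-ordered index type; \<open>'a wo\<close> is a
  well-ordered copy of the finite type \<open>'a\<close>.\<close>

typedef 'a wo = "UNIV :: 'a set" morphisms of_wo to_wo by simp

lemma bij_of_wo: "bij of_wo"
  by (metis bijI' of_wo_inject to_wo_cases UNIV_I of_wo_induct to_wo_inverse)

instance wo :: (finite) finite
proof
  show "finite (UNIV :: 'a wo set)"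
    by (metis bij_of_wo bij_betw_finite finite)
qed

instantiation wo :: (finite) wellorder
begin

definition less_eq_wo :: "'a wo \<Rightarrow> 'a wo \<Rightarrow> bool" where
  "less_eq_wo x y \<longleftrightarrow> to_nat_on UNIV x \<le> to_nat_on UNIV y"

definition less_wo :: "'a wo \<Rightarrow> 'a wo \<Rightarrow> bool" where
  "less_wo x y \<longleftrightarrow> to_nat_on UNIV x < to_nat_on UNIV y"

instance
proof
  have inj: "to_nat_on UNIV x = to_nat_on UNIV y \<longleftrightarrow> x = y" for x y :: "'a wo"
    by (simp add: countable_finite)
  fix x y z :: "'a wo"
  show "x < y \<longleftrightarrow> x \<le> y \<and> \<not> y \<le> x" "x \<le> x" "x \<le> y \<or> y \<le> x"
    by (auto simp: less_eq_wo_def less_wo_def)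
  show "x \<le> y \<Longrightarrow> y \<le> z \<Longrightarrow> x \<le> z" by (auto simp: less_eq_wo_def)
  show "x \<le> y \<Longrightarrow> y \<le> x \<Longrightarrow> x = y" using inj by (auto simp: less_eq_wo_def)
  fix P :: "'a wo \<Rightarrow> bool"
  assume "\<And>x. (\<And>y. y < x \<Longrightarrow> P y) \<Longrightarrow> P x"
  then show "P x"
    unfolding less_wo_def using measure_induct_rule[of "to_nat_on UNIV" P] by blast
qed

end

definition wo_vec :: "real^'n \<Rightarrow> real^('n::finite wo)" where
  "wo_vec x = (\<chi> i. x $ of_wo i)"

definition vec_wo :: "real^('n::finite wo) \<Rightarrow> real^'n" where
  "vec_wo x = (\<chi> i. x $ to_wo i)"

lemma vec_wo_inverse [simp]: "wo_vec (vec_wo x) = x" "vec_wo (wo_vec y) = y"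
  by (simp_all add: wo_vec_def vec_wo_def vec_eq_iff of_wo_inverse to_wo_inverse)

lemma linear_wo_vec: "linear wo_vec" and linear_vec_wo: "linear vec_wo"
  by (auto intro!: linearI simp: wo_vec_def vec_wo_def vec_eq_iff)

lemma continuous_wo_vec: "continuous_on S wo_vec" and continuous_vec_wo: "continuous_on T vec_wo"
  by (simp_all add: linear_wo_vec linear_vec_wo linear_continuous_on linear_linear)

lemma borel_wo [measurable]: "wo_vec \<in> borel \<rightarrow>\<^sub>M borel" "vec_wo \<in> borel \<rightarrow>\<^sub>M borel"
  by (rule borel_measurable_continuous_onI continuous_wo_vec continuous_vec_wo)+

lemma vec_wo_image_box: "vec_wo -` box l u = box (wo_vec l) (wo_vec u)"
  by (auto simp: mem_box_cart vec_wo_def wo_vec_def) (metis of_wo_inverse to_wo_inverse UNIV_I)+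

text \<open>Relabelling the coordinates only reorders the factors in the volume of a box, and boxes
  determine Lebesgue measure.\<close>

lemma lborel_vec_wo: "distr lborel borel vec_wo = (lborel :: (real^'n::finite) measure)"
proof (rule lborel_eqI[symmetric])
  fix l u :: "real^'n"
  assume lu: "\<And>b. b \<in> Basis \<Longrightarrow> l \<bullet> b \<le> u \<bullet> b"
  have le: "l $ i \<le> u $ i" for i
    using lu[of "axis i 1"] by (simp add: inner_axis axis_in_Basis_iff)
  have "emeasure (distr lborel borel vec_wo) (box l u) = emeasure lborel (box (wo_vec l) (wo_vec u))"
    by (simp add: emeasure_distr vec_wo_image_box)
  also have "\<dots> = (\<Prod>b\<in>Basis. (wo_vec u - wo_vec l) \<bullet> b)"
    by (rule emeasure_lborel_box) (auto simp: Basis_vec_def inner_axis wo_vec_def le)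
  also have "(\<Prod>b\<in>Basis. (wo_vec u - wo_vec l) \<bullet> b) = (\<Prod>i\<in>UNIV. u $ of_wo i - l $ of_wo i)"
    by (simp add: Basis_vec_def UNION_singleton_eq_range prod.reindex inj_on_def axis_eq_axis
        inner_axis wo_vec_def)
  also have "\<dots> = (\<Prod>i\<in>UNIV. u $ i - l $ i)"
    using prod.reindex_bij_betw[OF bij_of_wo, of "\<lambda>i. u $ i - l $ i"] by simp
  also have "\<dots> = (\<Prod>b\<in>Basis. (u - l) \<bullet> b)"
    by (simp add: Basis_vec_def UNION_singleton_eq_range prod.reindex inj_on_def axis_eq_axis inner_axis)
  finally show "emeasure (distr lborel borel vec_wo) (box l u) = (\<Prod>b\<in>Basis. (u - l) \<bullet> b)" .
qed simp

text \<open>Conjugation with \<open>\<pi>\<close> is a bijection between the permutations of the two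
  index types. It keeps the sign and carries each term of the Leibniz expansion to a term with the
  same factors.\<close>

lemma det_reindex:
  fixes A :: "'a::comm_ring_1^'n^'n" and \<pi> :: "'m::finite \<Rightarrow> 'n::finite"
  assumes "bij \<pi>"
  shows "det (\<chi> i j. A $ \<pi> i $ \<pi> j) = det A"
proof -
  have inj: "inj \<pi>" and bi: "bij (inv \<pi>)" using assms by (auto simp: bij_is_inj bij_imp_bij_inv)
  define T where "T = map_permutation UNIV (inv \<pi>)"
  have T: "T p = inv \<pi> \<circ> p \<circ> \<pi>" for p
    using assms bi by (simp add: T_def map_permutation_def restrict_id_def fun_eq_iff bij_is_surj
        inv_inv_eq)
  have "bij_betw T {p. p permutes UNIV} {p. p permutes UNIV}"
  proof (rule bij_betw_byWitness[where f' = "\<lambda>q. \<pi> \<circ> q \<circ> inv \<pi>"])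
    show "\<forall>p\<in>{p. p permutes UNIV}. \<pi> \<circ> T p \<circ> inv \<pi> = p" "\<forall>q\<in>{p. p permutes UNIV}. T (\<pi> \<circ> q \<circ> inv \<pi>) = q"
      using assms by (auto simp: T fun_eq_iff bij_inv_eq_iff bij_is_inj surj_f_inv_f bij_is_surj)
    show "T ` {p. p permutes UNIV} \<subseteq> {p. p permutes UNIV}"
      using map_permutation_permutes[OF bi] by (auto simp: T_def)
    show "(\<lambda>q. \<pi> \<circ> q \<circ> inv \<pi>) ` {p. p permutes UNIV} \<subseteq> {p. p permutes UNIV}"
      using assms bi by (auto intro!: bij_imp_permutes bij_comp permutes_bij)
  qed
  note bT = this
  have "det (\<chi> i j. A $ \<pi> i $ \<pi> j) = (\<Sum>q | q permutes UNIV. of_int (sign q) * (\<Prod>i\<in>UNIV. A $ \<pi> i $ \<pi> (q i)))"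
    by (simp add: det_def)
  also have "\<dots> = (\<Sum>p | p permutes UNIV. of_int (sign (T p)) * (\<Prod>i\<in>UNIV. A $ \<pi> i $ \<pi> (T p i)))"
    by (rule sum.reindex_bij_betw[OF bT, symmetric])
  also have "\<dots> = (\<Sum>p | p permutes UNIV. of_int (sign p) * (\<Prod>i\<in>UNIV. A $ i $ p i))"
  proof (rule sum.cong[OF refl])
    fix p :: "'n \<Rightarrow> 'n" assume "p \<in> {p. p permutes UNIV}"
    then have "sign (T p) = sign p"
      using bi by (auto simp: T_def intro!: sign_map_permutation bij_is_inj)
    moreover have "(\<Prod>i\<in>UNIV. A $ \<pi> i $ \<pi> (T p i)) = (\<Prod>i\<in>UNIV. A $ \<pi> i $ p (\<pi> i))"
      using assms by (simp add: T surj_f_inv_f bij_is_surj)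
    moreover have "\<dots> = (\<Prod>i\<in>UNIV. A $ i $ p i)"
      by (rule prod.reindex_bij_betw[OF assms])
    ultimately show "of_int (sign (T p)) * (\<Prod>i\<in>UNIV. A $ \<pi> i $ \<pi> (T p i)) = of_int (sign p) * (\<Prod>i\<in>UNIV. A $ i $ p i)"
      by simp
  qed
  also have "\<dots> = det A" by (simp add: det_def)
  finally show ?thesis .
qed

text \<open>The classical theorem equates finite integrals of absolutely integrable functions. For a
  nonnegative integrand this extends to values in \<open>ennreal\<close>: if one side is not
  integrable, neither is the other, and both integrals are infinite.\<close>

lemma nn_integral_change_of_variables_wo:
  fixes g :: "real^'m::{finite,wellorder} \<Rightarrow> real^'m::_" and f :: "real^'m::_ \<Rightarrow> real"
  assumes S: "S \<in> sets borel"
    and der: "\<And>x. x \<in> S \<Longrightarrow> (g has_derivative g' x) (at x within S)"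
    and inj: "inj_on g S" and nonneg: "\<And>x. 0 \<le> f x"
    and meas1: "(\<lambda>x. indicator S x * (\<bar>det (matrix (g' x))\<bar> * f (g x))) \<in> borel_measurable borel"
    and meas2: "(\<lambda>y. indicator (g ` S) y * f y) \<in> borel_measurable borel"
  shows "(\<integral>\<^sup>+y. ennreal (indicator (g ` S) y * f y) \<partial>lborel) =
    (\<integral>\<^sup>+x. ennreal (indicator S x * (\<bar>det (matrix (g' x))\<bar> * f (g x))) \<partial>lborel)"
proof -
  define F where "F = (\<lambda>x. \<bar>det (matrix (g' x))\<bar> * f (g x))"
  have iff: "F absolutely_integrable_on S \<and> integral S F = b \<longleftrightarrow>
      f absolutely_integrable_on (g ` S) \<and> integral (g ` S) f = b" for b
    using has_absolute_integral_change_of_variables[of S g g' "\<lambda>x. vec (f x) :: real^1" "vec b"] S der inj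
    by (auto simp: absolutely_integrable_on_1_iff integral_on_1_eq F_def vec_eq_iff)
  \<comment> \<open>Absolute integrability refers to the completion of \<open>lborel\<close>; for
    Borel functions it reduces to \<open>lborel\<close> itself.\<close>
  have conv: "h absolutely_integrable_on T \<longleftrightarrow> integrable lborel (\<lambda>x. indicator T x * h x)"
    "h absolutely_integrable_on T \<Longrightarrow> integral T h = (\<integral>x. indicator T x * h x \<partial>lborel)"
    if "(\<lambda>x. indicator T x * h x) \<in> borel_measurable borel" for h :: "real^'m::_ \<Rightarrow> real" and T
    using that set_lebesgue_integral_eq_integral(2)[of T h]
    by (simp_all add: set_integrable_def set_lebesgue_integral_def integrable_completion integral_completion)
  let ?F = "\<lambda>x. indicator S x * F x" and ?G = "\<lambda>y. indicator (g ` S) y * f y"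
  have F0: "0 \<le> ?F x" and G0: "0 \<le> ?G x" for x
    using nonneg by (auto simp: F_def)
  have mF: "?F \<in> borel_measurable borel" using meas1 by (simp add: F_def)
  note cF = conv[OF mF] and cG = conv[OF meas2]
  show ?thesis
  proof (cases "integrable lborel ?F")
    case True
    then have "integrable lborel ?G" "integral\<^sup>L lborel ?G = integral\<^sup>L lborel ?F"
      using iff[of "integral S F"] cF cG by auto
    then have "(\<integral>\<^sup>+x. ennreal (?F x) \<partial>lborel) = (\<integral>\<^sup>+x. ennreal (?G x) \<partial>lborel)"
      using True F0 G0 by (simp add: nn_integral_eq_integral)
    then show ?thesis by (simp add: F_def)
  next
    case False
    then have "\<not> integrable lborel ?G"
      using iff[of "integral (g ` S) f"] cF cG by auto
    then have "(\<integral>\<^sup>+x. ennreal (?F x) \<partial>lborel) = \<infinity>" "(\<integral>\<^sup>+x. ennreal (?G x) \<partial>lborel) = \<infinity>"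
      using False mF meas2 F0 G0 by (auto simp: integrable_iff_bounded abs_of_nonneg less_top[symmetric] simp del: F0 G0)
    then show ?thesis by (simp add: F_def)
  qed
qed

lemma matrix_wo:
  fixes f :: "real^'n::finite \<Rightarrow> real^'n"
  assumes "linear f"
  shows "matrix (wo_vec \<circ> f \<circ> vec_wo) = (\<chi> i j. matrix f $ of_wo i $ of_wo j)"
proof -
  have "vec_wo (axis j 1) = (axis (of_wo j) 1 :: real^'n)" for j
    by (auto simp: vec_wo_def axis_def vec_eq_iff to_wo_inverse of_wo_inverse)
  then show ?thesis by (simp add: matrix_def wo_vec_def)
qed

text \<open>Conjugation with the relabelling reduces this to the well-ordered index type;
  \<open>det_reindex\<close> takes care of the Jacobian and \<open>lborel_vec_wo\<close> of the
  measure.\<close>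

lemma nn_integral_change_of_variables:
  fixes g :: "real^'n::finite \<Rightarrow> real^'n" and f :: "real^'n \<Rightarrow> real"
  assumes S: "S \<in> sets borel"
    and der: "\<And>x. x \<in> S \<Longrightarrow> (g has_derivative g' x) (at x within S)"
    and inj: "inj_on g S" and nonneg: "\<And>x. 0 \<le> f x"
    and meas1: "(\<lambda>x. indicator S x * (\<bar>det (matrix (g' x))\<bar> * f (g x))) \<in> borel_measurable borel"
    and meas2: "(\<lambda>y. indicator (g ` S) y * f y) \<in> borel_measurable borel"
  shows "(\<integral>\<^sup>+y. ennreal (indicator (g ` S) y * f y) \<partial>lborel) =
    (\<integral>\<^sup>+x. ennreal (indicator S x * (\<bar>det (matrix (g' x))\<bar> * f (g x))) \<partial>lborel)"
proof -
  let ?g = "wo_vec \<circ> g \<circ> vec_wo" and ?g' = "\<lambda>x. wo_vec \<circ> g' (vec_wo x) \<circ> vec_wo"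
  let ?S = "vec_wo -` S" and ?f = "f \<circ> vec_wo"
  have inj_vw: "inj vec_wo" by (metis injI vec_wo_inverse(1))
  have S': "?S \<in> sets borel"
    using measurable_sets[OF borel_wo(2) S] by simp
  have img: "?g ` ?S = vec_wo -` (g ` S)"
  proof (intro set_eqI iffI)
    fix x assume "x \<in> vec_wo -` (g ` S)"
    then obtain z where z: "z \<in> S" "vec_wo x = g z" by auto
    then have "x = ?g (wo_vec z)" by (metis comp_apply vec_wo_inverse)
    then show "x \<in> ?g ` ?S" using z by (intro image_eqI[where x = "wo_vec z"]) auto
  qed auto
  have der': "(?g has_derivative ?g' x) (at x within ?S)" if "x \<in> ?S" for x
  proof -
    have "(vec_wo has_derivative vec_wo) (at x within ?S)" "(wo_vec has_derivative wo_vec) (at y within U)"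
      for y :: "real^'n" and U
      by (simp_all add: linear_imp_has_derivative linear_vec_wo linear_wo_vec)
    note d = this
    have im: "vec_wo ` ?S \<subseteq> S" by auto
    have "(g has_derivative g' (vec_wo x)) (at (vec_wo x) within vec_wo ` ?S)"
      using der[of "vec_wo x"] that im has_derivative_subset by blast
    from diff_chain_within[OF d(1) this] d(2)[of "(g \<circ> vec_wo) x"]
    show ?thesis by (metis (no_types, lifting) comp_assoc diff_chain_within)
  qed
  have dt: "det (matrix (?g' x)) = det (matrix (g' (vec_wo x)))" if "x \<in> ?S" for x
  proof -
    have "linear (g' (vec_wo x))" using der that has_derivative_linear by blast
    then show ?thesis by (simp only: matrix_wo det_reindex[OF bij_of_wo])
  qed
  have ind: "indicator ?S x = (indicator S (vec_wo x) :: real)" for x :: "real^('n wo)"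
    by (simp add: indicator_def)
  have eq1: "indicator ?S x * (\<bar>det (matrix (?g' x))\<bar> * ?f (?g x)) =
      indicator S (vec_wo x) * (\<bar>det (matrix (g' (vec_wo x)))\<bar> * f (g (vec_wo x)))" for x
    by (cases "x \<in> ?S") (simp_all add: dt)
  have eq2: "indicator (?g ` ?S) y * ?f y = indicator (g ` S) (vec_wo y) * f (vec_wo y)" for y
    unfolding img by (simp add: indicator_def)
  have "(\<integral>\<^sup>+y. ennreal (indicator (?g ` ?S) y * ?f y) \<partial>lborel) =
    (\<integral>\<^sup>+x. ennreal (indicator ?S x * (\<bar>det (matrix (?g' x))\<bar> * ?f (?g x))) \<partial>lborel)"
  proof (rule nn_integral_change_of_variables_wo[OF S' der'])
    show "inj_on ?g ?S"
      using inj by (auto simp: inj_on_def) (metis inj_vw injD vec_wo_inverse(2))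
    show "0 \<le> ?f x" for x using nonneg by simp
    show "(\<lambda>x. indicator ?S x * (\<bar>det (matrix (?g' x))\<bar> * ?f (?g x))) \<in> borel_measurable borel"
      unfolding eq1 by (rule measurable_compose[OF borel_wo(2) meas1])
    show "(\<lambda>y. indicator (?g ` ?S) y * ?f y) \<in> borel_measurable borel"
      unfolding eq2 by (rule measurable_compose[OF borel_wo(2) meas2])
  qed auto
  then show ?thesis
    unfolding eq1 eq2 using meas1 meas2
    by (subst (1 2) lborel_vec_wo[symmetric]) (simp add: nn_integral_distr)
qed

section \<open>Lebesgue measure on coordinate subspaces\<close>

definition coord_embed :: "'n::finite set \<Rightarrow> ('n \<Rightarrow> real) \<Rightarrow> real^'n" where
  "coord_embed I y = (\<chi> i. if i \<in> I then y i else 0)"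

definition coord_proj :: "'n::finite set \<Rightarrow> real^'n \<Rightarrow> real^'n" where
  "coord_proj I x = (\<chi> i. if i \<in> I then x $ i else 0)"

lemma coord_lborel_altdef: "coord_lborel I = distr (Pi\<^sub>M I (\<lambda>_. lborel)) borel (coord_embed I)"
  unfolding coord_lborel_def coord_embed_def ..

lemma sets_coord_lborel [simp, measurable_cong]: "sets (coord_lborel I) = sets borel"
  and space_coord_lborel [simp]: "space (coord_lborel I) = UNIV"
  by (simp_all add: coord_lborel_def)

lemma borel_measurable_vec:
  fixes f :: "'a \<Rightarrow> real^'n::finite"
  shows "f \<in> borel_measurable N \<longleftrightarrow> (\<forall>i. (\<lambda>x. f x $ i) \<in> borel_measurable N)"
  by (subst borel_measurable_euclidean_space) (auto simp: Basis_vec_def inner_axis)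

lemma coord_embed_measurable [measurable]:
  "coord_embed I \<in> Pi\<^sub>M I (\<lambda>_. lborel) \<rightarrow>\<^sub>M (borel :: (real^'n::finite) measure)"
proof -
  have "(\<lambda>y. coord_embed I y $ i) \<in> Pi\<^sub>M I (\<lambda>_. lborel) \<rightarrow>\<^sub>M borel" for i :: 'n
    by (cases "i \<in> I") (simp_all add: coord_embed_def measurable_lborel1)
  then show ?thesis by (simp add: borel_measurable_vec)
qed

lemma linear_coord_proj: "linear (coord_proj I)"
  by (auto intro!: linearI simp: coord_proj_def vec_eq_iff)

lemma continuous_coord_proj: "continuous_on S (coord_proj I)"
  by (simp add: linear_continuous_on linear_linear linear_coord_proj)

lemma coord_proj_measurable [measurable]: "coord_proj I \<in> borel \<rightarrow>\<^sub>M borel"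
  by (rule borel_measurable_continuous_onI continuous_coord_proj)+

lemma coord_proj_UNIV [simp]: "coord_proj UNIV x = x"
  by (simp add: coord_proj_def)

lemma coord_proj_idem [simp]: "coord_proj I (coord_proj I x) = coord_proj I x"
  by (simp add: coord_proj_def vec_eq_iff)

lemma coord_lborel_UNIV: "coord_lborel UNIV = (lborel :: (real^'n::finite) measure)"
proof (rule lborel_eqI[symmetric])
  interpret product_sigma_finite "\<lambda>_::'n. lborel :: real measure" ..
  interpret finite_product_sigma_finite "\<lambda>_::'n. lborel :: real measure" UNIV by standard simp
  fix l u :: "real^'n"
  assume lu: "\<And>b. b \<in> Basis \<Longrightarrow> l \<bullet> b \<le> u \<bullet> b"
  have le: "l $ i \<le> u $ i" for i
    using lu[of "axis i 1"] by (simp add: inner_axis axis_in_Basis_iff)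
  have "coord_embed UNIV -` box l u \<inter> space (Pi\<^sub>M UNIV (\<lambda>_. lborel)) = (\<Pi>\<^sub>E i\<in>UNIV. {l $ i<..<u $ i})"
    by (auto simp: mem_box_cart coord_embed_def space_PiM PiE_def Pi_def)
  then have "emeasure (coord_lborel UNIV) (box l u) = (\<Prod>i\<in>UNIV. emeasure lborel {l $ i<..<u $ i})"
    by (simp add: coord_lborel_altdef emeasure_distr measure_times)
  also have "\<dots> = ennreal (\<Prod>i\<in>UNIV. u $ i - l $ i)"
    by (simp add: le prod_ennreal)
  also have "(\<Prod>i\<in>UNIV. u $ i - l $ i) = (\<Prod>b\<in>Basis. (u - l) \<bullet> b)"
    by (simp add: Basis_vec_def UNION_singleton_eq_range prod.reindex inj_on_def axis_eq_axis inner_axis)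
  finally show "emeasure (coord_lborel UNIV) (box l u) = (\<Prod>b\<in>Basis. (u - l) \<bullet> b)" .
qed simp

lemma coord_embed_merge:
  "I \<inter> J = {} \<Longrightarrow> coord_embed (I \<union> J) (merge I J (x, y)) = coord_embed I x + coord_embed J y"
  by (auto simp: coord_embed_def merge_def vec_eq_iff)

text \<open>Tonelli's theorem for product measures; under \<open>coord_embed\<close>, merging two
  families with disjoint index sets becomes addition of vectors.\<close>

lemma nn_integral_coord_lborel_Un:
  fixes f :: "real^'n::finite \<Rightarrow> ennreal"
  assumes IJ: "I \<inter> J = {}" and f [measurable]: "f \<in> borel_measurable borel"
  shows "integral\<^sup>N (coord_lborel (I \<union> J)) f = (\<integral>\<^sup>+x. (\<integral>\<^sup>+y. f (x + y) \<partial>coord_lborel J) \<partial>coord_lborel I)"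
proof -
  interpret product_sigma_finite "\<lambda>_::'n. lborel :: real measure" ..
  interpret J: finite_product_sigma_finite "\<lambda>_::'n. lborel :: real measure" J by standard simp
  have [measurable]: "(\<lambda>x. \<integral>\<^sup>+y. f (x + coord_embed J y) \<partial>Pi\<^sub>M J (\<lambda>_. lborel)) \<in> borel_measurable borel"
    by (rule J.borel_measurable_nn_integral) measurable
  have "integral\<^sup>N (coord_lborel (I \<union> J)) f
      = (\<integral>\<^sup>+x. (\<integral>\<^sup>+y. f (coord_embed (I \<union> J) (merge I J (x, y))) \<partial>Pi\<^sub>M J (\<lambda>_. lborel)) \<partial>Pi\<^sub>M I (\<lambda>_. lborel))"
    unfolding coord_lborel_altdef
    by (subst nn_integral_distr) (auto intro!: product_nn_integral_fold[OF IJ])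
  then show ?thesis
    by (simp add: coord_embed_merge[OF IJ] coord_lborel_altdef nn_integral_distr)
qed

lemma integral_coord_lborel_Un:
  fixes f :: "real^'n::finite \<Rightarrow> real"
  assumes IJ: "I \<inter> J = {}" and f: "integrable (coord_lborel (I \<union> J)) f"
  shows "integral\<^sup>L (coord_lborel (I \<union> J)) f = (\<integral>x. (\<integral>y. f (x + y) \<partial>coord_lborel J) \<partial>coord_lborel I)"
proof -
  interpret product_sigma_finite "\<lambda>_::'n. lborel :: real measure" ..
  interpret J: finite_product_sigma_finite "\<lambda>_::'n. lborel :: real measure" J by standard simp
  have mf [measurable]: "f \<in> borel_measurable borel" using borel_measurable_integrable[OF f] by simp
  have [measurable]: "(\<lambda>x. \<integral>y. f (x + coord_embed J y) \<partial>Pi\<^sub>M J (\<lambda>_. lborel)) \<in> borel_measurable borel"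
    by (rule J.borel_measurable_lebesgue_integral) measurable
  have "integrable (Pi\<^sub>M (I \<union> J) (\<lambda>_. lborel)) (\<lambda>x. f (coord_embed (I \<union> J) x))"
    using f by (simp add: coord_lborel_altdef integrable_distr_eq)
  from product_integral_fold[OF IJ _ _ this]
  have "integral\<^sup>L (coord_lborel (I \<union> J)) f
      = (\<integral>x. (\<integral>y. f (coord_embed (I \<union> J) (merge I J (x, y))) \<partial>Pi\<^sub>M J (\<lambda>_. lborel)) \<partial>Pi\<^sub>M I (\<lambda>_. lborel))"
    by (simp add: coord_lborel_altdef integral_distr)
  then show ?thesis
    by (simp add: coord_embed_merge[OF IJ] coord_lborel_altdef integral_distr)
qed

lemma integral_coord_lborel_singleton:
  fixes f :: "real^'n::finite \<Rightarrow> real"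
  assumes [measurable]: "f \<in> borel_measurable borel"
  shows "integral\<^sup>L (coord_lborel {i}) f = (\<integral>t. f (t *\<^sub>R axis i 1) \<partial>lborel)"
proof -
  interpret product_sigma_finite "\<lambda>_::'n. lborel :: real measure" ..
  have [measurable]: "(\<lambda>t. f (t *\<^sub>R axis i 1)) \<in> borel_measurable borel" by measurable
  have "coord_embed {i} y = y i *\<^sub>R axis i 1" for y
    by (auto simp: coord_embed_def axis_def vec_eq_iff)
  then show ?thesis
    using product_integral_singleton[of "\<lambda>t. f (t *\<^sub>R axis i 1)" i]
    by (simp add: coord_lborel_altdef integral_distr)
qed

text \<open>The measure \<open>coord_lborel I\<close> is carried by the range of
  \<open>coord_proj I\<close>.\<close>

lemma nn_integral_coord_lborel_proj:
  assumes [measurable]: "f \<in> borel_measurable borel"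
  shows "integral\<^sup>N (coord_lborel I) (\<lambda>x. f (coord_proj I x)) = integral\<^sup>N (coord_lborel I) f"
proof -
  have "coord_proj I (coord_embed I y) = coord_embed I y" for y
    by (simp add: coord_proj_def coord_embed_def vec_eq_iff)
  then show ?thesis by (simp add: coord_lborel_altdef nn_integral_distr)
qed

text \<open>With \<open>J\<close> the complement of \<open>I\<close>, this is the product of the
  coordinate subspace of \<open>I\<close> with a cube of measure 1. It thickens sets in that
  subspace to full dimension without changing their measure.\<close>

definition coord_cube :: "'n::finite set \<Rightarrow> (real^'n) set" where
  "coord_cube J = {y. \<forall>j\<in>J. y $ j \<in> {0..1}}"

lemma closed_coord_cube: "closed (coord_cube J)"
proof -
  have "coord_cube J = (\<Inter>j\<in>J. {y. 0 \<le> y $ j} \<inter> {y. y $ j \<le> 1})" by (auto simp: coord_cube_def)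
  then show ?thesis
    by (auto intro!: closed_INT closed_Int closed_Collect_le continuous_intros)
qed

lemma emeasure_coord_cube: "emeasure (coord_lborel J) (coord_cube J) = 1"
proof -
  interpret product_sigma_finite "\<lambda>_::'a. lborel :: real measure" ..
  interpret finite_product_sigma_finite "\<lambda>_::'a. lborel :: real measure" J by standard simp
  have "coord_embed J -` coord_cube J \<inter> space (Pi\<^sub>M J (\<lambda>_. lborel)) = (\<Pi>\<^sub>E i\<in>J. {0..1})"
    by (auto simp: coord_cube_def coord_embed_def space_PiM PiE_def)
  then show ?thesis
    by (simp add: coord_lborel_altdef emeasure_distr measure_times borel_closed closed_coord_cube)
qed

text \<open>Tonelli over \<open>I\<close> and its complement, where the cube contributes the factor
  1. Integrals over a coordinate subspace are thus traded for Lebesgue integrals on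
  \<open>real^'n\<close>.\<close>

lemma nn_integral_lborel_slab:
  fixes k :: "real^'n::finite \<Rightarrow> ennreal"
  assumes [measurable]: "k \<in> borel_measurable borel"
  shows "(\<integral>\<^sup>+x. indicator (coord_cube (- I)) x * k (coord_proj I x) \<partial>lborel) = integral\<^sup>N (coord_lborel I) k"
proof -
  have [measurable]: "coord_cube (- I) \<in> sets borel" by (simp add: borel_closed closed_coord_cube)
  have m: "(\<lambda>x. indicator (coord_cube (- I)) x * k (coord_proj I x)) \<in> borel_measurable borel"
    by measurable
  have UN: "I \<union> - I = UNIV" "I \<inter> - I = {}" by auto
  have "(\<integral>\<^sup>+x. indicator (coord_cube (- I)) x * k (coord_proj I x) \<partial>lborel) =
    (\<integral>\<^sup>+x. (\<integral>\<^sup>+y. indicator (coord_cube (- I)) (x + y) * k (coord_proj I (x + y)) \<partial>coord_lborel (- I)) \<partial>coord_lborel I)"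
    using nn_integral_coord_lborel_Un[OF UN(2) m] by (simp only: UN coord_lborel_UNIV)
  \<comment> \<open>Each measure is carried by its own subspace, so projections can be inserted. The
    integrand then becomes a function of \<open>x\<close> times a function of
    \<open>y\<close>.\<close>
  also have "\<dots> = (\<integral>\<^sup>+x. (\<integral>\<^sup>+y. indicator (coord_cube (- I)) (coord_proj I x + coord_proj (- I) y) *
      k (coord_proj I (coord_proj I x + coord_proj (- I) y)) \<partial>coord_lborel (- I)) \<partial>coord_lborel I)"
    (is "_ = integral\<^sup>N _ ?H")
  proof -
    have "(\<integral>\<^sup>+y. indicator (coord_cube (- I)) (x + y) * k (coord_proj I (x + y)) \<partial>coord_lborel (- I)) =
      (\<integral>\<^sup>+y. indicator (coord_cube (- I)) (x + coord_proj (- I) y) * k (coord_proj I (x + coord_proj (- I) y)) \<partial>coord_lborel (- I))"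
      for x
      by (rule nn_integral_coord_lborel_proj[symmetric,
            of "\<lambda>y. indicator (coord_cube (- I)) (x + y) * k (coord_proj I (x + y))"]) measurable
    note 1 = this
    interpret product_sigma_finite "\<lambda>_::'n. lborel :: real measure" ..
    interpret J: finite_product_sigma_finite "\<lambda>_::'n. lborel :: real measure" "- I" by standard simp
    have "(\<lambda>x. \<integral>\<^sup>+y. indicator (coord_cube (- I)) (x + coord_proj (- I) y) * k (coord_proj I (x + coord_proj (- I) y)) \<partial>coord_lborel (- I))
      \<in> borel_measurable borel"
      unfolding coord_lborel_altdef
      by (subst nn_integral_distr) (auto intro!: J.borel_measurable_nn_integral)
    from nn_integral_coord_lborel_proj[OF this] show ?thesis by (simp add: 1)
  qed
  also have "\<dots> = (\<integral>\<^sup>+x. (\<integral>\<^sup>+y. k (coord_proj I x) * indicator (coord_cube (- I)) y \<partial>coord_lborel (- I)) \<partial>coord_lborel I)"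
  proof (intro nn_integral_cong)
    fix x y
    have "coord_proj I (coord_proj I x + coord_proj (- I) y) = coord_proj I x"
      by (auto simp: coord_proj_def vec_eq_iff)
    moreover have "coord_proj I x + coord_proj (- I) y \<in> coord_cube (- I) \<longleftrightarrow> y \<in> coord_cube (- I)"
      by (auto simp: coord_proj_def coord_cube_def)
    ultimately show "indicator (coord_cube (- I)) (coord_proj I x + coord_proj (- I) y) *
      k (coord_proj I (coord_proj I x + coord_proj (- I) y)) = k (coord_proj I x) * indicator (coord_cube (- I)) y"
      by (simp add: indicator_def)
  qed
  also have "\<dots> = (\<integral>\<^sup>+x. k (coord_proj I x) \<partial>coord_lborel I)"
    by (simp add: nn_integral_cmult_indicator emeasure_coord_cube)
  finally show ?thesis by (simp add: nn_integral_coord_lborel_proj)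
qed

lemma coord_proj_simps [simp]:
  "coord_proj I (x + y) = coord_proj I x + coord_proj I y"
  "coord_proj I (x - y) = coord_proj I x - coord_proj I y"
  "coord_proj I 0 = 0"
  by (auto simp: coord_proj_def vec_eq_iff)

lemma coord_proj_nth: "coord_proj I x $ i = (if i \<in> I then x $ i else 0)"
  by (simp add: coord_proj_def)

lemma coord_proj_axis: "coord_proj I (axis j 1) = (if j \<in> I then axis j 1 else 0)"
  by (auto simp: coord_proj_def axis_def vec_eq_iff)

text \<open>The map is extended by the identity to the product with the unit cube in the remaining
  coordinates, which turns the principal minor into the determinant of a derivative.\<close>

lemma nn_integral_coord_change_of_variables:
  fixes g :: "real^'n::finite \<Rightarrow> real^'n" and f :: "real^'n \<Rightarrow> real"
  assumes S: "S \<in> sets borel" and SI: "\<And>x. x \<in> S \<Longrightarrow> coord_proj I x = x"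
    and gI: "\<And>x. x \<in> S \<Longrightarrow> coord_proj I (g x) = g x"
    and der: "\<And>x. x \<in> S \<Longrightarrow> (g has_derivative g' x) (at x within S)"
    and inj: "inj_on g S" and nonneg: "\<And>x. 0 \<le> f x"
    and meas1: "(\<lambda>x. indicator S x * (\<bar>det (block I (matrix (g' x)))\<bar> * f (g x))) \<in> borel_measurable borel"
    and meas2: "(\<lambda>y. indicator (g ` S) y * f y) \<in> borel_measurable borel"
  shows "(\<integral>\<^sup>+y. ennreal (indicator (g ` S) y * f y) \<partial>coord_lborel I) =
    (\<integral>\<^sup>+x. ennreal (indicator S x * (\<bar>det (block I (matrix (g' x)))\<bar> * f (g x))) \<partial>coord_lborel I)"
proof -
  let ?P = "coord_proj I"
  let ?S = "{x. ?P x \<in> S \<and> x \<in> coord_cube (- I)}"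
  let ?g = "\<lambda>x. g (?P x) + (x - ?P x)"
  \<comment> \<open>Nothing is known about \<open>g'\<close> in directions outside the subspace.
    Projecting before and after it removes the corresponding entries, so that the matrix becomes
    exactly the completed block.\<close>
  let ?g' = "\<lambda>x v. ?P (g' (?P x) (?P v)) + (v - ?P v)"
  have [measurable]: "coord_cube (- I) \<in> sets borel" by (simp add: borel_closed closed_coord_cube)
  have S': "?S \<in> sets borel"
    using S by measurable
  have derP: "(?P has_derivative ?P) F" for F
    by (simp add: linear_imp_has_derivative linear_coord_proj)
  have der': "(?g has_derivative ?g' x) (at x within ?S)" if "x \<in> ?S" for x
  proof -
    have xS: "?P x \<in> S" using that by simp
    have "((\<lambda>y. ?P (g y)) has_derivative (\<lambda>v. ?P (g' (?P x) v))) (at (?P x) within S)"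
      using diff_chain_within[OF der[OF xS] derP] by (simp add: o_def)
    then have "(g has_derivative (\<lambda>v. ?P (g' (?P x) v))) (at (?P x) within S)"
      by (rule has_derivative_transform[rotated 2]) (use xS gI in auto)
    moreover have "?P ` ?S \<subseteq> S" by auto
    ultimately have "(g has_derivative (\<lambda>v. ?P (g' (?P x) v))) (at (?P x) within ?P ` ?S)"
      using has_derivative_subset by blast
    from diff_chain_within[OF derP this] show ?thesis
      by (auto intro!: derivative_intros derP simp: o_def)
  qed
  have img: "?g ` ?S = {y. ?P y \<in> g ` S \<and> y \<in> coord_cube (- I)}"
  proof (intro set_eqI iffI)
    fix y assume "y \<in> ?g ` ?S"
    then obtain x where x: "?P x \<in> S" "x \<in> coord_cube (- I)" "y = ?g x" by auto
    have "?P y = g (?P x)" using gI[OF x(1)] x by simp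
    moreover have "y $ j = x $ j" if "j \<notin> I" for j
      using that gI[OF x(1)] x(3) by (metis add.left_neutral add_diff_cancel_left' coord_proj_nth
          diff_zero vector_add_component vector_minus_component)
    ultimately show "y \<in> {y. ?P y \<in> g ` S \<and> y \<in> coord_cube (- I)}"
      using x by (auto simp: coord_cube_def)
  next
    fix y assume "y \<in> {y. ?P y \<in> g ` S \<and> y \<in> coord_cube (- I)}"
    then obtain z where z: "z \<in> S" "?P y = g z" and y: "y \<in> coord_cube (- I)" by auto
    let ?x = "z + (y - ?P y)"
    have "?P ?x = z" using SI[OF z(1)] by simp
    moreover have "?x \<in> coord_cube (- I)"
    proof -
      have "z $ j = 0" if "j \<notin> I" for j
        using that SI[OF z(1)] by (metis coord_proj_nth)
      then show ?thesis using y by (auto simp: coord_cube_def coord_proj_nth)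
    qed
    ultimately have "?x \<in> ?S" "y = ?g ?x" using z by auto
    then show "y \<in> ?g ` ?S" by blast
  qed
  have mat: "matrix (?g' x) = block I (matrix (g' (?P x)))" if "?P x \<in> S" for x
  proof -
    have "linear (g' (?P x))" using der that has_derivative_linear by blast
    then show ?thesis
      by (auto simp: matrix_def block_def vec_eq_iff coord_proj_axis coord_proj_nth linear_0)
        (auto simp: axis_def)
  qed
  let ?F = "\<lambda>x. indicator S x * (\<bar>det (block I (matrix (g' x)))\<bar> * f (g x))"
  let ?G = "\<lambda>y. indicator (g ` S) y * f y"
  have eq1: "indicator ?S x * (\<bar>det (matrix (?g' x))\<bar> * f (?P (?g x))) = indicator (coord_cube (- I)) x * ?F (?P x)" for x
    using gI by (cases "?P x \<in> S") (auto simp: mat indicator_def)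
  have eq2: "indicator (?g ` ?S) y * f (?P y) = indicator (coord_cube (- I)) y * ?G (?P y)" for y
    unfolding img by (auto simp: indicator_def)
  have slab: "(\<integral>\<^sup>+x. ennreal (indicator (coord_cube (- I)) x * k (?P x)) \<partial>lborel) =
      (\<integral>\<^sup>+x. ennreal (k x) \<partial>coord_lborel I)" if "k \<in> borel_measurable borel" for k
    using that by (subst nn_integral_lborel_slab[symmetric]) (auto intro!: nn_integral_cong simp: indicator_def)
  have "(\<integral>\<^sup>+y. ennreal (indicator (?g ` ?S) y * f (?P y)) \<partial>lborel) =
    (\<integral>\<^sup>+x. ennreal (indicator ?S x * (\<bar>det (matrix (?g' x))\<bar> * f (?P (?g x)))) \<partial>lborel)"
  proof (rule nn_integral_change_of_variables[OF S' der'])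
    show "inj_on ?g ?S"
    proof (rule inj_onI)
      fix x y assume x: "x \<in> ?S" and y: "y \<in> ?S" and eq: "?g x = ?g y"
      have "?P (?g x) = ?P (?g y)" using eq by simp
      then have "g (?P x) = g (?P y)" using x y gI by simp
      then have "?P x = ?P y" using inj x y by (auto dest: inj_onD)
      then show "x = y" using eq by simp
    qed
    show "(\<lambda>x. indicator ?S x * (\<bar>det (matrix (?g' x))\<bar> * f (?P (?g x)))) \<in> borel_measurable borel"
      unfolding eq1 using measurable_compose[OF coord_proj_measurable meas1] by measurable
    show "(\<lambda>y. indicator (?g ` ?S) y * f (?P y)) \<in> borel_measurable borel"
      unfolding eq2 using measurable_compose[OF coord_proj_measurable meas2] by measurable
  qed (use nonneg in auto)
  then show ?thesis
    unfolding eq1 eq2 slab[OF meas1] slab[OF meas2] .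
qed

section \<open>Smooth functions on sets with boundary\<close>

text \<open>The condition under which derivatives within \<open>S\<close> are determined in the
  directions of \<open>I\<close>, also at boundary points: a one-sided segment in each of these
  directions lies in \<open>S\<close>.\<close>

definition inward :: "'n::finite set \<Rightarrow> (real^'n) set \<Rightarrow> bool" where
  "inward I S \<longleftrightarrow> (\<forall>x\<in>S. \<forall>i\<in>I. \<forall>\<^sub>F t in at_right 0. x + t *\<^sub>R axis i 1 \<in> S)"

text \<open>Along the ray from \<open>x\<close> in direction \<open>v\<close> both
  \<open>f' v\<close> and \<open>f'' v\<close> are the vector derivative at parameter 0, which is a
  limit point of the admissible parameters.\<close>

lemma has_derivative_unique_direction:
  assumes f': "(f has_derivative f') (at x within S)" and f'': "(f has_derivative f'') (at x within S)"
    and v: "\<forall>\<^sub>F t in at_right 0. x + t *\<^sub>R v \<in> S"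
  shows "f' v = f'' v"
proof -
  define T where "T = {t::real. 0 < t \<and> x + t *\<^sub>R v \<in> S}"
  have nbot: "at 0 within T \<noteq> bot"
  proof -
    from v obtain e where e: "e > 0" "\<And>t. 0 < t \<Longrightarrow> t < e \<Longrightarrow> x + t *\<^sub>R v \<in> S"
      by (auto simp: eventually_at_right_field)
    have "0 islimpt T"
      unfolding islimpt_approachable
    proof (intro allI impI)
      fix d :: real assume "0 < d"
      then show "\<exists>t\<in>T. t \<noteq> 0 \<and> dist t 0 < d"
        using e by (intro bexI[where x = "min d e / 2"]) (auto simp: T_def)
    qed
    then show ?thesis by (simp add: trivial_limit_within)
  qed
  have "((\<lambda>t. f (x + t *\<^sub>R v)) has_vector_derivative g v) (at 0 within T)"
    if g: "(f has_derivative g) (at x within S)" for g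
  proof -
    have 1: "((\<lambda>t. x + t *\<^sub>R v) has_derivative (\<lambda>t. t *\<^sub>R v)) (at 0 within T)"
      by (auto intro!: derivative_eq_intros)
    have "(\<lambda>t. x + t *\<^sub>R v) ` T \<subseteq> S" by (auto simp: T_def)
    then have "(f has_derivative g) (at (x + 0 *\<^sub>R v) within (\<lambda>t. x + t *\<^sub>R v) ` T)"
      using has_derivative_subset[OF g] by simp
    from diff_chain_within[OF 1 this] show ?thesis
      using linear_scale[OF has_derivative_linear[OF g]] by (simp add: has_vector_derivative_def o_def)
  qed
  from vector_derivative_unique_within[OF nbot this[OF f'] this[OF f'']] show ?thesis .
qed

text \<open>Any derivative within \<open>S\<close> may be used to compute the partial derivative, in
  particular that of a smooth extension.\<close>

lemma coord_deriv_eq: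
  assumes "inward I S" "x \<in> S" "i \<in> I" and f': "(f has_derivative f') (at x within S)"
  shows "coord_deriv S f i x = f' (axis i 1)"
  unfolding coord_deriv_def
proof (rule has_derivative_unique_direction[OF _ f'])
  have "f differentiable (at x within S)" using f' by (rule differentiableI)
  then show "(f has_derivative frechet_derivative f (at x within S)) (at x within S)"
    by (simp only: frechet_derivative_works)
  show "\<forall>\<^sub>F t in at_right 0. x + t *\<^sub>R axis i 1 \<in> S"
    using assms by (auto simp: inward_def)
qed

lemma has_derivative_unique_inward:
  fixes f :: "real^'n::finite \<Rightarrow> 'b::real_normed_vector"
  assumes "inward UNIV S" "x \<in> S" and f': "(f has_derivative f') (at x within S)"
    and f'': "(f has_derivative f'') (at x within S)"
  shows "f' = f''"
proof (rule linear_eq_stdbasis[OF has_derivative_linear[OF f'] has_derivative_linear[OF f'']])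
  fix b :: "real^'n" assume "b \<in> Basis"
  then obtain i where "b = axis i 1" by (auto simp: Basis_vec_def)
  moreover have "f' (axis i 1) = f'' (axis i 1)"
    using assms(1,2) by (intro has_derivative_unique_direction[OF f' f'']) (simp add: inward_def)
  ultimately show "f' b = f'' b" by simp
qed

lemma frechet_derivative_inward:
  fixes f :: "real^'n::finite \<Rightarrow> 'b::real_normed_vector"
  assumes "inward UNIV S" "x \<in> S" and f': "(f has_derivative f') (at x within S)"
  shows "frechet_derivative f (at x within S) = f'"
proof (rule has_derivative_unique_inward[OF assms(1,2) _ f'])
  have "f differentiable (at x within S)" using f' by (rule differentiableI)
  then show "(f has_derivative frechet_derivative f (at x within S)) (at x within S)"
    by (simp only: frechet_derivative_works)
qed

lemma linear_sum_axis:
  fixes f :: "real^'n::finite \<Rightarrow> 'b::real_vector"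
  assumes "linear f"
  shows "f v = (\<Sum>i\<in>UNIV. v $ i *\<^sub>R f (axis i 1))"
proof -
  have "f v = f (\<Sum>i\<in>UNIV. v $ i *\<^sub>R axis i 1)"
    by (simp add: basis_expansion flip: scalar_mult_eq_scaleR)
  also have "\<dots> = (\<Sum>i\<in>UNIV. f (v $ i *\<^sub>R axis i 1))" by (rule linear_sum[OF assms])
  also have "\<dots> = (\<Sum>i\<in>UNIV. v $ i *\<^sub>R f (axis i 1))"
    by (intro sum.cong refl linear_scale[OF assms])
  finally show ?thesis .
qed

lemma Ck_on_has_derivative:
  assumes "open W" "Ck_on (Suc k) f W" "x \<in> W"
  shows "(f has_derivative frechet_derivative f (at x)) (at x)"
proof -
  have "f differentiable (at x within W)"
    using assms(2,3) by (simp add: differentiable_on_def)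
  then have "f differentiable (at x)"
    by (simp only: at_within_open[OF assms(3,1)])
  then show ?thesis by (simp only: frechet_derivative_works)
qed

lemma Ck_on_cong:
  assumes W: "open W" and "\<And>x. x \<in> W \<Longrightarrow> f x = g x" and "Ck_on k f W"
  shows "Ck_on k g W"
  using assms(2,3)
proof (induction k arbitrary: f g)
  case 0
  then show ?case by (simp cong: continuous_on_cong)
next
  case (Suc k)
  have gd: "(g has_derivative frechet_derivative f (at x)) (at x)" if "x \<in> W" for x
    by (rule has_derivative_transform_within_open[OF Ck_on_has_derivative[OF W Suc.prems(2) that] W that])
      (rule Suc.prems(1))
  have "g differentiable_on W"
    unfolding differentiable_on_def using gd differentiableI has_derivative_at_withinI by blast
  moreover have "Ck_on k (\<lambda>x. frechet_derivative g (at x) v) W" for v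
  proof (rule Suc.IH[of "\<lambda>x. frechet_derivative f (at x) v"])
    show "frechet_derivative f (at x) v = frechet_derivative g (at x) v" if "x \<in> W" for x
      using frechet_derivative_at[OF gd[OF that]] by simp
    show "Ck_on k (\<lambda>x. frechet_derivative f (at x) v) W" using Suc.prems(2) by simp
  qed
  ultimately show ?case by simp
qed

text \<open>A local smooth extension supplies the derivative within \<open>S\<close> at all points
  of \<open>S\<close> in its domain, not only at \<open>x\<close>. This makes a second
  differentiation possible.\<close>

lemma smooth_onE:
  assumes "smooth_on S f" "x \<in> S"
  obtains W g where "open W" "x \<in> W" "\<And>k. Ck_on k g W" "\<And>y. y \<in> S \<inter> W \<Longrightarrow> f y = g y"
    "\<And>y. y \<in> S \<inter> W \<Longrightarrow> (f has_derivative frechet_derivative g (at y)) (at y within S)"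
proof -
  from assms obtain W g where W: "open W" "x \<in> W" "\<And>k. Ck_on k g W" "\<And>y. y \<in> S \<inter> W \<Longrightarrow> f y = g y"
    unfolding smooth_on_def by metis
  have "(f has_derivative frechet_derivative g (at y)) (at y within S)" if y: "y \<in> S \<inter> W" for y
  proof (rule has_derivative_transform_eventually)
    show "(g has_derivative frechet_derivative g (at y)) (at y within S)"
      using Ck_on_has_derivative[OF W(1) W(3)] y by (auto intro: has_derivative_at_withinI)
    have "\<forall>\<^sub>F z in at y within S. z \<in> W \<and> z \<in> S"
      using y W(1) by (auto simp: eventually_at_topological)
    then show "\<forall>\<^sub>F z in at y within S. g z = f z"
      by (rule eventually_mono) (use W(4) in auto)
  qed (use y W(4) in auto)
  with W show thesis by (auto intro: that)
qed

lemma smooth_on_subset: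
  assumes "smooth_on S f" "T \<subseteq> S"
  shows "smooth_on T f"
  unfolding smooth_on_def
proof
  fix x assume "x \<in> T"
  from bspec[OF assms(1)[unfolded smooth_on_def] subsetD[OF assms(2) this]]
  obtain W g where "open W" "x \<in> W" "\<forall>k. Ck_on k g W" "\<forall>y\<in>S \<inter> W. f y = g y"
    by (elim exE conjE)
  with assms show "\<exists>W g. open W \<and> x \<in> W \<and> (\<forall>k. Ck_on k g W) \<and> (\<forall>y\<in>T \<inter> W. f y = g y)"
    by (intro exI[of _ W] exI[of _ g]) auto
qed

lemma smooth_on_has_derivative:
  assumes "smooth_on S f" "x \<in> S"
  shows "(f has_derivative frechet_derivative f (at x within S)) (at x within S)"
proof -
  have "f differentiable (at x within S)"
    by (rule smooth_onE[OF assms]) (use assms differentiableI in blast)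
  then show ?thesis by (simp only: frechet_derivative_works)
qed

lemma smooth_on_continuous:
  assumes "smooth_on S f"
  shows "continuous_on S f"
  unfolding continuous_on_eq_continuous_within
  using has_derivative_continuous[OF smooth_on_has_derivative[OF assms]] by blast

text \<open>The partial derivative of a local extension extends the partial derivative, because
  \<open>inward\<close> makes the latter independent of the extension.\<close>

lemma smooth_on_coord_deriv:
  assumes S: "inward I S" "i \<in> I" and f: "smooth_on S f"
  shows "smooth_on S (coord_deriv S f i)"
  unfolding smooth_on_def
proof
  fix x assume "x \<in> S"
  from smooth_onE[OF f this] obtain W g where W: "open W" "x \<in> W" "\<And>k. Ck_on k g W"
    "\<And>y. y \<in> S \<inter> W \<Longrightarrow> (f has_derivative frechet_derivative g (at y)) (at y within S)"
    by metis
  have "\<forall>y\<in>S \<inter> W. coord_deriv S f i y = frechet_derivative g (at y) (axis i 1)"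
    using coord_deriv_eq[OF S(1) _ S(2) W(4)] by auto
  moreover have "\<forall>k. Ck_on k (\<lambda>y. frechet_derivative g (at y) (axis i 1)) W"
    using W(3)[of "Suc _"] by simp
  ultimately show "\<exists>W g. open W \<and> x \<in> W \<and> (\<forall>k. Ck_on k g W) \<and> (\<forall>y\<in>S \<inter> W. coord_deriv S f i y = g y)"
    using W(1,2) by blast
qed

text \<open>The mean value theorem is applied twice: in direction \<open>u\<close> to the increment
  of \<open>g\<close> along \<open>t *\<^sub>R v\<close>, then in direction \<open>v\<close> to the
  derivative along \<open>u\<close>. The left side is symmetric in \<open>u\<close> and
  \<open>v\<close>.\<close>

lemma second_difference:
  fixes g :: "'a::euclidean_space \<Rightarrow> real"
  assumes C2: "Ck_on (Suc (Suc 0)) g W" and "open W" and t: "0 < t"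
    and W: "\<And>r s. 0 \<le> r \<Longrightarrow> r \<le> t \<Longrightarrow> 0 \<le> s \<Longrightarrow> s \<le> t \<Longrightarrow> x + r *\<^sub>R u + s *\<^sub>R v \<in> W"
  obtains r s where "0 < r" "r < t" "0 < s" "s < t"
    "g (x + t *\<^sub>R u + t *\<^sub>R v) - g (x + t *\<^sub>R u) - g (x + t *\<^sub>R v) + g x =
      t\<^sup>2 * frechet_derivative (\<lambda>y. frechet_derivative g (at y) u) (at (x + r *\<^sub>R u + s *\<^sub>R v)) v"
proof -
  let ?gu = "\<lambda>y. frechet_derivative g (at y) u"
  have dg: "(g has_derivative frechet_derivative g (at y)) (at y)" if "y \<in> W" for y
    using Ck_on_has_derivative[OF \<open>open W\<close> C2] that by simp
  have dgu: "(?gu has_derivative frechet_derivative ?gu (at y)) (at y)" if "y \<in> W" for y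
    using Ck_on_has_derivative[OF \<open>open W\<close>, of 0 ?gu] C2 that by simp
  have line: "((\<lambda>r. h (p + r *\<^sub>R w)) has_real_derivative h' w) (at r)"
    if "(h has_derivative h') (at (p + r *\<^sub>R w))" for h :: "'a \<Rightarrow> real" and h' p w r
  proof -
    have "((\<lambda>r. p + r *\<^sub>R w) has_derivative (\<lambda>r. r *\<^sub>R w)) (at r)"
      by (auto intro!: derivative_eq_intros)
    from diff_chain_at[OF this that] show ?thesis
      using linear_scale[OF has_derivative_linear[OF that]]
      by (simp add: has_field_derivative_def o_def mult_commute_abs)
  qed
  have "\<exists>r>0. r < t \<and> (g (x + t *\<^sub>R v + t *\<^sub>R u) - g (x + t *\<^sub>R u)) - (g (x + t *\<^sub>R v + 0 *\<^sub>R u) - g (x + 0 *\<^sub>R u)) =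
      (t - 0) * (?gu (x + t *\<^sub>R v + r *\<^sub>R u) - ?gu (x + r *\<^sub>R u))"
  proof (rule MVT2[OF t])
    fix r assume r: "0 \<le> r" "r \<le> t"
    then show "((\<lambda>r. g (x + t *\<^sub>R v + r *\<^sub>R u) - g (x + r *\<^sub>R u)) has_real_derivative
        ?gu (x + t *\<^sub>R v + r *\<^sub>R u) - ?gu (x + r *\<^sub>R u)) (at r)"
      using W[OF r, of t] W[OF r, of 0] t
      by (intro DERIV_diff line dg) (auto simp: add_ac)
  qed
  then obtain r where r: "0 < r" "r < t" and eq1:
    "(g (x + t *\<^sub>R v + t *\<^sub>R u) - g (x + t *\<^sub>R u)) - (g (x + t *\<^sub>R v) - g x) =
      t * (?gu (x + t *\<^sub>R v + r *\<^sub>R u) - ?gu (x + r *\<^sub>R u))"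
    by auto
  have "\<exists>s>0. s < t \<and> ?gu (x + r *\<^sub>R u + t *\<^sub>R v) - ?gu (x + r *\<^sub>R u + 0 *\<^sub>R v) =
      (t - 0) * frechet_derivative ?gu (at (x + r *\<^sub>R u + s *\<^sub>R v)) v"
    using W r by (intro MVT2[OF t] line dgu) auto
  then obtain s where s: "0 < s" "s < t" and eq2:
    "?gu (x + r *\<^sub>R u + t *\<^sub>R v) - ?gu (x + r *\<^sub>R u) = t * frechet_derivative ?gu (at (x + r *\<^sub>R u + s *\<^sub>R v)) v"
    by auto
  have "x + r *\<^sub>R u + t *\<^sub>R v = x + t *\<^sub>R v + r *\<^sub>R u" "x + t *\<^sub>R u + t *\<^sub>R v = x + t *\<^sub>R v + t *\<^sub>R u"
    by (simp_all add: add_ac)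
  then show thesis
    using eq1 eq2 that[OF r s] by (simp add: power2_eq_square algebra_simps)
qed

text \<open>Swapping \<open>u\<close> and \<open>v\<close> leaves the second difference unchanged,
  so the two mixed derivatives take a common value at points arbitrarily close to \<open>x\<close>;
  by continuity they cannot differ at \<open>x\<close>.\<close>

lemma symmetric_second_derivative_real:
  fixes g :: "'a::euclidean_space \<Rightarrow> real"
  assumes C2: "Ck_on (Suc (Suc 0)) g W" and "open W" "x \<in> W"
  shows "frechet_derivative (\<lambda>y. frechet_derivative g (at y) u) (at x) v =
    frechet_derivative (\<lambda>y. frechet_derivative g (at y) v) (at x) u"
    (is "?uv x = ?vu x")
proof (rule ccontr)
  assume ne: "?uv x \<noteq> ?vu x"
  define e where "e = \<bar>?uv x - ?vu x\<bar> / 2"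
  have "0 < e" using ne by (simp add: e_def)
  have cont: "continuous_on W ?uv" "continuous_on W ?vu" using C2 by auto
  have "isCont ?uv x" "isCont ?vu x"
    using cont assms by (simp_all add: continuous_on_eq_continuous_at)
  then obtain d1 d2 where d: "0 < d1" "0 < d2" "\<And>y. dist y x < d1 \<Longrightarrow> dist (?uv y) (?uv x) < e"
    "\<And>y. dist y x < d2 \<Longrightarrow> dist (?vu y) (?vu x) < e"
    using \<open>0 < e\<close> unfolding continuous_at_eps_delta by metis
  obtain d3 where d3: "0 < d3" "ball x d3 \<subseteq> W" using assms open_contains_ball by blast
  define c where "c = norm u + norm v + 1"
  have c: "0 < c" by (simp add: c_def add_nonneg_pos)
  \<comment> \<open>\<open>t * c\<close> is half of the smallest of the three radii and bounds the
    distance from \<open>x\<close> to any point of the parallelogram; the summand 1 in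
    \<open>c\<close> keeps the divisor positive.\<close>
  define t where "t = min d1 (min d2 d3) / c / 2"
  have t: "0 < t" using d d3 c by (simp add: t_def)
  have near: "dist (x + r *\<^sub>R u + s *\<^sub>R v) x < min d1 (min d2 d3)" if "0 \<le> r" "r \<le> t" "0 \<le> s" "s \<le> t" for r s
  proof -
    have "dist (x + r *\<^sub>R u + s *\<^sub>R v) x \<le> r * norm u + s * norm v"
      using that norm_triangle_ineq[of "r *\<^sub>R u" "s *\<^sub>R v"] by (simp add: dist_norm)
    also have "\<dots> \<le> t * norm u + t * norm v" using that by (intro add_mono mult_right_mono) auto
    also have "\<dots> \<le> t * c" using t by (simp add: c_def algebra_simps)
    also have "\<dots> = min d1 (min d2 d3) / 2" using c by (simp add: t_def)
    also have "\<dots> < min d1 (min d2 d3)" using d d3 by linarith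
    finally show ?thesis .
  qed
  have W: "x + r *\<^sub>R u + s *\<^sub>R v \<in> W" if "0 \<le> r" "r \<le> t" "0 \<le> s" "s \<le> t" for r s
    using near[OF that] d3 by (auto simp: dist_commute)
  have W': "x + r *\<^sub>R v + s *\<^sub>R u \<in> W" if "0 \<le> r" "r \<le> t" "0 \<le> s" "s \<le> t" for r s
    using W[OF that(3,4,1,2)] by (simp add: add_ac)
  obtain r s where rs: "0 < r" "r < t" "0 < s" "s < t"
    and eq: "g (x + t *\<^sub>R u + t *\<^sub>R v) - g (x + t *\<^sub>R u) - g (x + t *\<^sub>R v) + g x = t\<^sup>2 * ?uv (x + r *\<^sub>R u + s *\<^sub>R v)"
    by (rule second_difference[OF C2 \<open>open W\<close> t W]) auto
  obtain r' s' where rs': "0 < r'" "r' < t" "0 < s'" "s' < t"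
    and eq': "g (x + t *\<^sub>R v + t *\<^sub>R u) - g (x + t *\<^sub>R v) - g (x + t *\<^sub>R u) + g x = t\<^sup>2 * ?vu (x + r' *\<^sub>R v + s' *\<^sub>R u)"
    by (rule second_difference[OF C2 \<open>open W\<close> t W']) auto
  have swap: "x + t *\<^sub>R v + t *\<^sub>R u = x + t *\<^sub>R u + t *\<^sub>R v" "x + r' *\<^sub>R v + s' *\<^sub>R u = x + s' *\<^sub>R u + r' *\<^sub>R v"
    by (simp_all add: add_ac)
  have "t\<^sup>2 * ?uv (x + r *\<^sub>R u + s *\<^sub>R v) = t\<^sup>2 * ?vu (x + s' *\<^sub>R u + r' *\<^sub>R v)"
    using eq eq' unfolding swap by linarith
  then have "?uv (x + r *\<^sub>R u + s *\<^sub>R v) = ?vu (x + s' *\<^sub>R u + r' *\<^sub>R v)"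
    using t by simp
  moreover have "dist (?uv (x + r *\<^sub>R u + s *\<^sub>R v)) (?uv x) < e"
    using near[of r s] rs by (intro d) auto
  moreover have "dist (?vu (x + s' *\<^sub>R u + r' *\<^sub>R v)) (?vu x) < e"
    using near[of s' r'] rs' by (intro d) auto
  ultimately show False by (simp add: e_def dist_real_def field_simps abs_if split: if_splits)
qed

text \<open>Used to reduce vector-valued maps to real components: the same component of a local
  extension is a local extension of the component.\<close>

lemma smooth_on_inner:
  assumes "smooth_on S f"
  shows "smooth_on S (\<lambda>x. f x \<bullet> b)"
proof -
  have C: "Ck_on k (\<lambda>x. g x \<bullet> b) W" if "open W" "\<And>k. Ck_on k g W" for g :: "'a \<Rightarrow> 'b" and W k
    using that(2)
  proof (induction k arbitrary: g)
    case 0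
    from 0[of 0] show ?case by (simp add: continuous_on_inner)
  next
    case (Suc k)
    have d: "((\<lambda>x. g x \<bullet> b) has_derivative (\<lambda>v. frechet_derivative g (at x) v \<bullet> b)) (at x)" if "x \<in> W" for x
      using Ck_on_has_derivative[OF \<open>open W\<close> Suc.prems that] by (auto intro!: derivative_eq_intros)
    have diff: "(\<lambda>x. g x \<bullet> b) differentiable_on W"
      unfolding differentiable_on_def using d by (meson differentiableI has_derivative_at_withinI)
    have fd: "frechet_derivative (\<lambda>x. g x \<bullet> b) (at x) v = frechet_derivative g (at x) v \<bullet> b" if "x \<in> W" for x v
      using frechet_derivative_at[OF d[OF that]] by (simp add: fun_eq_iff)
    have "Ck_on k (\<lambda>x. frechet_derivative g (at x) v \<bullet> b) W" for v
      by (rule Suc.IH) (use Suc.prems[of "Suc _"] in simp)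
    then have "Ck_on k (\<lambda>x. frechet_derivative (\<lambda>x. g x \<bullet> b) (at x) v) W" for v
      by (rule Ck_on_cong[OF \<open>open W\<close>, rotated]) (simp add: fd)
    with diff show ?case by simp
  qed
  show ?thesis
    unfolding smooth_on_def
  proof
    fix x assume "x \<in> S"
    from smooth_onE[OF assms this] obtain W g where "open W" "x \<in> W" "\<And>k. Ck_on k g W"
      "\<And>y. y \<in> S \<inter> W \<Longrightarrow> f y = g y" by metis
    with C show "\<exists>W g. open W \<and> x \<in> W \<and> (\<forall>k. Ck_on k g W) \<and> (\<forall>y\<in>S \<inter> W. f y \<bullet> b = g y)"
      by (intro exI[of _ W] exI[of _ "\<lambda>x. g x \<bullet> b"]) auto
  qed
qed

text \<open>Both second derivatives are read off a smooth extension, so the boundary points of \<open>S\<close> need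
  no special treatment.\<close>

lemma coord_deriv_commute_real:
  fixes f :: "real^'n::finite \<Rightarrow> real"
  assumes S: "inward UNIV S" and f: "smooth_on S f" and x: "x \<in> S"
  shows "coord_deriv S (coord_deriv S f j) i x = coord_deriv S (coord_deriv S f i) j x"
proof -
  from smooth_onE[OF f x] obtain W g where W: "open W" "x \<in> W" "\<And>k. Ck_on k g W"
    "\<And>y. y \<in> S \<inter> W \<Longrightarrow> (f has_derivative frechet_derivative g (at y)) (at y within S)"
    by metis
  let ?h = "\<lambda>i y. frechet_derivative g (at y) (axis i 1)"
  have 1: "coord_deriv S f i y = ?h i y" if "y \<in> S \<inter> W" for y i
    using coord_deriv_eq[OF S _ _ W(4)] that by auto
  have 2: "coord_deriv S (coord_deriv S f j) i x = frechet_derivative (?h j) (at x) (axis i 1)" for i j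
  proof (rule coord_deriv_eq[OF S x])
    have "Ck_on (Suc 0) (?h j) W" using W(3)[of "Suc (Suc 0)"] by simp
    then have "(?h j has_derivative frechet_derivative (?h j) (at x)) (at x within S)"
      using Ck_on_has_derivative[OF W(1) _ W(2)] has_derivative_at_withinI by blast
    then show "(coord_deriv S f j has_derivative frechet_derivative (?h j) (at x)) (at x within S)"
    proof (rule has_derivative_transform_eventually)
      have "\<forall>\<^sub>F z in at x within S. z \<in> W \<and> z \<in> S"
        using W(1,2) by (auto simp: eventually_at_topological)
      then show "\<forall>\<^sub>F z in at x within S. ?h j z = coord_deriv S f j z"
        by (rule eventually_mono) (simp add: 1)
    qed (use x W(2) 1 in auto)
  qed simp
  show ?thesis
    unfolding 2 by (rule symmetric_second_derivative_real[OF W(3) W(1,2)])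
qed

text \<open>\<open>coord_deriv\<close> commutes with the inner product with a fixed vector, so the
  real case applies to each component.\<close>

lemma coord_deriv_commute:
  fixes f :: "real^'n::finite \<Rightarrow> 'b::euclidean_space"
  assumes S: "inward UNIV S" and f: "smooth_on S f" and x: "x \<in> S"
  shows "coord_deriv S (coord_deriv S f j) i x = coord_deriv S (coord_deriv S f i) j x"
proof (rule euclidean_eqI)
  fix b :: 'b
  have inner: "coord_deriv S (\<lambda>y. h y \<bullet> b) k y = coord_deriv S h k y \<bullet> b"
    if "smooth_on S h" "y \<in> S" for h :: "real^'n \<Rightarrow> 'b" and k y
  proof -
    note d = smooth_on_has_derivative[OF that]
    have "((\<lambda>y. h y \<bullet> b) has_derivative (\<lambda>v. frechet_derivative h (at y within S) v \<bullet> b)) (at y within S)"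
      using d by (auto intro!: derivative_eq_intros)
    from coord_deriv_eq[OF S that(2) _ this] coord_deriv_eq[OF S that(2) _ d] show ?thesis by simp
  qed
  have sm: "smooth_on S (coord_deriv S f k)" for k
    by (rule smooth_on_coord_deriv[OF S _ f]) simp
  have "coord_deriv S (coord_deriv S f k) l x \<bullet> b = coord_deriv S (coord_deriv S (\<lambda>y. f y \<bullet> b) k) l x" for k l
  proof -
    have "coord_deriv S (coord_deriv S f k) l x \<bullet> b = coord_deriv S (\<lambda>y. coord_deriv S f k y \<bullet> b) l x"
      using inner[OF sm x] by simp
    also have "\<dots> = coord_deriv S (coord_deriv S (\<lambda>y. f y \<bullet> b) k) l x"
    proof -
      have "(coord_deriv S (\<lambda>y. f y \<bullet> b) k has_derivative frechet_derivative (\<lambda>y. coord_deriv S f k y \<bullet> b) (at x within S)) (at x within S)"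
        by (rule has_derivative_transform[OF x _ smooth_on_has_derivative[OF smooth_on_inner[OF sm] x]])
          (simp add: inner[OF f])
      from coord_deriv_eq[OF S x UNIV_I this, of l] show ?thesis
        unfolding coord_deriv_def[of S "\<lambda>y. coord_deriv S f k y \<bullet> b"] by simp
    qed
    finally show ?thesis .
  qed
  then show "coord_deriv S (coord_deriv S f j) i x \<bullet> b = coord_deriv S (coord_deriv S f i) j x \<bullet> b"
    using coord_deriv_commute_real[OF S smooth_on_inner[OF f] x] by simp
qed

text \<open>Continuity of the derivative is asked for in each fixed direction, which in finite
  dimension amounts to continuous differentiability without an operator norm. The class contains the
  metric coefficients and their inverses as well as the bump functions, which are not
  smooth.\<close>

definition C1_on :: "'a::real_normed_vector set \<Rightarrow> ('a \<Rightarrow> 'b::real_normed_vector) \<Rightarrow> bool" where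
  "C1_on S f \<longleftrightarrow> (\<exists>f'. (\<forall>x\<in>S. (f has_derivative f' x) (at x within S)) \<and>
    (\<forall>v. continuous_on S (\<lambda>x. f' x v)))"

lemma C1_onE:
  assumes "C1_on S f"
  obtains f' where "\<And>x. x \<in> S \<Longrightarrow> (f has_derivative f' x) (at x within S)"
    "\<And>v. continuous_on S (\<lambda>x. f' x v)"
  using assms unfolding C1_on_def by blast

lemma C1_onI:
  assumes "\<And>x. x \<in> S \<Longrightarrow> (f has_derivative f' x) (at x within S)"
    "\<And>v. continuous_on S (\<lambda>x. f' x v)"
  shows "C1_on S f"
  using assms unfolding C1_on_def by blast

lemma C1_on_continuous:
  assumes "C1_on S f"
  shows "continuous_on S f"
  unfolding continuous_on_eq_continuous_within
proof
  fix x assume x: "x \<in> S"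
  obtain f' where "\<forall>x\<in>S. (f has_derivative f' x) (at x within S)"
    "\<forall>v. continuous_on S (\<lambda>x. f' x v)"
    using assms unfolding C1_on_def by (elim exE conjE)
  note f' = this[rule_format]
  show "continuous (at x within S) f" by (rule has_derivative_continuous[OF f'(1)[OF x]])
qed

lemma C1_on_has_derivative:
  assumes "C1_on S f" "x \<in> S"
  shows "(f has_derivative frechet_derivative f (at x within S)) (at x within S)"
proof -
  have "f differentiable (at x within S)"
    by (rule C1_onE[OF assms(1)]) (rule differentiableI, use assms(2) in blast)
  then show ?thesis by (simp only: frechet_derivative_works)
qed

lemma C1_on_cong:
  assumes "C1_on S f" "\<And>x. x \<in> S \<Longrightarrow> g x = f x"
  shows "C1_on S g"
proof (rule C1_onE[OF assms(1)])
  fix f' assume "\<And>x. x \<in> S \<Longrightarrow> (f has_derivative f' x) (at x within S)"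
    and "\<And>v. continuous_on S (\<lambda>x. f' x v)"
  then show ?thesis
    by (intro C1_onI[where f' = f'] has_derivative_transform[of _ S g f] assms(2))
qed

lemma C1_on_const [simp]: "C1_on S (\<lambda>x. c)"
  by (rule C1_onI[where f' = "\<lambda>x v. 0"]) auto

lemma C1_on_bounded_linear:
  assumes "bounded_linear l" "C1_on S f"
  shows "C1_on S (\<lambda>x. l (f x))"
proof (rule C1_onE[OF assms(2)])
  fix f' assume f': "\<And>x. x \<in> S \<Longrightarrow> (f has_derivative f' x) (at x within S)"
    "\<And>v. continuous_on S (\<lambda>x. f' x v)"
  show ?thesis
    by (rule C1_onI[where f' = "\<lambda>x v. l (f' x v)"])
      (auto intro!: bounded_linear.has_derivative[OF assms(1)] bounded_linear.continuous_on[OF assms(1)] f')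
qed

lemma C1_on_add:
  assumes "C1_on S f" "C1_on S g"
  shows "C1_on S (\<lambda>x. f x + g x)"
proof -
  obtain f' where "\<forall>x\<in>S. (f has_derivative f' x) (at x within S)"
    "\<forall>v. continuous_on S (\<lambda>x. f' x v)"
    using assms(1) unfolding C1_on_def by (elim exE conjE)
  note f' = this[rule_format]
  obtain g' where "\<forall>x\<in>S. (g has_derivative g' x) (at x within S)"
    "\<forall>v. continuous_on S (\<lambda>x. g' x v)"
    using assms(2) unfolding C1_on_def by (elim exE conjE)
  note g' = this[rule_format]
  note d = f' g'
  show ?thesis
    by (rule C1_onI[where f' = "\<lambda>x v. f' x v + g' x v"]) (auto intro!: has_derivative_add continuous_on_add d)
qed

lemma C1_on_sum: "(\<And>i. i \<in> A \<Longrightarrow> C1_on S (f i)) \<Longrightarrow> C1_on S (\<lambda>x. \<Sum>i\<in>A. f i x)"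
  by (induction A rule: infinite_finite_induct) (auto intro: C1_on_add)

lemma C1_on_bounded_bilinear:
  assumes B: "bounded_bilinear B" and "C1_on S f" "C1_on S g"
  shows "C1_on S (\<lambda>x. B (f x) (g x))"
proof -
  obtain f' where "\<forall>x\<in>S. (f has_derivative f' x) (at x within S)"
    "\<forall>v. continuous_on S (\<lambda>x. f' x v)"
    using assms(2) unfolding C1_on_def by (elim exE conjE)
  note f' = this[rule_format]
  obtain g' where "\<forall>x\<in>S. (g has_derivative g' x) (at x within S)"
    "\<forall>v. continuous_on S (\<lambda>x. g' x v)"
    using assms(3) unfolding C1_on_def by (elim exE conjE)
  note g' = this[rule_format]
  note d = f' g'
  show ?thesis
    by (rule C1_onI[where f' = "\<lambda>x v. B (f x) (g' x v) + B (f' x v) (g x)"])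
      (auto intro!: bounded_bilinear.FDERIV[OF B] continuous_on_add bounded_bilinear.continuous_on[OF B]
        d C1_on_continuous[OF assms(2)] C1_on_continuous[OF assms(3)])
qed

lemmas C1_on_scaleR = C1_on_bounded_bilinear[OF bounded_bilinear_scaleR]
lemmas C1_on_mult = C1_on_bounded_bilinear[OF bounded_bilinear_mult]

lemma C1_on_prod:
  fixes f :: "'i \<Rightarrow> 'a::real_normed_vector \<Rightarrow> 'b::real_normed_field"
  shows "(\<And>i. i \<in> A \<Longrightarrow> C1_on S (f i)) \<Longrightarrow> C1_on S (\<lambda>x. \<Prod>i\<in>A. f i x)"
  by (induction A rule: infinite_finite_induct) (auto intro: C1_on_mult)

lemma C1_on_compose_real:
  fixes f :: "'a::real_normed_vector \<Rightarrow> real"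
  assumes f: "C1_on S f" and h: "\<And>x. x \<in> S \<Longrightarrow> (h has_real_derivative h' (f x)) (at (f x))"
    and h': "continuous_on (f ` S) h'"
  shows "C1_on S (\<lambda>x. h (f x))"
proof (rule C1_onE[OF f])
  fix f' assume f': "\<And>x. x \<in> S \<Longrightarrow> (f has_derivative f' x) (at x within S)"
    "\<And>v. continuous_on S (\<lambda>x. f' x v)"
  have "continuous_on S (\<lambda>x. h' (f x))"
    using continuous_on_compose[OF C1_on_continuous[OF f] h'] by (simp add: o_def)
  moreover have "((\<lambda>x. h (f x)) has_derivative (\<lambda>v. h' (f x) * f' x v)) (at x within S)" if "x \<in> S" for x
    using diff_chain_within[OF f'(1)[OF that]
        has_derivative_at_withinI[OF h[OF that, unfolded has_field_derivative_def]]]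
    by (simp add: o_def)
  ultimately show ?thesis
    by (intro C1_onI[where f' = "\<lambda>x v. h' (f x) * f' x v"]) (auto intro!: continuous_on_mult f')
qed

lemma C1_on_inverse:
  fixes f :: "'a::real_normed_vector \<Rightarrow> real"
  assumes "C1_on S f" "\<And>x. x \<in> S \<Longrightarrow> f x \<noteq> 0"
  shows "C1_on S (\<lambda>x. inverse (f x))"
  by (rule C1_on_compose_real[OF assms(1), where h' = "\<lambda>y. - (inverse y ^ 2)"])
    (use assms(2) in \<open>auto intro!: DERIV_inverse[THEN DERIV_cong] continuous_intros simp: numeral_2_eq_2\<close>)

lemma C1_on_sqrt:
  fixes f :: "'a::real_normed_vector \<Rightarrow> real"
  assumes "C1_on S f" "\<And>x. x \<in> S \<Longrightarrow> 0 < f x"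
  shows "C1_on S (\<lambda>x. sqrt (f x))"
  by (rule C1_on_compose_real[OF assms(1), where h' = "\<lambda>y. inverse (sqrt y) / 2"])
    (use assms(2) in \<open>force intro!: DERIV_real_sqrt continuous_intros\<close>)+

lemma C1_on_det:
  fixes G :: "'a::real_normed_vector \<Rightarrow> real^'n^'n"
  assumes "\<And>i j. C1_on S (\<lambda>x. G x $ i $ j)"
  shows "C1_on S (\<lambda>x. det (G x))"
  unfolding det_def by (intro C1_on_sum C1_on_mult C1_on_const C1_on_prod assms)

text \<open>The derivative in direction \<open>v\<close> is a combination of the partial
  derivatives, which are again smooth.\<close>

lemma smooth_on_C1_on:
  fixes f :: "real^'n::finite \<Rightarrow> 'b::real_normed_vector"
  assumes S: "inward UNIV S" and f: "smooth_on S f"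
  shows "C1_on S f"
proof (rule C1_onI[OF smooth_on_has_derivative[OF f]])
  fix v
  have "continuous_on S (\<lambda>x. \<Sum>i\<in>UNIV. v $ i *\<^sub>R coord_deriv S f i x)"
    by (intro continuous_intros smooth_on_continuous smooth_on_coord_deriv[OF S _ f]) simp
  then show "continuous_on S (\<lambda>x. frechet_derivative f (at x within S) v)"
    by (rule continuous_on_eq)
      (simp add: coord_deriv_def linear_sum_axis[OF has_derivative_linear[OF smooth_on_has_derivative[OF f]], symmetric])
qed

lemma C1_on_coord_deriv_continuous:
  fixes f :: "real^'n::finite \<Rightarrow> 'b::real_normed_vector"
  assumes S: "inward UNIV S" and f: "C1_on S f"
  shows "continuous_on S (coord_deriv S f i)"
proof (rule C1_onE[OF f])
  fix f' assume f': "\<And>x. x \<in> S \<Longrightarrow> (f has_derivative f' x) (at x within S)"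
    "\<And>v. continuous_on S (\<lambda>x. f' x v)"
  show ?thesis
    by (rule continuous_on_eq[OF f'(2)[of "axis i 1"]]) (simp add: coord_deriv_eq[OF S _ UNIV_I f'(1)])
qed

lemma coord_deriv_mult:
  fixes f g :: "real^'n::finite \<Rightarrow> real"
  assumes S: "inward UNIV S" and f: "C1_on S f" and g: "C1_on S g" and x: "x \<in> S"
  shows "coord_deriv S (\<lambda>y. f y * g y) i x = f x * coord_deriv S g i x + coord_deriv S f i x * g x"
  using coord_deriv_eq[OF S x UNIV_I has_derivative_mult[OF C1_on_has_derivative[OF f x] C1_on_has_derivative[OF g x]]]
  by (simp add: coord_deriv_def)

section \<open>Linear algebra\<close>

text \<open>A permutation other than the identity moves at least two indices. After one factor of
  its Leibniz term has been differentiated, an off-diagonal entry of the identity matrix remains, so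
  only the trace survives.\<close>

lemma has_derivative_det_at_1:
  fixes H :: "'a::real_normed_vector \<Rightarrow> real^'n^'n"
  assumes H: "\<And>i j. ((\<lambda>y. H y $ i $ j) has_derivative H' i j) (at x within S)" and x: "H x = mat 1"
  shows "((\<lambda>y. det (H y)) has_derivative (\<lambda>v. \<Sum>i\<in>UNIV. H' i i v)) (at x within S)"
proof -
  let ?P = "{p. p permutes (UNIV :: 'n set)}"
  have "((\<lambda>y. \<Sum>p\<in>?P. of_int (sign p) * (\<Prod>i\<in>UNIV. H y $ i $ p i)) has_derivative
     (\<lambda>v. \<Sum>p\<in>?P. of_int (sign p) * (\<Sum>i\<in>UNIV. H' i (p i) v * (\<Prod>j\<in>UNIV - {i}. H x $ j $ p j)))) (at x within S)"
    by (intro has_derivative_sum has_derivative_mult_right has_derivative_prod H)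
  moreover have "(\<Sum>p\<in>?P. of_int (sign p) * (\<Sum>i\<in>UNIV. H' i (p i) v * (\<Prod>j\<in>UNIV - {i}. H x $ j $ p j))) =
      (\<Sum>i\<in>UNIV. H' i i v)" for v
  proof -
    have "(\<Sum>i\<in>UNIV. H' i (p i) v * (\<Prod>j\<in>UNIV - {i}. H x $ j $ p j)) = 0" if p: "p \<in> ?P - {id}" for p
    proof (intro sum.neutral ballI)
      fix i
      from p have pp: "p permutes UNIV" "p \<noteq> id" by auto
      have "\<exists>j. j \<noteq> i \<and> p j \<noteq> j"
      proof (rule ccontr)
        assume "\<nexists>j. j \<noteq> i \<and> p j \<noteq> j"
        then have fix_: "p j = j" if "j \<noteq> i" for j using that by blast
        moreover have "p i = i"
        proof (rule ccontr)
          assume "p i \<noteq> i"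
          then have "p (p i) = p i" by (rule fix_)
          then show False using \<open>p i \<noteq> i\<close> permutes_inj[OF pp(1)] by (metis injD)
        qed
        ultimately show False using pp(2) by (metis eq_id_iff)
      qed
      then obtain j where "j \<noteq> i" "p j \<noteq> j" by blast
      then have "(\<Prod>j\<in>UNIV - {i}. H x $ j $ p j) = 0"
        by (intro prod_zero bexI[of _ j]) (auto simp: x mat_def)
      then show "H' i (p i) v * (\<Prod>j\<in>UNIV - {i}. H x $ j $ p j) = 0" by simp
    qed
    moreover have "id \<in> ?P" by (simp add: permutes_id)
    ultimately have "(\<Sum>p\<in>?P. of_int (sign p) * (\<Sum>i\<in>UNIV. H' i (p i) v * (\<Prod>j\<in>UNIV - {i}. H x $ j $ p j))) =
      of_int (sign id) * (\<Sum>i\<in>UNIV. H' i (id i) v * (\<Prod>j\<in>UNIV - {i}. H x $ j $ id j))"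
      by (subst sum.remove[of _ id]) (auto simp: finite_permutations)
    then show ?thesis by (simp add: x mat_def)
  qed
  ultimately show ?thesis by (simp add: det_def)
qed

text \<open>Jacobi's formula. Multiplication by the constant matrix \<open>A\<close> moves the base
  point to the identity, and \<open>det (G x) * det A = 1\<close> undoes it on the level of
  determinants.\<close>

lemma has_derivative_det:
  fixes G :: "'a::real_normed_vector \<Rightarrow> real^'n^'n"
  assumes G: "\<And>i j. ((\<lambda>y. G y $ i $ j) has_derivative G' i j) (at x within S)" and A: "A ** G x = mat 1"
  shows "((\<lambda>y. det (G y)) has_derivative (\<lambda>v. det (G x) * (\<Sum>i\<in>UNIV. \<Sum>j\<in>UNIV. A $ i $ j * G' j i v))) (at x within S)"
proof -
  have "((\<lambda>y. det (A ** G y)) has_derivative (\<lambda>v. \<Sum>i\<in>UNIV. \<Sum>j\<in>UNIV. A $ i $ j * G' j i v)) (at x within S)"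
    by (rule has_derivative_det_at_1[where H' = "\<lambda>i k v. \<Sum>j\<in>UNIV. A $ i $ j * G' j k v"])
      (simp add: matrix_matrix_mult_def, intro has_derivative_sum has_derivative_mult_right G, rule A)
  from has_derivative_mult_right[OF this, of "det (G x)"]
  have "((\<lambda>y. det (G x) * det (A ** G y)) has_derivative (\<lambda>v. det (G x) * (\<Sum>i\<in>UNIV. \<Sum>j\<in>UNIV. A $ i $ j * G' j i v))) (at x within S)" .
  moreover have "det (G x) * det (A ** G y) = det (G y)" for y
    using arg_cong[OF A, of det] by (simp add: det_mul algebra_simps)
  ultimately show ?thesis by simp
qed

text \<open>On the segment from the identity to \<open>G\<close> all matrices are positive definite,
  hence injective. The determinant never vanishes there and keeps the sign that it has at the
  identity.\<close>

lemma det_pos_of_posdef: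
  fixes G :: "real^'n^'n"
  assumes "\<And>v. v \<noteq> 0 \<Longrightarrow> 0 < (G *v v) \<bullet> v"
  shows "0 < det G"
proof -
  define h where "h t = det ((1 - t) *\<^sub>R mat 1 + t *\<^sub>R G)" for t :: real
  have nz: "h t \<noteq> 0" if t: "0 \<le> t" "t \<le> 1" for t
  proof -
    have "inj ((*v) ((1 - t) *\<^sub>R mat 1 + t *\<^sub>R G))"
    proof (rule linear_injective_0[THEN iffD2], simp, intro allI impI, rule ccontr)
      fix v assume "((1 - t) *\<^sub>R mat 1 + t *\<^sub>R G) *v v = 0" and v: "v \<noteq> 0"
      then have "(1 - t) * (v \<bullet> v) + t * ((G *v v) \<bullet> v) = 0"
        by (metis (no_types, lifting) inner_add_left inner_scaleR_left inner_zero_left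
            matrix_vector_mul_lid matrix_vector_mult_add_rdistrib scaleR_matrix_vector_assoc)
      moreover have "0 < (1 - t) * (v \<bullet> v) + t * ((G *v v) \<bullet> v)"
        using assms[OF v] v t by (cases "t = 0") (auto intro!: add_nonneg_pos)
      ultimately show False by simp
    qed
    then show ?thesis
      by (metis h_def invertible_det_nz matrix_left_invertible_injective invertible_left_inverse)
  qed
  have cont: "continuous_on {0..1} h"
    unfolding h_def det_def by (auto intro!: continuous_intros)
  have "h 0 = 1" by (simp add: h_def)
  show ?thesis
  proof (rule ccontr)
    assume "\<not> 0 < det G"
    then have "h 1 \<le> 0" by (simp add: h_def)
    then obtain t where "0 \<le> t" "t \<le> 1" "h t = 0"
      using IVT2'[of h 1 0 0] cont \<open>h 0 = 1\<close> by auto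
    with nz show False by blast
  qed
qed

text \<open>The transformation law of the volume density: the block of \<open>K\<close> arises from
  the block of \<open>G\<close> by congruence with the block of \<open>J\<close>. Completion by the
  identity is compatible with products and transposes, so determinants multiply.\<close>

lemma sqrt_det_block_congruence:
  fixes J K G :: "real^'n^'n"
  assumes K: "\<And>i j. i \<in> I \<Longrightarrow> j \<in> I \<Longrightarrow> K $ i $ j = (\<Sum>k\<in>I. \<Sum>l\<in>I. J $ k $ i * G $ k $ l * J $ l $ j)"
  shows "sqrt (det (block I K)) = \<bar>det (block I J)\<bar> * sqrt (det (block I G))"
proof -
  have "block I K = transpose (block I J) ** block I G ** block I J"
  proof -
    have "(transpose (block I J) ** block I G ** block I J) $ i $ j = block I K $ i $ j" for i j
    proof -
      have "(transpose (block I J) ** block I G ** block I J) $ i $ j =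
        (\<Sum>l\<in>UNIV. (\<Sum>k\<in>UNIV. block I J $ k $ i * block I G $ k $ l) * block I J $ l $ j)"
        by (simp add: matrix_matrix_mult_def transpose_def)
      also have "\<dots> = block I K $ i $ j"
      proof (cases "i \<in> I \<and> j \<in> I")
        case True
        have "(\<Sum>k\<in>UNIV. block I J $ k $ i * block I G $ k $ l) = (if l \<in> I then \<Sum>k\<in>I. J $ k $ i * G $ k $ l else 0)" for l
        proof -
          have "(\<Sum>k\<in>UNIV. block I J $ k $ i * block I G $ k $ l) = (\<Sum>k\<in>I. block I J $ k $ i * block I G $ k $ l)"
            using True by (intro sum.mono_neutral_right) (auto simp: block_def)
          then show ?thesis using True by (auto simp: block_def intro!: sum.neutral)
        qed
        then have "(\<Sum>l\<in>UNIV. (\<Sum>k\<in>UNIV. block I J $ k $ i * block I G $ k $ l) * block I J $ l $ j) =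
            (\<Sum>l\<in>UNIV. (if l \<in> I then \<Sum>k\<in>I. J $ k $ i * G $ k $ l else 0) * block I J $ l $ j)" by simp
        also have "\<dots> = (\<Sum>l\<in>I. (\<Sum>k\<in>I. J $ k $ i * G $ k $ l) * J $ l $ j)"
          using True by (intro sum.mono_neutral_cong_right) (auto simp: block_def)
        also have "\<dots> = (\<Sum>k\<in>I. \<Sum>l\<in>I. J $ k $ i * G $ k $ l * J $ l $ j)"
          by (subst sum.swap) (simp add: sum_distrib_right)
        finally show ?thesis using True K by (simp add: block_def)
      next
        case False
        have e': "(if l \<in> I \<and> j \<in> I then J $ l $ j else of_bool (l = j)) = (if l = j then 1 else 0)"
          if "j \<notin> I" for l using that by auto
        show ?thesis
        proof (cases "i \<in> I")
          case True
          then have j: "j \<notin> I" using False by simp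
          then have "(\<Sum>l\<in>UNIV. (\<Sum>k\<in>UNIV. block I J $ k $ i * block I G $ k $ l) * block I J $ l $ j) =
            (\<Sum>k\<in>UNIV. block I J $ k $ i * block I G $ k $ j)"
            by (simp add: block_def e' if_distrib cong: if_cong)
          also have "\<dots> = (\<Sum>k\<in>UNIV. 0)"
            using j True by (auto intro!: sum.cong simp: block_def)
          finally show ?thesis using j True by (auto simp: block_def)
        next
          case i: False
          have row: "(\<Sum>k\<in>UNIV. block I J $ k $ i * block I G $ k $ l) = (if l = i then 1 else 0)" for l
          proof -
            have "(\<Sum>k\<in>UNIV. block I J $ k $ i * block I G $ k $ l) = (\<Sum>k\<in>UNIV. if k = i then block I G $ i $ l else 0)"
              using i by (intro sum.cong) (auto simp: block_def)
            then show ?thesis using i by (simp add: block_def)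
          qed
          have "(\<Sum>l\<in>UNIV. (\<Sum>k\<in>UNIV. block I J $ k $ i * block I G $ k $ l) * block I J $ l $ j) =
              (\<Sum>l\<in>UNIV. if l = i then block I J $ i $ j else 0)"
            by (rule sum.cong[OF refl], simp only: row, simp)
          then show ?thesis using i by (simp add: block_def)
        qed
      qed
      finally show ?thesis .
    qed
    then show ?thesis by (simp add: vec_eq_iff)
  qed
  then show ?thesis
    by (simp add: det_mul det_transpose real_sqrt_mult)
qed

text \<open>By Cramer's rule the left side is the determinant of \<open>G\<close> with column
  \<open>b\<close> replaced by \<open>axis b 1\<close>. For a metric, \<open>y $ b\<close> is a
  diagonal entry of the inverse, and the identity compares the densities of interior and
  boundary.\<close>

lemma det_block_cofactor:
  fixes G :: "real^'n^'n"
  assumes y: "G *v y = axis b 1"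
  shows "y $ b * det G = det (block (- {b}) G)"
proof -
  define C where "C = (\<chi> i j. if j = b then (G *v y) $ i else G $ i $ j)"
  \<comment> \<open>\<open>E\<close> is the identity except for row \<open>b\<close>, which carries
    the off-diagonal entries of that row of \<open>G\<close>; it restores the row that
    \<open>block\<close> discards.\<close>
  define E :: "real^'n^'n" where "E = (\<chi> i j. if i = b then (if j = b then 1 else G $ b $ j) else of_bool (i = j))"
  have "C = block (- {b}) G ** E"
  proof -
    have "(\<Sum>k\<in>UNIV. block (- {b}) G $ i $ k * E $ k $ j) = C $ i $ j" for i j
    proof (cases "i = b")
      case True
      then have "(\<Sum>k\<in>UNIV. block (- {b}) G $ i $ k * E $ k $ j) = (\<Sum>k\<in>UNIV. if k = b then E $ k $ j else 0)"
        by (intro sum.cong) (auto simp: block_def)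
      then show ?thesis using True by (simp add: E_def C_def y)
    next
      case False
      then have "(\<Sum>k\<in>UNIV. block (- {b}) G $ i $ k * E $ k $ j) = (\<Sum>k\<in>UNIV. if k = j then (if j = b then 0 else G $ i $ j) else 0)"
        by (intro sum.cong) (auto simp: block_def E_def)
      then show ?thesis using False by (auto simp: C_def y axis_def)
    qed
    then show ?thesis by (simp add: matrix_matrix_mult_def vec_eq_iff)
  qed
  moreover have "det E = 1"
  proof -
    \<comment> \<open>The transpose is the identity with one column replaced, so Cramer's rule
      evaluates its determinant as the diagonal entry 1.\<close>
    have tE: "transpose E = (\<chi> i j. if j = b then row b E $ i else mat 1 $ i $ j)"
      by (auto simp: transpose_def E_def row_def vec_eq_iff mat_def)
    have "det (transpose E) = row b E $ b * det (mat 1 :: real^'n^'n)"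
      using cramer_lemma[of b "mat 1 :: real^'n^'n" "row b E"]
      unfolding matrix_vector_mul_lid tE .
    then show ?thesis by (simp add: det_transpose row_def E_def)
  qed
  ultimately have "det C = det (block (- {b}) G)" by (simp add: det_mul)
  then show ?thesis by (simp add: C_def cramer_lemma)
qed

section \<open>Minimal hypersurfaces in a chart\<close>

lemma bounded_bilinear_lorentz:
  "bounded_bilinear (lorentz :: 'e::euclidean_space \<times> real \<Rightarrow> 'e \<times> real \<Rightarrow> real)"
proof -
  have "bounded_linear (\<lambda>v::'e \<times> real. (fst v, - snd v))"
    by (intro bounded_linear_Pair bounded_linear_minus bounded_linear_fst bounded_linear_snd)
  from bounded_bilinear.comp[OF bounded_bilinear_inner bounded_linear_ident this]
  show ?thesis by (simp add: lorentz_def[abs_def] inner_prod_def)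
qed

interpretation lorentz: bounded_bilinear lorentz
  by (rule bounded_bilinear_lorentz)

lemma lorentz_commute: "lorentz u v = lorentz v u"
  by (simp add: lorentz_def inner_commute)

lemma lorentz_inner: "lorentz u v = (fst u, - snd u) \<bullet> v"
  by (simp add: lorentz_def inner_prod_def)

text \<open>Orthogonality to \<open>p\<close> gives
  \<open>fst v \<bullet> fst p = snd v * snd p\<close>. Since the square of \<open>fst p\<close> is
  smaller by 1 than that of \<open>snd p\<close>, the Cauchy-Schwarz inequality forces
  \<open>fst v\<close> to outweigh \<open>snd v\<close>.\<close>

lemma lorentz_spacelike:
  assumes p: "p \<in> hyperbolic_space" and v: "lorentz v p = 0" "v \<noteq> 0"
  shows "0 < lorentz v v"
proof (cases "snd v = 0")
  case True
  then show ?thesis using v(2) by (auto simp: lorentz_def prod_eq_iff)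
next
  case False
  have p': "fst p \<bullet> fst p = (snd p)\<^sup>2 - 1" "0 < snd p"
    using p by (auto simp: hyperbolic_space_def lorentz_def power2_eq_square)
  have eq: "fst v \<bullet> fst p = snd v * snd p" using v(1) by (simp add: lorentz_def)
  have "(snd v * snd p)\<^sup>2 \<le> (fst v \<bullet> fst v) * ((snd p)\<^sup>2 - 1)"
    using Cauchy_Schwarz_ineq[of "fst v" "fst p"] by (simp add: eq p')
  moreover have "0 \<le> (snd p)\<^sup>2 - 1" using p'(1) by (metis inner_ge_zero)
  ultimately have *: "(snd v)\<^sup>2 * (snd p)\<^sup>2 \<le> (fst v \<bullet> fst v) * ((snd p)\<^sup>2 - 1)"
    by (simp add: power_mult_distrib)
  have "\<not> fst v \<bullet> fst v \<le> (snd v)\<^sup>2"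
  proof
    assume "fst v \<bullet> fst v \<le> (snd v)\<^sup>2"
    then have "(fst v \<bullet> fst v) * ((snd p)\<^sup>2 - 1) \<le> (snd v)\<^sup>2 * ((snd p)\<^sup>2 - 1)"
      using \<open>0 \<le> (snd p)\<^sup>2 - 1\<close> by (rule mult_right_mono)
    with * have "(snd v)\<^sup>2 * (snd p)\<^sup>2 \<le> (snd v)\<^sup>2 * ((snd p)\<^sup>2 - 1)" by linarith
    then have "(snd v)\<^sup>2 \<le> 0" by (simp add: algebra_simps)
    then show False using False by simp
  qed
  then show ?thesis by (simp add: lorentz_def power2_eq_square)
qed

lemma lorentz_nonneg:
  "p \<in> hyperbolic_space \<Longrightarrow> lorentz v p = 0 \<Longrightarrow> 0 \<le> lorentz v v"
  using lorentz_spacelike[of p v] by (cases "v = 0") (auto simp: lorentz.zero_left)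

text \<open>The projection of \<open>a\<close> to the tangent space at \<open>p\<close> has Lorentz
  square \<open>(lorentz a p)\<^sup>2 - 1\<close>, which is nonnegative. The sign of
  \<open>lorentz a p\<close> follows because both points lie on the upper sheet.\<close>

lemma hyperbolic_cosh_ge_1:
  assumes a: "a \<in> hyperbolic_space" and p: "p \<in> hyperbolic_space"
  shows "1 \<le> - lorentz a p"
proof -
  have n: "lorentz a a = -1" "lorentz p p = -1" "0 < snd a" "0 < snd p"
    using a p by (auto simp: hyperbolic_space_def)
  have pos: "0 < - lorentz a p"
  proof -
    have "norm (fst a) < snd a" "norm (fst p) < snd p"
      using n by (auto simp: lorentz_def dot_square_norm power2_eq_square intro!: power2_less_imp_less[of "norm _"])
    then have "norm (fst a) * norm (fst p) < snd a * snd p"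
      by (intro mult_strict_mono') auto
    then show ?thesis using norm_cauchy_schwarz[of "fst a" "fst p"] by (simp add: lorentz_def)
  qed
  let ?c = "lorentz a p"
  have "0 \<le> lorentz (a + ?c *\<^sub>R p) (a + ?c *\<^sub>R p)"
    by (rule lorentz_nonneg[OF p]) (simp add: lorentz.add_left lorentz.scaleR_left n)
  also have "\<dots> = ?c\<^sup>2 - 1"
    by (simp add: lorentz.add_left lorentz.add_right lorentz.scaleR_left lorentz.scaleR_right n
        lorentz_commute[of p a] power2_eq_square algebra_simps)
  finally have "1\<^sup>2 \<le> (- ?c)\<^sup>2" by simp
  from power2_le_imp_le[OF this] pos show ?thesis by linarith
qed

text \<open>At the vector \<open>?z\<close> the quadratic form equals \<open>?q\<close> times the
  difference of the two sides.\<close>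

lemma posdef_Cauchy_Schwarz:
  fixes G :: "real^'n^'n"
  assumes sym: "transpose G = G" and pos: "\<And>v. v \<noteq> 0 \<Longrightarrow> 0 < (G *v v) \<bullet> v"
  shows "((G *v y) \<bullet> x)\<^sup>2 \<le> ((G *v y) \<bullet> y) * ((G *v x) \<bullet> x)"
proof (cases "y = 0")
  case False
  let ?q = "(G *v y) \<bullet> y" and ?r = "(G *v y) \<bullet> x"
  have swap: "(G *v x) \<bullet> y = ?r"
    by (metis dot_lmul_matrix inner_commute sym transpose_matrix_vector)
  let ?z = "?q *\<^sub>R x - ?r *\<^sub>R y"
  have "0 \<le> (G *v ?z) \<bullet> ?z" using pos[of ?z] by (cases "?z = 0") auto
  also have "\<dots> = ?q * (?q * ((G *v x) \<bullet> x) - ?r\<^sup>2)"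
    by (simp add: matrix_vector_mult_diff_distrib matrix_vector_mult_scaleR inner_diff_left inner_diff_right
        swap power2_eq_square algebra_simps)
  finally show ?thesis using pos[OF False] by (simp add: zero_le_mult_iff)
qed simp

text \<open>Here \<open>U\<close> is a chart image and \<open>\<Psi>\<close> the immersion read in
  that chart. The ambient space \<open>'e \<times> real\<close> has dimension n + 2, so besides
  \<open>\<Psi>\<close> and n tangent vectors there is room for exactly one normal
  direction.\<close>

locale immersed_patch =
  fixes U :: "(real^'n::finite) set" and \<Psi> :: "real^'n \<Rightarrow> 'e::euclidean_space \<times> real"
  assumes U: "inward UNIV U" and smooth: "smooth_on U \<Psi>"
    and hyp: "\<And>x. x \<in> U \<Longrightarrow> \<Psi> x \<in> hyperbolic_space"
    and immersed: "\<And>x. x \<in> U \<Longrightarrow> inj (frechet_derivative \<Psi> (at x within U))"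
    and dim: "DIM('e) = CARD('n) + 1"
begin

definition d\<Psi> :: "real^'n \<Rightarrow> real^'n \<Rightarrow> 'e \<times> real" where
  "d\<Psi> x = frechet_derivative \<Psi> (at x within U)"

definition D :: "'n \<Rightarrow> real^'n \<Rightarrow> 'e \<times> real" where
  "D i = coord_deriv U \<Psi> i"

definition G :: "real^'n \<Rightarrow> real^'n^'n" where
  "G x = (\<chi> i j. lorentz (D i x) (D j x))"

definition dens :: "real^'n \<Rightarrow> real" where
  "dens x = sqrt (det (G x))"

definition Ginv :: "real^'n \<Rightarrow> real^'n^'n" where
  "Ginv x = matrix_inv (G x)"

text \<open>The gradients of the coordinate functions, multiplied by the volume density.\<close>

definition V :: "'n \<Rightarrow> real^'n \<Rightarrow> 'e \<times> real" where
  "V i x = (\<Sum>j\<in>UNIV. (dens x * Ginv x $ i $ j) *\<^sub>R D j x)"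

lemma has_derivative_\<Psi>: "x \<in> U \<Longrightarrow> (\<Psi> has_derivative d\<Psi> x) (at x within U)"
  unfolding d\<Psi>_def by (rule smooth_on_has_derivative[OF smooth])

lemma d\<Psi>_axis: "d\<Psi> x (axis i 1) = D i x"
  by (simp add: d\<Psi>_def D_def coord_deriv_def)

lemma linear_d\<Psi>: "x \<in> U \<Longrightarrow> linear (d\<Psi> x)"
  using has_derivative_\<Psi> has_derivative_linear by blast

lemma d\<Psi>_sum: "x \<in> U \<Longrightarrow> d\<Psi> x v = (\<Sum>i\<in>UNIV. v $ i *\<^sub>R D i x)"
  by (subst linear_sum_axis[OF linear_d\<Psi>]) (simp_all add: d\<Psi>_axis)

lemma smooth_D: "smooth_on U (D i)"
  unfolding D_def by (rule smooth_on_coord_deriv[OF U _ smooth]) simp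

lemma C1_\<Psi>: "C1_on U \<Psi>" and C1_D: "C1_on U (D i)"
  using smooth_on_C1_on[OF U] smooth smooth_D by auto

lemma coord_deriv_lorentz:
  assumes "C1_on U f" "C1_on U g" "x \<in> U"
  shows "coord_deriv U (\<lambda>y. lorentz (f y) (g y)) i x =
    lorentz (f x) (coord_deriv U g i x) + lorentz (coord_deriv U f i x) (g x)"
  using coord_deriv_eq[OF U assms(3) UNIV_I lorentz.FDERIV[OF C1_on_has_derivative[OF assms(1,3)] C1_on_has_derivative[OF assms(2,3)]]]
  by (simp add: coord_deriv_def)

lemma coord_deriv_const_on:
  assumes x: "x \<in> U" and c: "\<And>y. y \<in> U \<Longrightarrow> f y = c"
  shows "coord_deriv U f i x = 0"
proof -
  have "(f has_derivative (\<lambda>v. 0)) (at x within U)"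
    by (rule has_derivative_transform[OF x c]) auto
  from coord_deriv_eq[OF U x UNIV_I this] show ?thesis .
qed

lemma lorentz_\<Psi>: "x \<in> U \<Longrightarrow> lorentz (\<Psi> x) (\<Psi> x) = -1"
  using hyp by (auto simp: hyperbolic_space_def)

lemma lorentz_D_\<Psi>:
  assumes x: "x \<in> U"
  shows "lorentz (D i x) (\<Psi> x) = 0"
proof -
  have "coord_deriv U (\<lambda>y. lorentz (\<Psi> y) (\<Psi> y)) i x = 0"
    by (rule coord_deriv_const_on[OF x]) (rule lorentz_\<Psi>)
  then show ?thesis
    using coord_deriv_lorentz[OF C1_\<Psi> C1_\<Psi> x, of i] by (simp add: D_def lorentz_commute)
qed

lemma lorentz_d\<Psi>_\<Psi>: "x \<in> U \<Longrightarrow> lorentz (d\<Psi> x v) (\<Psi> x) = 0"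
  by (simp add: d\<Psi>_sum lorentz.sum_left lorentz.scaleR_left lorentz_D_\<Psi>)

lemma transpose_G: "transpose (G x) = G x"
  by (simp add: G_def transpose_def lorentz_commute)

lemma G_mult:
  assumes "x \<in> U"
  shows "(G x *v v) $ i = lorentz (d\<Psi> x v) (D i x)"
  unfolding d\<Psi>_sum[OF assms]
  by (simp add: matrix_vector_mult_def G_def lorentz.sum_left lorentz.scaleR_left
      lorentz_commute[of "D i x"] mult.commute)

lemma G_inner:
  assumes "x \<in> U"
  shows "(G x *v v) \<bullet> w = lorentz (d\<Psi> x v) (d\<Psi> x w)"
  unfolding d\<Psi>_sum[OF assms, of w]
  by (simp add: inner_vec_def G_mult[OF assms] lorentz.sum_right lorentz.scaleR_right mult.commute)

lemma d\<Psi>_eq_0: "x \<in> U \<Longrightarrow> d\<Psi> x v = 0 \<longleftrightarrow> v = 0"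
  using immersed[of x] linear_injective_0[OF linear_d\<Psi>, of x] linear_0[OF linear_d\<Psi>, of x]
  by (auto simp: d\<Psi>_def)

lemma G_pos: "x \<in> U \<Longrightarrow> v \<noteq> 0 \<Longrightarrow> 0 < (G x *v v) \<bullet> v"
  by (simp add: G_inner lorentz_spacelike[OF hyp] lorentz_d\<Psi>_\<Psi> d\<Psi>_eq_0)

lemma det_G_pos: "x \<in> U \<Longrightarrow> 0 < det (G x)"
  by (intro det_pos_of_posdef G_pos)

lemma dens_pos: "x \<in> U \<Longrightarrow> 0 < dens x"
  by (simp add: dens_def det_G_pos)

lemma G_Ginv: "x \<in> U \<Longrightarrow> G x ** Ginv x = mat 1" and Ginv_G: "x \<in> U \<Longrightarrow> Ginv x ** G x = mat 1"
proof -
  assume "x \<in> U"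
  then have "invertible (G x)" using det_G_pos[of x] by (simp add: invertible_det_nz)
  then have "\<exists>B. G x ** B = mat 1 \<and> B ** G x = mat 1" by (simp add: invertible_def)
  then have "G x ** Ginv x = mat 1 \<and> Ginv x ** G x = mat 1"
    unfolding Ginv_def matrix_inv_def by (rule someI_ex)
  then show "G x ** Ginv x = mat 1" "Ginv x ** G x = mat 1" by auto
qed

lemma Ginv_sym: "x \<in> U \<Longrightarrow> Ginv x $ i $ j = Ginv x $ j $ i"
proof -
  assume x: "x \<in> U"
  have "transpose (Ginv x) ** G x = mat 1"
    by (metis G_Ginv[OF x] matrix_transpose_mul transpose_G transpose_mat)
  then have "transpose (Ginv x) = Ginv x"
    by (metis G_Ginv[OF x] matrix_mul_assoc matrix_mul_lid matrix_mul_rid)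
  then have "transpose (Ginv x) $ i $ j = Ginv x $ i $ j" by simp
  then show ?thesis by (simp add: transpose_def)
qed

lemma Ginv_G_sum: "x \<in> U \<Longrightarrow> (\<Sum>j\<in>UNIV. Ginv x $ i $ j * G x $ j $ k) = of_bool (i = k)"
  using Ginv_G[of x] by (auto simp: matrix_matrix_mult_def vec_eq_iff mat_def)

lemma C1_G: "C1_on U (\<lambda>x. G x $ i $ j)"
  using C1_on_bounded_bilinear[OF bounded_bilinear_lorentz C1_D C1_D] by (simp add: G_def)

lemma C1_dens: "C1_on U dens"
  unfolding dens_def[abs_def] by (intro C1_on_sqrt C1_on_det C1_G det_G_pos)

text \<open>Cramer's rule writes each entry as a quotient of determinants of matrices with C1
  entries, with nonvanishing denominator.\<close>

lemma C1_Ginv: "C1_on U (\<lambda>x. Ginv x $ i $ j)"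
proof -
  define C where "C x = (\<chi> r s. if s = i then axis j 1 $ r else G x $ r $ s)" for x
  have "C1_on U (\<lambda>x. inverse (det (G x)) * det (C x))"
  proof (intro C1_on_mult C1_on_inverse C1_on_det)
    show "C1_on U (\<lambda>x. C x $ r $ s)" for r s
      by (cases "s = i") (simp_all add: C_def C1_G)
    show "det (G x) \<noteq> 0" if "x \<in> U" for x using det_G_pos[OF that] by simp
  qed (rule C1_G)
  moreover have "Ginv x $ i $ j = inverse (det (G x)) * det (C x)" if x: "x \<in> U" for x
  proof -
    have ax: "G x *v (Ginv x *v axis j 1) = axis j 1"
      by (simp add: matrix_vector_mul_assoc G_Ginv[OF x])
    have "det (C x) = (Ginv x *v axis j 1) $ i * det (G x)"
      using cramer_lemma[of i "G x" "Ginv x *v axis j 1"] unfolding ax C_def .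
    also have "(Ginv x *v axis j 1) $ i = Ginv x $ i $ j"
      by (simp add: matrix_vector_mult_def axis_def if_distrib cong: if_cong)
    finally show ?thesis using det_G_pos[OF x] by (simp add: field_simps)
  qed
  ultimately show ?thesis by (rule C1_on_cong)
qed

lemma C1_coeff: "C1_on U (\<lambda>x. dens x * Ginv x $ i $ j)"
  by (intro C1_on_mult C1_dens C1_Ginv)

lemma C1_V: "C1_on U (V i)"
  unfolding V_def[abs_def] by (intro C1_on_sum C1_on_scaleR C1_coeff C1_D)

lemma lorentz_V_\<Psi>: "x \<in> U \<Longrightarrow> lorentz (V i x) (\<Psi> x) = 0"
  by (simp add: V_def lorentz.sum_left lorentz.scaleR_left lorentz_D_\<Psi>)

text \<open>Divided by the density, the vectors \<open>V i x\<close> form the basis dual to the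
  coordinate basis.\<close>

lemma lorentz_V_D:
  assumes "x \<in> U"
  shows "lorentz (V i x) (D k x) = dens x * of_bool (i = k)"
proof -
  have "lorentz (V i x) (D k x) = (\<Sum>j\<in>UNIV. dens x * (Ginv x $ i $ j * G x $ j $ k))"
    by (simp add: V_def lorentz.sum_left lorentz.scaleR_left G_def mult.assoc)
  also have "\<dots> = dens x * of_bool (i = k)"
    unfolding sum_distrib_left[symmetric] Ginv_G_sum[OF assms] ..
  finally show ?thesis .
qed

lemma D_commute: "x \<in> U \<Longrightarrow> coord_deriv U (D i) j x = coord_deriv U (D j) i x"
  unfolding D_def by (rule coord_deriv_commute[OF U smooth])

text \<open>The Laplacian of \<open>\<Psi>\<close>, multiplied by the volume density.\<close>

definition Z :: "real^'n \<Rightarrow> 'e \<times> real" where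
  "Z x = (\<Sum>i\<in>UNIV. coord_deriv U (V i) i x)"

text \<open>Differentiate \<open>lorentz (V i y) (\<Psi> y) = 0\<close> in direction
  \<open>i\<close>: by duality of \<open>V\<close> and \<open>D\<close>, each of the n directions
  contributes \<open>- dens x\<close>.\<close>

lemma lorentz_Z_\<Psi>:
  assumes x: "x \<in> U"
  shows "lorentz (Z x) (\<Psi> x) = - (real CARD('n) * dens x)"
proof -
  have "lorentz (coord_deriv U (V i) i x) (\<Psi> x) = - dens x" for i
  proof -
    have "coord_deriv U (\<lambda>y. lorentz (V i y) (\<Psi> y)) i x = 0"
      by (rule coord_deriv_const_on[OF x]) (rule lorentz_V_\<Psi>)
    then show ?thesis
      using coord_deriv_lorentz[OF C1_V[of i] C1_\<Psi> x, of i] lorentz_V_D[OF x, of i i] by (simp add: D_def)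
  qed
  then show ?thesis by (simp add: Z_def lorentz.sum_left)
qed

text \<open>Jacobi's formula followed by the derivative of the square root, which produces the
  factor 1/2.\<close>

lemma coord_deriv_dens:
  assumes x: "x \<in> U"
  shows "coord_deriv U dens k x = dens x / 2 * (\<Sum>i\<in>UNIV. \<Sum>j\<in>UNIV. Ginv x $ i $ j * coord_deriv U (\<lambda>x. G x $ j $ i) k x)"
proof -
  let ?G' = "\<lambda>i j. frechet_derivative (\<lambda>x. G x $ i $ j) (at x within U)"
  let ?T = "\<lambda>v. \<Sum>i\<in>UNIV. \<Sum>j\<in>UNIV. Ginv x $ i $ j * ?G' j i v"
  have "((\<lambda>y. det (G y)) has_derivative (\<lambda>v. det (G x) * ?T v)) (at x within U)"
    by (rule has_derivative_det[OF C1_on_has_derivative[OF C1_G x] Ginv_G[OF x]])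
  from diff_chain_within[OF this has_derivative_at_withinI[OF
      DERIV_real_sqrt[OF det_G_pos[OF x], unfolded has_field_derivative_def]]]
  have "(dens has_derivative (\<lambda>v. inverse (sqrt (det (G x))) / 2 * (det (G x) * ?T v))) (at x within U)"
    by (simp add: o_def dens_def[abs_def])
  from coord_deriv_eq[OF U x UNIV_I this, of k]
  have "coord_deriv U dens k x = inverse (sqrt (det (G x))) * det (G x) / 2 * ?T (axis k 1)" by simp
  also have "inverse (sqrt (det (G x))) * det (G x) = dens x"
    using real_div_sqrt[of "det (G x)"] det_G_pos[OF x] by (simp add: dens_def divide_inverse mult.commute)
  finally show ?thesis by (simp add: coord_deriv_def)
qed

text \<open>The product rule for \<open>lorentz (V i y) (D k y) = dens y * of_bool (i = k)\<close>
  is summed over \<open>i\<close>. The right side gives the derivative of the density in direction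
  \<open>k\<close>. The terms with derivatives of \<open>D k\<close> give the same: by symmetry of
  second derivatives they turn into the trace in Jacobi's formula. This takes the place of a
  computation with Christoffel symbols.\<close>

lemma lorentz_Z_D:
  assumes x: "x \<in> U"
  shows "lorentz (Z x) (D k x) = 0"
proof -
  have C1d: "C1_on U (\<lambda>x. dens x * of_bool (i = k))" for i by (intro C1_on_mult C1_dens C1_on_const)
  have eq: "lorentz (coord_deriv U (V i) i x) (D k x) =
      coord_deriv U dens i x * of_bool (i = k) - lorentz (V i x) (coord_deriv U (D k) i x)" for i
  proof -
    have "coord_deriv U (\<lambda>y. lorentz (V i y) (D k y)) i x = coord_deriv U (\<lambda>y. dens y * of_bool (i = k)) i x"
    proof -
      have "((\<lambda>y. lorentz (V i y) (D k y)) has_derivative frechet_derivative (\<lambda>y. dens y * of_bool (i = k)) (at x within U)) (at x within U)"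
        by (rule has_derivative_transform[OF x lorentz_V_D C1_on_has_derivative[OF C1d x]])
      from coord_deriv_eq[OF U x UNIV_I this, of i] show ?thesis
        unfolding coord_deriv_def[of U "\<lambda>y. dens y * of_bool (i = k)"] .
    qed
    also have "\<dots> = coord_deriv U dens i x * of_bool (i = k)"
      using coord_deriv_mult[OF U C1_dens C1_on_const x, of "of_bool (i = k)" i]
        coord_deriv_const_on[OF x, of "\<lambda>x. of_bool (i = k) :: real"] by simp
    finally show ?thesis
      using coord_deriv_lorentz[OF C1_V[of i] C1_D[of k] x, of i] by simp
  qed
  have "(\<Sum>i\<in>UNIV. lorentz (V i x) (coord_deriv U (D k) i x)) = coord_deriv U dens k x"
  proof -
    have "(\<Sum>i\<in>UNIV. \<Sum>j\<in>UNIV. Ginv x $ i $ j * coord_deriv U (\<lambda>x. G x $ j $ i) k x) =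
        (\<Sum>i\<in>UNIV. \<Sum>j\<in>UNIV. Ginv x $ i $ j * lorentz (D j x) (coord_deriv U (D i) k x)) +
        (\<Sum>i\<in>UNIV. \<Sum>j\<in>UNIV. Ginv x $ i $ j * lorentz (coord_deriv U (D j) k x) (D i x))"
      by (simp add: G_def coord_deriv_lorentz[OF C1_D C1_D x] algebra_simps sum.distrib)
    \<comment> \<open>Exchanging the indices, with \<open>Ginv\<close> symmetric, shows that both
      halves of the derivative of the metric contribute equally; this cancels the factor 1/2 of
      \<open>coord_deriv_dens\<close>.\<close>
    also have "(\<Sum>i\<in>UNIV. \<Sum>j\<in>UNIV. Ginv x $ i $ j * lorentz (coord_deriv U (D j) k x) (D i x)) =
        (\<Sum>i\<in>UNIV. \<Sum>j\<in>UNIV. Ginv x $ i $ j * lorentz (D j x) (coord_deriv U (D i) k x))"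
      by (subst sum.swap) (simp add: Ginv_sym[OF x] lorentz_commute)
    finally have "coord_deriv U dens k x =
        (\<Sum>i\<in>UNIV. \<Sum>j\<in>UNIV. dens x * Ginv x $ i $ j * lorentz (D j x) (coord_deriv U (D i) k x))"
      by (simp add: coord_deriv_dens[OF x] sum_distrib_left mult.assoc)
    then show ?thesis
      by (simp add: V_def lorentz.sum_left lorentz.scaleR_left D_commute[OF x, of k])
  qed
  then have "(\<Sum>i\<in>UNIV. lorentz (coord_deriv U (V i) i x) (D k x)) = 0"
    by (simp add: eq sum_subtractf)
  then show ?thesis by (simp add: Z_def lorentz.sum_left)
qed

text \<open>In the product rule for \<open>V i\<close> the terms with a differentiated coefficient
  are tangential and are killed by \<open>N\<close>. What remains is \<open>dens x\<close> times the
  trace of the second fundamental form.\<close>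

lemma lorentz_Z_normal:
  assumes x: "x \<in> U" and N: "\<And>i. lorentz N (D i x) = 0"
    and H: "trace (matrix_inv (G x) ** (\<chi> i j. lorentz (coord_deriv U (D j) i x) N)) = 0"
  shows "lorentz (Z x) N = 0"
proof -
  have "lorentz (coord_deriv U (V i) i x) N =
      dens x * (\<Sum>j\<in>UNIV. Ginv x $ i $ j * lorentz (coord_deriv U (D i) j x) N)" for i
  proof -
    let ?a = "\<lambda>j x. dens x * Ginv x $ i $ j"
    have "(V i has_derivative (\<lambda>v. \<Sum>j\<in>UNIV. ?a j x *\<^sub>R frechet_derivative (D j) (at x within U) v +
        frechet_derivative (?a j) (at x within U) v *\<^sub>R D j x)) (at x within U)"
      unfolding V_def[abs_def]
      by (intro has_derivative_sum has_derivative_scaleR C1_on_has_derivative[OF C1_coeff x] C1_on_has_derivative[OF C1_D x])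
    from coord_deriv_eq[OF U x UNIV_I this, of i]
    have "coord_deriv U (V i) i x = (\<Sum>j\<in>UNIV. ?a j x *\<^sub>R coord_deriv U (D j) i x + coord_deriv U (?a j) i x *\<^sub>R D j x)"
      by (simp add: coord_deriv_def)
    then show ?thesis
      using N by (simp add: lorentz.sum_left lorentz.add_left lorentz.scaleR_left lorentz_commute[of "D _ x" N]
          sum_distrib_left mult.assoc D_commute[OF x])
  qed
  then have "lorentz (Z x) N = dens x * (\<Sum>i\<in>UNIV. \<Sum>j\<in>UNIV. Ginv x $ i $ j * lorentz (coord_deriv U (D i) j x) N)"
    by (simp add: Z_def lorentz.sum_left sum_distrib_left)
  also have "\<dots> = dens x * trace (matrix_inv (G x) ** (\<chi> i j. lorentz (coord_deriv U (D j) i x) N))"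
    by (simp add: trace_def matrix_matrix_mult_def Ginv_def)
  finally show ?thesis using H by simp
qed

text \<open>\<open>\<Psi> x\<close> and the tangent vectors span at most n + 1 of the n + 2
  dimensions, so some nonzero vector is orthogonal to them. Being orthogonal to
  \<open>\<Psi> x\<close> it is spacelike and can be normalised.\<close>

lemma unit_normal_exists:
  assumes x: "x \<in> U"
  obtains N where "lorentz N N = 1" "lorentz N (\<Psi> x) = 0" "\<And>i. lorentz N (D i x) = 0"
proof -
  let ?L = "\<lambda>z::real \<times> (real^'n). fst z *\<^sub>R \<Psi> x + d\<Psi> x (snd z)"
  have lin: "linear ?L"
    using linear_d\<Psi>[OF x] by (auto intro!: linearI simp: linear_add linear_scale algebra_simps)
  have "dim (range ?L) \<le> dim (UNIV :: (real \<times> (real^'n)) set)" by (rule dim_image_le[OF lin])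
  also have "\<dots> < DIM('e \<times> real)" using dim by (simp add: dim_UNIV)
  finally obtain w where w: "w \<noteq> 0" "\<And>y. y \<in> span (range ?L) \<Longrightarrow> orthogonal w y"
    using orthogonal_to_subspace_exists by blast
  \<comment> \<open>Changing the sign of the last coordinate turns Euclidean orthogonality into
    Lorentz orthogonality.\<close>
  define N0 where "N0 = (fst w, - snd w)"
  have N0: "lorentz N0 (?L z) = 0" for z
  proof -
    have "orthogonal w (?L z)" by (intro w(2) span_base rangeI)
    then show ?thesis by (simp add: lorentz_inner N0_def orthogonal_def)
  qed
  have 1: "lorentz N0 (\<Psi> x) = 0" using N0[of "(1, 0)"] linear_0[OF linear_d\<Psi>[OF x]] by simp
  have 2: "lorentz N0 (D i x) = 0" for i using N0[of "(0, axis i 1)"] by (simp add: d\<Psi>_axis)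
  have "N0 \<noteq> 0" using w(1) by (auto simp: N0_def prod_eq_iff)
  then have pos: "0 < lorentz N0 N0" by (rule lorentz_spacelike[OF hyp[OF x] 1])
  show thesis
    using pos 1 2 that[of "inverse (sqrt (lorentz N0 N0)) *\<^sub>R N0"]
    by (simp add: lorentz.scaleR_left lorentz.scaleR_right field_simps)
qed

text \<open>\<open>\<Psi> x\<close>, \<open>N\<close> and the tangent vectors are linearly
  independent and, by counting dimensions, span the whole space, on which the Lorentz form is
  nondegenerate.\<close>

lemma frame_complete:
  assumes x: "x \<in> U" and N: "lorentz N N = 1" "lorentz N (\<Psi> x) = 0" "\<And>i. lorentz N (D i x) = 0"
    and W: "lorentz W (\<Psi> x) = 0" "\<And>i. lorentz W (D i x) = 0" "lorentz W N = 0"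
  shows "W = 0"
proof -
  let ?L = "\<lambda>z::(real \<times> real) \<times> (real^'n). fst (fst z) *\<^sub>R \<Psi> x + snd (fst z) *\<^sub>R N + d\<Psi> x (snd z)"
  have lin: "linear ?L"
    using linear_d\<Psi>[OF x] by (auto intro!: linearI simp: linear_add linear_scale algebra_simps)
  have Nd: "lorentz (d\<Psi> x v) N = 0" for v
    by (simp add: d\<Psi>_sum[OF x] lorentz.sum_left lorentz.scaleR_left lorentz_commute[of "D _ x" N] N)
  have "inj ?L"
  proof (rule linear_injective_0[OF lin, THEN iffD2], intro allI impI)
    fix z assume z: "?L z = 0"
    have "lorentz (?L z) (\<Psi> x) = - fst (fst z)"
      by (simp add: lorentz.add_left lorentz.scaleR_left lorentz_\<Psi>[OF x] N lorentz_d\<Psi>_\<Psi>[OF x])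
    moreover have "lorentz (?L z) N = snd (fst z)"
      by (simp add: lorentz.add_left lorentz.scaleR_left N Nd lorentz_commute[of "\<Psi> x" N])
    ultimately have "fst (fst z) = 0" "snd (fst z) = 0" using z by (simp_all add: lorentz.zero_left)
    moreover from this z have "snd z = 0" by (simp add: d\<Psi>_eq_0[OF x])
    ultimately show "z = 0" by (simp add: prod_eq_iff)
  qed
  then have "dim (range ?L) = dim (UNIV :: ((real \<times> real) \<times> (real^'n)) set)"
    by (intro dim_image_eq[OF lin]) (simp add: inj_on_subset)
  then have "dim (range ?L) = DIM('e \<times> real)" using dim by (simp add: dim_UNIV)
  then have "span (range ?L) = UNIV" by (rule dim_eq_full[THEN iffD1])
  moreover have "span (range ?L) = range ?L"
    using linear_subspace_image[OF lin subspace_UNIV] by (rule span_eq_iff[THEN iffD2])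
  \<comment> \<open>The Lorentz product of \<open>W\<close> with this reflected vector is the
    Euclidean square of the reflected vector.\<close>
  ultimately have "(fst W, - snd W) \<in> range ?L" by simp
  then obtain z where z: "?L z = (fst W, - snd W)" by (auto simp del: split_paired_Ex)
  have "lorentz W (?L z) = 0"
    using W by (simp add: lorentz.add_right lorentz.scaleR_right d\<Psi>_sum[OF x] lorentz.sum_right)
  then have "(fst W, - snd W) \<bullet> (fst W, - snd W) = 0" unfolding z by (simp add: lorentz_inner)
  then have "(fst W, - snd W) = 0" by (simp only: inner_eq_zero_iff)
  then show ?thesis by (simp add: prod_eq_iff)
qed

end

section \<open>Integration by parts on the half space\<close>

lemma at_within_openin:
  assumes "openin (top_of_set H) U" "x \<in> U"
  shows "at x within U = at x within H"
proof -
  obtain T where T: "open T" "U = H \<inter> T" using assms(1) by (auto simp: openin_open)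
  show ?thesis by (rule at_within_nhd[of x T]) (use T assms(2) in auto)
qed

lemma mem_half_space: "x \<in> half_space \<longleftrightarrow> 0 \<le> x $ bd_index"
  and mem_hyperplane: "x \<in> hyperplane \<longleftrightarrow> x $ bd_index = 0"
  by (simp_all add: half_space_def hyperplane_def)

lemma closed_half_space: "closed half_space"
  unfolding half_space_def by (intro closed_Collect_le continuous_intros)

lemma closed_hyperplane: "closed hyperplane"
  unfolding hyperplane_def by (intro closed_Collect_eq continuous_intros)

text \<open>The two instances are the half space with all coordinates and the bounding hyperplane
  with the remaining ones. Stability under forward moves yields \<open>inward\<close> for relatively
  open subsets.\<close>

definition model_space :: "'n::finite set \<Rightarrow> (real^'n) set \<Rightarrow> bool" where
  "model_space I H \<longleftrightarrow> closed H \<and> (\<forall>x\<in>H. coord_proj I x = x \<and>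
     (\<forall>i\<in>I. \<forall>t\<ge>0. x + t *\<^sub>R axis i 1 \<in> H))"

lemma model_space_half_space: "model_space UNIV half_space"
  by (auto simp: model_space_def closed_half_space mem_half_space axis_def)

lemma model_space_hyperplane: "model_space (- {bd_index}) hyperplane"
  by (auto simp: model_space_def closed_hyperplane mem_hyperplane axis_def coord_proj_def vec_eq_iff)

lemma inward_openin:
  assumes "model_space I H" "openin (top_of_set H) U"
  shows "inward I U"
  unfolding inward_def
proof (intro ballI)
  fix x i assume x: "x \<in> U" and i: "i \<in> I"
  obtain T where T: "open T" "U = H \<inter> T" using assms(2) by (auto simp: openin_open)
  have "((\<lambda>t. x + t *\<^sub>R axis i 1) \<longlongrightarrow> x + 0 *\<^sub>R axis i 1) (at_right 0)"
    by (intro tendsto_intros)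
  then have "\<forall>\<^sub>F t in at_right 0. x + t *\<^sub>R axis i 1 \<in> T"
    by (rule topological_tendstoD) (use T x in auto)
  then show "\<forall>\<^sub>F t in at_right 0. x + t *\<^sub>R axis i 1 \<in> U"
    using eventually_at_right_less[of "0::real"]
    by eventually_elim (use assms(1) x i T in \<open>auto simp: model_space_def\<close>)
qed

lemma AE_coord_lborel: "AE x in coord_lborel I. \<forall>i. i \<notin> I \<longrightarrow> x $ i = 0"
proof -
  have "{x. \<forall>i. i \<notin> I \<longrightarrow> x $ i = 0} = (\<Inter>i\<in>- I. {x :: real^'a. x $ i = 0})" by auto
  then have "{x :: real^'a. \<forall>i. i \<notin> I \<longrightarrow> x $ i = 0} \<in> sets borel"
    by (auto intro!: borel_closed closed_INT closed_Collect_eq continuous_intros)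
  then show ?thesis
    unfolding coord_lborel_altdef by (subst AE_distr_iff) (auto simp: coord_embed_def)
qed

text \<open>Thickening by the unit cube turns the compact set into a bounded set of full dimension,
  which lies in a box.\<close>

lemma emeasure_coord_lborel_compact:
  assumes "compact K"
  shows "emeasure (coord_lborel I) K < \<infinity>"
proof -
  have [measurable]: "coord_cube (- I) \<in> sets borel" "K \<in> sets borel"
    using assms by (simp_all add: borel_closed closed_coord_cube compact_imp_closed)
  obtain R where R: "\<And>x. x \<in> K \<Longrightarrow> norm x \<le> R" using compact_imp_bounded[OF assms] bounded_iff by blast
  \<comment> \<open>The bound \<open>R\<close> controls the coordinates in \<open>I\<close>; the
    added 1 leaves room for the cube coordinates in \<open>{0..1}\<close>.\<close>
  let ?c = "(\<chi> i. \<bar>R\<bar> + 1) :: real^'a"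
  have "emeasure (coord_lborel I) K = (\<integral>\<^sup>+x. indicator (coord_cube (- I)) x * indicator K (coord_proj I x) \<partial>lborel)"
    using nn_integral_lborel_slab[of "indicator K" I] by simp
  also have "\<dots> \<le> (\<integral>\<^sup>+x. indicator (cbox (- ?c) ?c) x \<partial>lborel)"
  proof (intro nn_integral_mono)
    fix x :: "real^'a"
    have "x \<in> cbox (- ?c) ?c" if x: "x \<in> coord_cube (- I)" "coord_proj I x \<in> K"
    proof -
      have "\<bar>x $ i\<bar> \<le> \<bar>R\<bar> + 1" for i
      proof (cases "i \<in> I")
        case True
        then show ?thesis
          using R[OF x(2)] component_le_norm_cart[of "coord_proj I x" i] by (simp add: coord_proj_nth)
      next
        case False
        then have "0 \<le> x $ i" "x $ i \<le> 1" using x(1) by (auto simp: coord_cube_def)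
        then show ?thesis by linarith
      qed
      then show ?thesis by (auto simp: mem_box_cart abs_le_iff) (smt (verit))+
    qed
    then show "indicator (coord_cube (- I)) x * indicator K (coord_proj I x) \<le> (indicator (cbox (- ?c) ?c) x :: ennreal)"
      by (auto simp: indicator_def)
  qed
  also have "\<dots> = emeasure lborel (cbox (- ?c) ?c)" by simp
  also have "\<dots> < \<infinity>" by (rule emeasure_lborel_cbox_finite)
  finally show ?thesis .
qed

lemma integrable_coord_lborel_compact:
  fixes f :: "real^'n::finite \<Rightarrow> real"
  assumes K: "compact K" and f: "continuous_on K f"
  shows "integrable (coord_lborel I) (\<lambda>x. indicator K x * f x)"
proof -
  obtain C where C: "\<And>x. x \<in> K \<Longrightarrow> norm (f x) \<le> C"
    using compact_imp_bounded[OF compact_continuous_image[OF f K]] by (auto simp: bounded_iff)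
  have [measurable]: "K \<in> sets borel" using K by (simp add: borel_closed compact_imp_closed)
  have "(\<lambda>x. if x \<in> K then f x else 0) \<in> borel_measurable borel"
    by (rule borel_measurable_continuous_on_if) (auto intro!: continuous_on_subset[OF f])
  moreover have "(\<lambda>x. if x \<in> K then f x else 0) = (\<lambda>x. indicator K x * f x)" by auto
  ultimately have meas: "(\<lambda>x. indicator K x * f x) \<in> borel_measurable borel" by simp
  have "integrable (coord_lborel I) (\<lambda>x. indicator K x * C)"
    using emeasure_coord_lborel_compact[OF K] by (intro integrable_mult_left integrable_real_indicator) auto
  then show ?thesis
  proof (rule Bochner_Integration.integrable_bound)
    have "norm (indicator K x * f x) \<le> norm (indicator K x * C)" for x
      using order_trans[OF C abs_ge_self] by (cases "x \<in> K") auto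
    then show "AE x in coord_lborel I. norm (indicator K x * f x) \<le> norm (indicator K x * C)" by simp
  qed (use meas in simp)
qed

lemma coord_deriv_line:
  fixes u :: "real^'n::finite \<Rightarrow> real"
  assumes S: "inward UNIV S" and u: "C1_on S u" and T: "(\<lambda>t. x + t *\<^sub>R axis i 1) ` T \<subseteq> S" and t: "t \<in> T"
  shows "((\<lambda>t. u (x + t *\<^sub>R axis i 1)) has_vector_derivative coord_deriv S u i (x + t *\<^sub>R axis i 1)) (at t within T)"
proof -
  let ?y = "x + t *\<^sub>R axis i 1"
  have 1: "((\<lambda>t. x + t *\<^sub>R axis i 1) has_derivative (\<lambda>t. t *\<^sub>R axis i 1)) (at t within T)"
    by (auto intro!: derivative_eq_intros)
  have d: "(u has_derivative frechet_derivative u (at ?y within S)) (at ?y within S)"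
    using C1_on_has_derivative[OF u] T t by blast
  then have "(u has_derivative frechet_derivative u (at ?y within S)) (at ?y within (\<lambda>t. x + t *\<^sub>R axis i 1) ` T)"
    using T by (rule has_derivative_subset)
  from diff_chain_within[OF 1 this] show ?thesis
    using linear_scale[OF has_derivative_linear[OF d]]
    by (simp add: has_vector_derivative_def o_def coord_deriv_def)
qed

text \<open>Fubini isolates the lines in direction \<open>i\<close>, and the fundamental theorem of
  calculus applies on each. Compact support removes the end values, except in the boundary
  direction, where a line starts on the hyperplane and leaves minus the value there.\<close>

lemma
  fixes u :: "real^'n::finite \<Rightarrow> real"
  assumes U: "openin (top_of_set half_space) U" and u: "C1_on U u"
    and K: "compact K" "K \<subseteq> U" and supp: "\<And>x. x \<in> U - K \<Longrightarrow> u x = 0"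
  shows integrable_coord_deriv_half_space:
      "integrable lborel (\<lambda>x. indicator U x * coord_deriv U u i x)"
    and integral_coord_deriv_half_space:
      "(\<integral>x. indicator U x * coord_deriv U u i x \<partial>lborel) =
        (if i = bd_index then - (\<integral>x. indicator U x * u x \<partial>coord_lborel (- {bd_index})) else 0)"
proof -
  let ?H = "half_space :: (real^'n) set"
  have UH: "U \<subseteq> ?H" using U openin_imp_subset by blast
  have inw: "inward UNIV ?H" "inward UNIV U"
    by (intro inward_openin[OF model_space_half_space] openin_subtopology_self U)+
  \<comment> \<open>Extension by zero to the half space. It stays C1 because \<open>U\<close> and
    the complement of the compact \<open>K\<close> are relatively open and cover the half
    space.\<close>
  define v where "v x = (if x \<in> U then u x else 0)" for x
  obtain u' where u'0: "\<forall>x\<in>U. (u has_derivative u' x) (at x within U)"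
    "\<forall>w. continuous_on U (\<lambda>x. u' x w)"
    using u unfolding C1_on_def by (elim exE conjE)
  note u' = u'0[rule_format]
  have openK: "openin (top_of_set ?H) (?H - K)"
    using K by (auto simp: openin_open intro!: exI[of _ "- K"] compact_imp_closed open_Compl)
  have cover: "?H = U \<union> (?H - K)" using K UH by auto
  define v' where "v' x = (if x \<in> U then u' x else (\<lambda>w. 0))" for x
  have dv: "(v has_derivative v' x) (at x within ?H)" if "x \<in> U" for x
  proof -
    have "(v has_derivative u' x) (at x within U)"
      by (rule has_derivative_transform[OF that _ u'(1)[OF that]]) (simp add: v_def)
    then show ?thesis using that by (simp add: at_within_openin[OF U that] v'_def)
  qed
  have dv0: "(v has_derivative (\<lambda>w. 0)) (at x within ?H)" if "x \<in> ?H - K" for x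
  proof -
    have "(v has_derivative (\<lambda>w. 0)) (at x within ?H - K)"
      by (rule has_derivative_transform[OF that _ has_derivative_const[of 0]]) (auto simp: v_def supp)
    then show ?thesis by (simp add: at_within_openin[OF openK that])
  qed
  \<comment> \<open>On \<open>U - K\<close> both descriptions of the derivative of \<open>v\<close>
    are valid, and the derivative is unique.\<close>
  have u'0: "u' x = (\<lambda>w. 0)" if x: "x \<in> U - K" for x
  proof (rule has_derivative_unique_inward[OF inw(1)])
    show "(v has_derivative u' x) (at x within ?H)" using dv[of x] x by (simp add: v'_def)
    show "(v has_derivative (\<lambda>w. 0)) (at x within ?H)" using dv0[of x] x UH by auto
  qed (use x UH in auto)
  have dv_all: "(v has_derivative v' x) (at x within ?H)" if x: "x \<in> ?H" for x
    using dv[of x] dv0[of x] x K(2) by (cases "x \<in> U") (auto simp: v'_def)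
  have cont': "continuous_on ?H (\<lambda>x. v' x w)" for w
  proof -
    have "continuous_on U (\<lambda>x. v' x w)"
      by (rule continuous_on_eq[OF u'(2)[of w]]) (simp add: v'_def)
    moreover have "continuous_on (?H - K) (\<lambda>x. v' x w)"
      by (rule continuous_on_eq[OF continuous_on_const[of _ 0]]) (auto simp: v'_def u'0)
    ultimately have "continuous_on (U \<union> (?H - K)) (\<lambda>x. v' x w)"
      using U openK by (intro continuous_on_Un_local_open) (simp_all add: cover[symmetric])
    then show ?thesis using cover by simp
  qed
  have Cv: "C1_on ?H v" by (rule C1_onI[OF dv_all cont'])
  let ?g = "coord_deriv ?H v i"
  have g_eq: "?g x = v' x (axis i 1)" if "x \<in> ?H" for x
    by (rule coord_deriv_eq[OF inw(1) that UNIV_I dv_all[OF that]])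
  have gU: "coord_deriv U u i x = ?g x" if "x \<in> U" for x
    using coord_deriv_eq[OF inw(2) that UNIV_I u'(1)[OF that]] g_eq[of x] that UH by (auto simp: v'_def)
  have g0: "?g x = 0" if "x \<in> ?H - K" for x
    using g_eq[of x] that by (auto simp: v'_def u'0)
  have v0: "v x = 0" if "x \<notin> K" for x using that by (auto simp: v_def supp)
  have contg: "continuous_on ?H ?g"
    by (rule continuous_on_eq[OF cont'[of "axis i 1"]]) (simp add: g_eq)
  define h where "h x = indicator ?H x * ?g x" for x
  have h_eq: "indicator U x * coord_deriv U u i x = h x" for x
  proof (cases "x \<in> U")
    case True
    then show ?thesis using UH by (auto simp: h_def gU)
  next
    case False
    then show ?thesis using g0[of x] K(2) by (cases "x \<in> ?H") (auto simp: h_def)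
  qed
  have h_K: "h x = indicator K x * ?g x" for x
    using g0[of x] K(2) UH by (auto simp: h_def indicator_def)
  have int_h: "integrable lborel h"
    unfolding h_K[abs_def] using integrable_coord_lborel_compact[OF K(1), of ?g UNIV] contg K(2) UH
    by (simp add: coord_lborel_UNIV) (metis continuous_on_subset order_trans)
  show "integrable lborel (\<lambda>x. indicator U x * coord_deriv U u i x)"
    unfolding h_eq by (rule int_h)
  obtain R where R: "\<And>x. x \<in> K \<Longrightarrow> norm x \<le> R" "0 < R"
    using compact_imp_bounded[OF K(1)] bounded_pos by blast
  have mh: "h \<in> borel_measurable borel" using borel_measurable_integrable[OF int_h] by simp
  \<comment> \<open>For such \<open>x\<close> the parameter \<open>t\<close> is the
    \<open>i\<close>-th coordinate of the point, and on \<open>K\<close> this is at most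
    \<open>R\<close> in absolute value.\<close>
  have out: "x + t *\<^sub>R axis i 1 \<notin> K" if "x $ i = 0" "R < \<bar>t\<bar>" for x t
  proof
    assume "x + t *\<^sub>R axis i 1 \<in> K"
    then have "\<bar>(x + t *\<^sub>R axis i 1) $ i\<bar> \<le> R"
      using R(1) component_le_norm_cart order_trans by blast
    then show False using that by simp
  qed
  have inner: "(\<integral>y. h (x + y) \<partial>coord_lborel {i}) = (if i = bd_index then - v x else 0)"
    if xi: "x $ i = 0" and xb: "\<And>x. x \<in> U \<Longrightarrow> x $ bd_index \<ge> 0" for x
  proof -
    have "(\<integral>y. h (x + y) \<partial>coord_lborel {i}) = (\<integral>t. h (x + t *\<^sub>R axis i 1) \<partial>lborel)"
      by (rule integral_coord_lborel_singleton) (use mh in measurable)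
    also have "\<dots> = (if i = bd_index then - v x else 0)"
    proof -
      \<comment> \<open>In the boundary direction the line enters the half space at parameter 0.
        Otherwise it is cut off beyond the support, where the added 1 makes the inequality in
        \<open>out\<close> strict.\<close>
      define l where "l = (if i = bd_index then 0 else - (R + 1))"
      show ?thesis
      proof (cases "x \<in> ?H")
        case False
        then have "i \<noteq> bd_index" "x + t *\<^sub>R axis i 1 \<notin> ?H" for t
          using xi by (auto simp: mem_half_space axis_def)
        then show ?thesis by (simp add: h_def)
      next
        case True
        have inH: "x + t *\<^sub>R axis i 1 \<in> ?H \<longleftrightarrow> l \<le> t" if "i = bd_index \<or> - (R + 1) \<le> t" for t
          using True xi that by (auto simp: mem_half_space axis_def l_def)
        have sub: "(\<lambda>t. x + t *\<^sub>R axis i 1) ` {l..R + 1} \<subseteq> ?H"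
        proof (rule image_subsetI)
          fix t assume t: "t \<in> {l..R + 1}"
          then have "i = bd_index \<or> - (R + 1) \<le> t" by (cases "i = bd_index") (simp_all add: l_def)
          from inH[OF this] t show "x + t *\<^sub>R axis i 1 \<in> ?H" by simp
        qed
        have "h (x + t *\<^sub>R axis i 1) = indicator {l..R + 1} t *\<^sub>R ?g (x + t *\<^sub>R axis i 1)" for t
        proof (cases "\<bar>t\<bar> \<le> R + 1")
          case t: True
          then have "x + t *\<^sub>R axis i 1 \<in> ?H \<longleftrightarrow> l \<le> t" by (intro inH) (simp add: abs_le_iff)
          then show ?thesis using t by (simp add: h_def indicator_def abs_le_iff)
        next
          case t: False
          then have "h (x + t *\<^sub>R axis i 1) = 0" using out[OF xi, of t] by (simp add: h_K)
          moreover have "t \<notin> {l..R + 1}" using t R(2) by (auto simp: l_def split: if_splits)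
          ultimately show ?thesis by simp
        qed
        then have "(\<integral>t. h (x + t *\<^sub>R axis i 1) \<partial>lborel) =
            (\<integral>t. indicator {l..R + 1} t *\<^sub>R ?g (x + t *\<^sub>R axis i 1) \<partial>lborel)" by simp
        also have "\<dots> = v (x + (R + 1) *\<^sub>R axis i 1) - v (x + l *\<^sub>R axis i 1)"
        proof (rule integral_FTC_Icc)
          show "l \<le> R + 1" using R(2) by (simp add: l_def)
          show "((\<lambda>t. v (x + t *\<^sub>R axis i 1)) has_vector_derivative ?g (x + t *\<^sub>R axis i 1)) (at t within {l..R + 1})"
            if "l \<le> t" "t \<le> R + 1" for t
            by (rule coord_deriv_line[OF inw(1) Cv sub]) (use that in auto)
          show "continuous_on {l..R + 1} (\<lambda>t. ?g (x + t *\<^sub>R axis i 1))"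
            by (rule continuous_on_compose2[OF contg _ sub]) (intro continuous_intros)
        qed
        also have "\<dots> = (if i = bd_index then - v x else 0)"
          using v0[OF out[OF xi, of "R + 1"]] v0[OF out[OF xi, of "- (R + 1)"]] R(2) by (auto simp: l_def)
        finally show ?thesis .
      qed
    qed
    finally show ?thesis .
  qed
  have Un: "- {i} \<union> {i} = UNIV" by auto
  have "integral\<^sup>L lborel h = (\<integral>x. (\<integral>y. h (x + y) \<partial>coord_lborel {i}) \<partial>coord_lborel (- {i}))"
    using integral_coord_lborel_Un[of "- {i}" "{i}" h] int_h unfolding Un coord_lborel_UNIV by simp
  also have "\<dots> = (\<integral>x. (if i = bd_index then - v x else 0) \<partial>coord_lborel (- {i}))"
  proof (rule integral_cong_AE)
    \<comment> \<open>\<open>inner\<close> requires \<open>x $ i = 0\<close>, which holds almost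
      everywhere for \<open>coord_lborel (- {i})\<close>.\<close>
    show "AE x in coord_lborel (- {i}). (\<integral>y. h (x + y) \<partial>coord_lborel {i}) = (if i = bd_index then - v x else 0)"
      using AE_coord_lborel[of "- {i}"]
      by eventually_elim (rule inner, use UH in \<open>auto simp: mem_half_space\<close>)
    interpret product_sigma_finite "\<lambda>_::'n. lborel :: real measure" ..
    interpret J: finite_product_sigma_finite "\<lambda>_::'n. lborel :: real measure" "{i}" by standard simp
    have [measurable]: "h \<in> borel_measurable borel" by (rule mh)
    have "(\<lambda>x. \<integral>y. h (x + coord_embed {i} y) \<partial>Pi\<^sub>M {i} (\<lambda>_. lborel)) \<in> borel_measurable borel"
      by (rule J.borel_measurable_lebesgue_integral) measurable
    then show "(\<lambda>x. \<integral>y. h (x + y) \<partial>coord_lborel {i}) \<in> borel_measurable (coord_lborel (- {i}))"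
      by (simp add: coord_lborel_altdef integral_distr)
    have "(\<lambda>x. if x \<in> ?H then v x else 0) \<in> borel_measurable borel"
      using closed_half_space C1_on_continuous[OF Cv]
      by (intro borel_measurable_continuous_on_if) (auto intro: borel_closed)
    moreover have "(\<lambda>x. if x \<in> ?H then v x else 0) = v"
      using UH by (auto simp: v_def fun_eq_iff)
    ultimately show "(\<lambda>x. if i = bd_index then - v x else 0) \<in> borel_measurable (coord_lborel (- {i}))"
      by (cases "i = bd_index") auto
  qed
  also have "\<dots> = (if i = bd_index then - (\<integral>x. indicator U x * u x \<partial>coord_lborel (- {bd_index})) else 0)"
  proof -
    have "v x = indicator U x * u x" for x by (simp add: v_def)
    then show ?thesis by simp
  qed
  finally show "(\<integral>x. indicator U x * coord_deriv U u i x \<partial>lborel) =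
        (if i = bd_index then - (\<integral>x. indicator U x * u x \<partial>coord_lborel (- {bd_index})) else 0)"
    unfolding h_eq .
qed

section \<open>The divergence of the gradient and the boundary flux\<close>

locale minimal_patch = immersed_patch U \<Psi>
  for U :: "(real^'n::finite) set" and \<Psi> :: "real^'n \<Rightarrow> 'e::euclidean_space \<times> real" +
  fixes a :: "'e \<times> real"
  assumes a: "a \<in> hyperbolic_space"
    and minimal: "\<And>x N. x \<in> U \<Longrightarrow> lorentz N N = 1 \<Longrightarrow> lorentz N (\<Psi> x) = 0 \<Longrightarrow>
      (\<And>i. lorentz N (D i x) = 0) \<Longrightarrow>
      trace (matrix_inv (G x) ** (\<chi> i j. lorentz (coord_deriv U (D j) i x) N)) = 0"
begin

lemma Z_eq:
  assumes x: "x \<in> U"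
  shows "Z x = (real CARD('n) * dens x) *\<^sub>R \<Psi> x"
proof -
  obtain N where N: "lorentz N N = 1" "lorentz N (\<Psi> x) = 0" "\<And>i. lorentz N (D i x) = 0"
    using unit_normal_exists[OF x] by blast
  have "Z x - (real CARD('n) * dens x) *\<^sub>R \<Psi> x = 0"
  proof (rule frame_complete[OF x N])
    show "lorentz (Z x - (real CARD('n) * dens x) *\<^sub>R \<Psi> x) (\<Psi> x) = 0"
      by (simp add: lorentz.diff_left lorentz.scaleR_left lorentz_Z_\<Psi>[OF x] lorentz_\<Psi>[OF x])
    show "lorentz (Z x - (real CARD('n) * dens x) *\<^sub>R \<Psi> x) (D i x) = 0" for i
      by (simp add: lorentz.diff_left lorentz.scaleR_left lorentz_Z_D[OF x] lorentz_commute[of "\<Psi> x"] lorentz_D_\<Psi>[OF x])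
    show "lorentz (Z x - (real CARD('n) * dens x) *\<^sub>R \<Psi> x) N = 0"
      by (simp add: lorentz.diff_left lorentz.scaleR_left lorentz_Z_normal[OF x N(3) minimal[OF x N]]
          lorentz_commute[of "\<Psi> x"] N)
  qed
  then show ?thesis by simp
qed

text \<open>\<open>ch\<close> is the hyperbolic cosine of the distance from \<open>a\<close>, \<open>X\<close> is its gradient, and \<open>Y\<close> is the
  gradient multiplied by the volume density.\<close>

definition ch :: "real^'n \<Rightarrow> real" where
  "ch x = - lorentz a (\<Psi> x)"

definition X :: "real^'n \<Rightarrow> real^'n" where
  "X x = (\<chi> i. - (\<Sum>j\<in>UNIV. Ginv x $ i $ j * lorentz a (D j x)))"

definition Y :: "'n \<Rightarrow> real^'n \<Rightarrow> real" where
  "Y i x = - lorentz a (V i x)"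

lemma Y_eq: "Y i x = dens x * X x $ i"
  by (simp add: Y_def V_def X_def lorentz.sum_right lorentz.scaleR_right sum_distrib_left mult.assoc)

lemma C1_Y: "C1_on U (Y i)"
  using C1_on_bounded_linear[OF bounded_linear_minus[OF bounded_bilinear.bounded_linear_right[OF bounded_bilinear_lorentz, of a]] C1_V]
  by (simp add: Y_def[abs_def])

lemma divergence_Y:
  assumes x: "x \<in> U"
  shows "(\<Sum>i\<in>UNIV. coord_deriv U (Y i) i x) = real CARD('n) * dens x * ch x"
proof -
  have "coord_deriv U (Y i) i x = - lorentz a (coord_deriv U (V i) i x)" for i
  proof -
    have "(Y i has_derivative (\<lambda>v. - lorentz a (frechet_derivative (V i) (at x within U) v))) (at x within U)"
      unfolding Y_def[abs_def]
      by (intro has_derivative_minus bounded_linear.has_derivative[OF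
          bounded_bilinear.bounded_linear_right[OF bounded_bilinear_lorentz]] C1_on_has_derivative[OF C1_V x])
    from coord_deriv_eq[OF U x UNIV_I this] show ?thesis by (simp add: coord_deriv_def)
  qed
  then have "(\<Sum>i\<in>UNIV. coord_deriv U (Y i) i x) = - lorentz a (Z x)"
    by (simp add: Z_def lorentz.sum_right sum_negf)
  then show ?thesis by (simp add: Z_eq[OF x] lorentz.scaleR_right ch_def)
qed

text \<open>The product rule for the cut-off gradient. The last summand is the derivative of
  \<open>u\<close> along the gradient, which will cancel over a partition of unity.\<close>

lemma divergence_mult_Y:
  assumes x: "x \<in> U" and u: "C1_on U u"
  shows "(\<Sum>i\<in>UNIV. coord_deriv U (\<lambda>y. u y * Y i y) i x) =
    dens x * (real CARD('n) * ch x * u x + frechet_derivative u (at x within U) (X x))"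
proof -
  have "(\<Sum>i\<in>UNIV. coord_deriv U (\<lambda>y. u y * Y i y) i x) =
      u x * (\<Sum>i\<in>UNIV. coord_deriv U (Y i) i x) + (\<Sum>i\<in>UNIV. coord_deriv U u i x * Y i x)"
    by (simp add: coord_deriv_mult[OF U u C1_Y x] sum.distrib sum_distrib_left)
  also have "(\<Sum>i\<in>UNIV. coord_deriv U u i x * Y i x) = dens x * frechet_derivative u (at x within U) (X x)"
    unfolding linear_sum_axis[OF has_derivative_linear[OF C1_on_has_derivative[OF u x]], of "X x"]
    by (simp add: Y_eq coord_deriv_def sum_distrib_left mult_ac)
  finally show ?thesis by (simp add: divergence_Y[OF x] algebra_simps)
qed

text \<open>A description of the gradient by inner products with tangent vectors; it does not refer
  to coordinates and therefore survives a change of chart.\<close>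

lemma X_gradient:
  assumes x: "x \<in> U"
  shows "lorentz (d\<Psi> x (X x)) (d\<Psi> x w) = - lorentz a (d\<Psi> x w)"
proof -
  have "X x = - (Ginv x *v (\<chi> j. lorentz a (D j x)))"
    by (simp add: X_def matrix_vector_mult_def vec_eq_iff)
  then have "G x *v X x = - (\<chi> j. lorentz a (D j x))"
    by (simp add: matrix_vector_mul_assoc G_Ginv[OF x] linear_neg[OF matrix_vector_mul_linear])
  then have "(G x *v X x) \<bullet> w = - (\<Sum>i\<in>UNIV. lorentz a (D i x) * w $ i)"
    by (simp add: inner_vec_def sum_negf)
  then show ?thesis
    by (simp add: G_inner[OF x] d\<Psi>_sum[OF x, of w] lorentz.sum_right lorentz.scaleR_right mult.commute)
qed

text \<open>The difference of two solutions has length zero in a positive definite metric.\<close>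

lemma X_unique:
  assumes x: "x \<in> U" and v: "\<And>w. lorentz (d\<Psi> x v) (d\<Psi> x w) = - lorentz a (d\<Psi> x w)"
  shows "v = X x"
proof -
  have "lorentz (d\<Psi> x (v - X x)) (d\<Psi> x (v - X x)) = 0"
    by (simp add: linear_diff[OF linear_d\<Psi>[OF x]] lorentz.diff_left lorentz.diff_right v X_gradient[OF x])
  then have "(G x *v (v - X x)) \<bullet> (v - X x) = 0" by (simp add: G_inner[OF x])
  then have "v - X x = 0" using G_pos[OF x, of "v - X x"] by fastforce
  then show ?thesis by simp
qed

text \<open>\<open>?b\<close> is the projection of \<open>a\<close> to the tangent space of the
  hyperboloid and has square \<open>(ch x)\<^sup>2 - 1\<close>; \<open>- ?v\<close> is its part
  tangent to the hypersurface. The rest \<open>?b + ?v\<close> is still tangent to the hyperboloid,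
  so its square, the difference of the two sides, is nonnegative.\<close>

lemma X_length:
  assumes x: "x \<in> U"
  shows "(G x *v X x) \<bullet> X x \<le> (ch x)\<^sup>2 - 1"
proof -
  let ?v = "d\<Psi> x (X x)" and ?b = "a - ch x *\<^sub>R \<Psi> x"
  have aa: "lorentz a a = -1" using a by (simp add: hyperbolic_space_def)
  have a\<Psi>: "lorentz a (\<Psi> x) = - ch x" "lorentz (\<Psi> x) a = - ch x"
    by (simp_all add: ch_def lorentz_commute)
  have b\<Psi>: "lorentz ?b (\<Psi> x) = 0"
    by (simp add: lorentz.diff_left lorentz.scaleR_left lorentz_\<Psi>[OF x] a\<Psi>)
  have bb: "lorentz ?b ?b = (ch x)\<^sup>2 - 1"
    by (simp add: lorentz.diff_left lorentz.diff_right lorentz.scaleR_left lorentz.scaleR_right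
        lorentz_\<Psi>[OF x] aa a\<Psi> power2_eq_square)
  have bv: "lorentz ?b ?v = - lorentz ?v ?v"
    by (simp add: lorentz.diff_left lorentz.scaleR_left X_gradient[OF x] lorentz_commute[of "\<Psi> x"]
        lorentz_d\<Psi>_\<Psi>[OF x])
  have "0 \<le> lorentz (?b + ?v) (?b + ?v)"
    by (rule lorentz_nonneg[OF hyp[OF x]]) (simp add: lorentz.add_left b\<Psi> lorentz_d\<Psi>_\<Psi>[OF x])
  also have "\<dots> = lorentz ?b ?b + 2 * lorentz ?b ?v + lorentz ?v ?v"
    by (simp only: lorentz.add_left lorentz.add_right lorentz_commute[of ?v ?b])
  finally show ?thesis by (simp add: G_inner[OF x] bb bv)
qed

lemma flux_bound:
  assumes x: "x \<in> U"
  shows "\<bar>Y b x\<bar> \<le> sqrt ((ch x)\<^sup>2 - 1) * sqrt (det (block (- {b}) (G x)))"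
proof -
  \<comment> \<open>Column \<open>b\<close> of the inverse metric is the gradient of the
    \<open>b\<close>-th coordinate: its inner product with any vector is the \<open>b\<close>-th
    component of that vector.\<close>
  let ?y = "Ginv x *v axis b 1"
  have y: "G x *v ?y = axis b 1" by (simp add: matrix_vector_mul_assoc G_Ginv[OF x])
  have X: "(G x *v ?y) \<bullet> X x = X x $ b" "(G x *v ?y) \<bullet> ?y = ?y $ b"
    unfolding y by (simp_all add: inner_axis')
  have y0: "0 \<le> ?y $ b"
    using G_pos[OF x, of ?y] unfolding X by (cases "?y = 0") auto
  have "(X x $ b)\<^sup>2 \<le> ?y $ b * ((G x *v X x) \<bullet> X x)"
    using posdef_Cauchy_Schwarz[OF transpose_G G_pos[OF x], of ?y "X x"] unfolding X .
  also have "\<dots> \<le> ?y $ b * ((ch x)\<^sup>2 - 1)"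
    by (rule mult_left_mono[OF X_length[OF x] y0])
  finally have *: "(X x $ b)\<^sup>2 \<le> ?y $ b * ((ch x)\<^sup>2 - 1)" .
  have "(Y b x)\<^sup>2 = det (G x) * (X x $ b)\<^sup>2"
    using det_G_pos[OF x] by (simp add: Y_eq dens_def power_mult_distrib)
  also have "\<dots> \<le> det (G x) * (?y $ b * ((ch x)\<^sup>2 - 1))"
    using * det_G_pos[OF x] by (simp add: mult_left_mono)
  also have "\<dots> = ((ch x)\<^sup>2 - 1) * det (block (- {b}) (G x))"
    using det_block_cofactor[OF y] by (simp add: algebra_simps)
  finally have "sqrt ((Y b x)\<^sup>2) \<le> sqrt (((ch x)\<^sup>2 - 1) * det (block (- {b}) (G x)))"
    by (rule real_sqrt_le_mono)
  then show ?thesis by (simp add: real_sqrt_mult)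
qed

end

section \<open>The Riemannian measure\<close>

text \<open>One construction of the measure serves both \<open>M\<close>, with all coordinates, and
  its boundary, with the coordinates other than \<open>bd_index\<close>.\<close>

locale compact_patched =
  fixes I :: "'n::finite set" and H :: "(real^'n) set" and M :: "'m::t2_space set"
    and A :: "('m, 'n) chart set" and \<psi> :: "'m \<Rightarrow> 'e::euclidean_space \<times> real"
  assumes model: "model_space I H" and atlas: "smooth_atlas H M A" and compact: "compact M"
    and smooth_\<psi>: "\<And>c. c \<in> A \<Longrightarrow> smooth_on (chart_img c) (\<psi> \<circ> chart_inv c)"
begin

lemma H_proj: "x \<in> H \<Longrightarrow> coord_proj I x = x"
  using model by (simp add: model_space_def)

lemma chart:
  assumes "c \<in> A"
  shows "openin (top_of_set M) (fst c)" "openin (top_of_set H) (chart_img c)"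
    "homeomorphism (fst c) (chart_img c) (snd c) (chart_inv c)"
  using atlas assms by (auto simp: smooth_atlas_def)

lemma M_eq: "M = (\<Union>c\<in>A. fst c)"
  using atlas by (simp add: smooth_atlas_def)

lemma chart_inv_chart: "c \<in> A \<Longrightarrow> p \<in> fst c \<Longrightarrow> chart_inv c (snd c p) = p"
  and chart_chart_inv: "c \<in> A \<Longrightarrow> x \<in> chart_img c \<Longrightarrow> snd c (chart_inv c x) = x"
  and chart_inv_mem: "c \<in> A \<Longrightarrow> x \<in> chart_img c \<Longrightarrow> chart_inv c x \<in> fst c"
  and chart_mem: "c \<in> A \<Longrightarrow> p \<in> fst c \<Longrightarrow> snd c p \<in> chart_img c"
  using chart(3) unfolding homeomorphism_def by blast+

lemma chart_continuous: "c \<in> A \<Longrightarrow> continuous_on (fst c) (snd c)"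
  and chart_inv_continuous: "c \<in> A \<Longrightarrow> continuous_on (chart_img c) (chart_inv c)"
  using chart(3) unfolding homeomorphism_def by blast+

lemma fst_chart_subset: "c \<in> A \<Longrightarrow> fst c \<subseteq> M" and chart_img_subset: "c \<in> A \<Longrightarrow> chart_img c \<subseteq> H"
  using chart openin_imp_subset by blast+

lemma inj_on_chart: "c \<in> A \<Longrightarrow> inj_on (snd c) (fst c)"
  by (rule inj_on_inverseI) (rule chart_inv_chart)

lemma inward_chart_img: "c \<in> A \<Longrightarrow> inward I (chart_img c)"
  using inward_openin[OF model chart(2)] .

lemma chart_img_borel [measurable]:
  assumes "c \<in> A"
  shows "chart_img c \<in> sets borel"
proof -
  obtain T where T: "open T" "chart_img c = H \<inter> T" using chart(2)[OF assms] by (auto simp: openin_open)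
  have "H \<in> sets borel" "T \<in> sets borel"
    using model T(1) by (simp_all add: model_space_def borel_closed borel_open)
  then show ?thesis unfolding T(2) by (rule sets.Int)
qed

lemma fst_chart_sets: "c \<in> A \<Longrightarrow> fst c \<in> sets (restrict_space borel M)"
proof -
  assume "c \<in> A"
  from chart(1)[OF this] obtain T where "open T" "fst c = M \<inter> T" by (auto simp: openin_open)
  then show ?thesis by (auto simp: sets_restrict_space intro: borel_open)
qed

text \<open>Measurability of images under a chart is reduced in this way to measurability of the
  continuous inverse.\<close>

lemma chart_image_eq:
  assumes c: "c \<in> A" and B: "B \<subseteq> fst c"
  shows "snd c ` B = chart_img c \<inter> chart_inv c -` B"
proof (intro equalityI subsetI)
  fix x assume "x \<in> snd c ` B"
  then obtain p where p: "p \<in> B" "x = snd c p" by (rule imageE)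
  then have "p \<in> fst c" using B by blast
  then show "x \<in> chart_img c \<inter> chart_inv c -` B"
    using p chart_inv_chart[OF c] chart_mem[OF c] by simp
next
  fix x assume "x \<in> chart_img c \<inter> chart_inv c -` B"
  then have "x = snd c (chart_inv c x)" "chart_inv c x \<in> B" using chart_chart_inv[OF c] by simp_all
  then show "x \<in> snd c ` B" by (rule image_eqI)
qed

lemma chart_inv_measurable:
  assumes c: "c \<in> A"
  shows "chart_inv c \<in> restrict_space borel (chart_img c) \<rightarrow>\<^sub>M restrict_space borel M"
proof (rule measurable_restrict_space2)
  show "chart_inv c \<in> space (restrict_space borel (chart_img c)) \<rightarrow> M"
    using chart_inv_mem[OF c] fst_chart_subset[OF c] by (auto simp: space_restrict_space)
  show "chart_inv c \<in> restrict_space borel (chart_img c) \<rightarrow>\<^sub>M borel"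
    by (rule borel_measurable_continuous_on_restrict[OF chart_inv_continuous[OF c]])
qed

lemma chart_image_borel:
  assumes c: "c \<in> A" and B: "B \<in> sets (restrict_space borel M)" "B \<subseteq> fst c"
  shows "snd c ` B \<in> sets borel"
proof -
  have "chart_inv c -` B \<inter> chart_img c \<in> sets (restrict_space borel (chart_img c))"
    using measurable_sets[OF chart_inv_measurable[OF c] B(1)] by (simp add: space_restrict_space)
  then show ?thesis
    using chart_img_borel[OF c] by (simp add: chart_image_eq[OF c B(2)] sets_restrict_space_iff Int_commute)
qed

abbreviation dens :: "('m, 'n) chart \<Rightarrow> real^'n \<Rightarrow> real" where
  "dens \<equiv> volume_density I \<psi>"

lemma continuous_dens:
  assumes c: "c \<in> A"
  shows "continuous_on (chart_img c) (dens c)"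
proof -
  have D: "continuous_on (chart_img c) (coord_deriv (chart_img c) (\<psi> \<circ> chart_inv c) i)" if "i \<in> I" for i
    by (rule smooth_on_continuous[OF smooth_on_coord_deriv[OF inward_chart_img[OF c] that smooth_\<psi>[OF c]]])
  have "continuous_on (chart_img c) (\<lambda>x. block I (induced_metric \<psi> c x) $ i $ j)" for i j
    by (cases "i \<in> I \<and> j \<in> I")
      (auto simp: block_def induced_metric_def intro!: bounded_bilinear.continuous_on[OF bounded_bilinear_lorentz] D)
  then show ?thesis
    unfolding volume_density_def[abs_def] det_def
    by (intro continuous_on_real_sqrt continuous_on_sum continuous_on_mult continuous_on_const continuous_on_prod)
qed

definition chart_measure :: "('m, 'n) chart \<Rightarrow> 'm set \<Rightarrow> ennreal" where
  "chart_measure c B = (\<integral>\<^sup>+x\<in>snd c ` B. ennreal (dens c x) \<partial>coord_lborel I)"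

lemma dens_measurable:
  assumes c: "c \<in> A"
  shows "(\<lambda>x. indicator (chart_img c) x * dens c x) \<in> borel_measurable borel"
proof -
  have "(\<lambda>x. if x \<in> chart_img c then dens c x else 0) \<in> borel_measurable borel"
    using chart_img_borel[OF c] continuous_dens[OF c] by (intro borel_measurable_continuous_on_if) auto
  moreover have "(\<lambda>x. if x \<in> chart_img c then dens c x else 0) = (\<lambda>x. indicator (chart_img c) x * dens c x)"
    by auto
  ultimately show ?thesis by simp
qed

text \<open>The density is controlled on the chart image only. Cut off with the indicator it is
  Borel on the whole space, so that additivity of \<open>chart_measure\<close> is inherited from a
  genuine measure.\<close>

lemma chart_measure_eq:
  assumes c: "c \<in> A" and B: "B \<in> sets (restrict_space borel M)" "B \<subseteq> fst c"
  shows "chart_measure c B =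
    emeasure (density (coord_lborel I) (\<lambda>x. ennreal (indicator (chart_img c) x * dens c x))) (snd c ` B)"
proof -
  have sub: "snd c ` B \<subseteq> chart_img c" using B(2) by (auto simp: chart_img_def)
  have "ennreal (dens c x) * indicator (snd c ` B) x =
      ennreal (indicator (chart_img c) x * dens c x) * indicator (snd c ` B) x" for x
    using subsetD[OF sub, of x] by (cases "x \<in> snd c ` B") simp_all
  then show ?thesis
    unfolding chart_measure_def
    using chart_image_borel[OF c B] dens_measurable[OF c] by (simp add: emeasure_density)
qed

lemma chart_measure_suminf:
  fixes B :: "nat \<Rightarrow> 'm set"
  assumes c: "c \<in> A" and B: "range B \<subseteq> sets (restrict_space borel M)" "\<And>i. B i \<subseteq> fst c"
    and disj: "disjoint_family B"
  shows "(\<Sum>i. chart_measure c (B i)) = chart_measure c (\<Union>i. B i)"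
proof -
  let ?N = "density (coord_lborel I) (\<lambda>x. ennreal (indicator (chart_img c) x * dens c x))"
  have "(\<Sum>i. emeasure ?N (snd c ` B i)) = emeasure ?N (\<Union>i. snd c ` B i)"
  proof (rule suminf_emeasure)
    show "range (\<lambda>i. snd c ` B i) \<subseteq> sets ?N" using chart_image_borel[OF c _ B(2)] B(1) by auto
    show "disjoint_family (\<lambda>i. snd c ` B i)"
      using disj inj_on_chart[OF c] B(2)
      unfolding disjoint_family_on_def by (metis (no_types) image_Int_subset image_empty inj_on_image_Int UNIV_I)
  qed
  moreover have "(\<Union>i. B i) \<in> sets (restrict_space borel M)" using B(1) by auto
  ultimately show ?thesis
    using B by (subst (1 2) chart_measure_eq[OF c]) (auto simp: image_UN)
qed

section \<open>Chart transitions and the transformation of the density\<close>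

definition overlap :: "('m, 'n) chart \<Rightarrow> ('m, 'n) chart \<Rightarrow> (real^'n) set" where
  "overlap c d = snd c ` (fst c \<inter> fst d)"

lemma openin_overlap:
  assumes c: "c \<in> A" and d: "d \<in> A"
  shows "openin (top_of_set H) (overlap c d)"
proof -
  have "openin (top_of_set (fst c)) (fst c \<inter> fst d)"
    using chart(1)[OF c] chart(1)[OF d] fst_chart_subset[OF c]
    by (metis inf_commute inf_le1 openin_Int openin_subset_trans)
  then have "openin (top_of_set (chart_img c)) (overlap c d)"
    unfolding overlap_def using chart(3)[OF c] homeomorphism_imp_open_map by blast
  then show ?thesis using chart(2)[OF c] openin_trans by blast
qed

lemma overlap_subset: "c \<in> A \<Longrightarrow> overlap c d \<subseteq> chart_img c"
  by (auto simp: overlap_def chart_img_def)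

lemma transition_mem: "c \<in> A \<Longrightarrow> d \<in> A \<Longrightarrow> x \<in> overlap c d \<Longrightarrow> (snd d \<circ> chart_inv c) x \<in> overlap d c"
  by (auto simp: overlap_def chart_inv_chart)

lemma transition_smooth: "c \<in> A \<Longrightarrow> d \<in> A \<Longrightarrow> smooth_on (overlap c d) (snd d \<circ> chart_inv c)"
  using atlas by (auto simp: smooth_atlas_def overlap_def)

lemma inward_overlap: "c \<in> A \<Longrightarrow> d \<in> A \<Longrightarrow> inward I (overlap c d)"
  using inward_openin[OF model openin_overlap] .

definition dtrans :: "('m, 'n) chart \<Rightarrow> ('m, 'n) chart \<Rightarrow> real^'n \<Rightarrow> real^'n \<Rightarrow> real^'n" where
  "dtrans c d x = frechet_derivative (snd d \<circ> chart_inv c) (at x within overlap c d)"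

lemma has_derivative_transition:
  assumes "c \<in> A" "d \<in> A" "x \<in> overlap c d"
  shows "(snd d \<circ> chart_inv c has_derivative dtrans c d x) (at x within overlap c d)"
  unfolding dtrans_def by (rule smooth_on_has_derivative[OF transition_smooth]) (use assms in auto)

text \<open>The chain rule through the transition map. The overlap is relatively open, so
  derivatives within it and within the chart image coincide.\<close>

lemma has_derivative_change_chart:
  fixes u :: "'m \<Rightarrow> 'b::real_normed_vector"
  assumes c: "c \<in> A" and d: "d \<in> A" and x: "x \<in> overlap c d"
    and E: "(u \<circ> chart_inv d has_derivative E) (at ((snd d \<circ> chart_inv c) x) within chart_img d)"
  shows "(u \<circ> chart_inv c has_derivative E \<circ> dtrans c d x) (at x within chart_img c)"
proof -
  let ?\<tau> = "snd d \<circ> chart_inv c"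
  have "?\<tau> ` overlap c d \<subseteq> chart_img d"
    using transition_mem[OF c d] overlap_subset[OF d] by blast
  then have "(u \<circ> chart_inv d has_derivative E) (at (?\<tau> x) within ?\<tau> ` overlap c d)"
    using has_derivative_subset[OF E] by blast
  from diff_chain_within[OF has_derivative_transition[OF c d x] this]
  have "(u \<circ> chart_inv d \<circ> ?\<tau> has_derivative E \<circ> dtrans c d x) (at x within overlap c d)" .
  then have "(u \<circ> chart_inv c has_derivative E \<circ> dtrans c d x) (at x within overlap c d)"
    by (rule has_derivative_transform[OF x, rotated])
      (auto simp: overlap_def chart_inv_chart[OF c] chart_inv_chart[OF d])
  moreover have "x \<in> chart_img c" using overlap_subset[OF c] x by blast
  then have "at x within overlap c d = at x within chart_img c"
    by (simp add: at_within_openin[OF openin_overlap[OF c d] x] at_within_openin[OF chart(2)[OF c]])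
  ultimately show ?thesis by simp
qed

text \<open>Transition maps take values in \<open>H\<close>, where the coordinates outside
  \<open>I\<close> vanish identically. Hence only indices in \<open>I\<close> enter the chain rule
  for the metric.\<close>

lemma dtrans_component:
  assumes c: "c \<in> A" and d: "d \<in> A" and x: "x \<in> overlap c d" and i: "i \<in> I" and k: "k \<notin> I"
  shows "dtrans c d x (axis i 1) $ k = 0"
proof -
  let ?\<tau> = "snd d \<circ> chart_inv c"
  have z: "?\<tau> y $ k = 0" if "y \<in> overlap c d" for y
  proof -
    have "?\<tau> y \<in> H" using transition_mem[OF c d that] overlap_subset[OF d] chart_img_subset[OF d] by blast
    then show ?thesis using H_proj[of "?\<tau> y"] k by (metis coord_proj_nth)
  qed
  have 1: "((\<lambda>y. ?\<tau> y $ k) has_derivative (\<lambda>v. dtrans c d x v $ k)) (at x within overlap c d)"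
    using bounded_linear.has_derivative[OF bounded_linear_vec_nth has_derivative_transition[OF c d x]] .
  have 2: "((\<lambda>y. ?\<tau> y $ k) has_derivative (\<lambda>v. 0)) (at x within overlap c d)"
    by (rule has_derivative_transform[OF x z has_derivative_const])
  show ?thesis
    by (rule has_derivative_unique_direction[OF 1 2])
      (use inward_overlap[OF c d] x i in \<open>auto simp: inward_def\<close>)
qed

text \<open>By the chain rule the partial derivatives of the immersion in one chart are combinations
  of those in the other, with the Jacobian as coefficients; the two metrics are therefore
  congruent.\<close>

lemma dens_transition:
  assumes c: "c \<in> A" and d: "d \<in> A" and x: "x \<in> overlap c d"
  shows "dens c x = \<bar>det (block I (matrix (dtrans c d x)))\<bar> * dens d ((snd d \<circ> chart_inv c) x)"
  unfolding volume_density_def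
proof (rule sqrt_det_block_congruence)
  fix i j assume i: "i \<in> I" and j: "j \<in> I"
  let ?y = "(snd d \<circ> chart_inv c) x" and ?J = "matrix (dtrans c d x)"
  have xc: "x \<in> chart_img c" using overlap_subset[OF c] x by blast
  have yd: "?y \<in> chart_img d" using transition_mem[OF c d x] overlap_subset[OF d] by blast
  define E where "E = frechet_derivative (\<psi> \<circ> chart_inv d) (at ?y within chart_img d)"
  have E: "(\<psi> \<circ> chart_inv d has_derivative E) (at ?y within chart_img d)"
    unfolding E_def by (rule smooth_on_has_derivative[OF smooth_\<psi>[OF d] yd])
  have lE: "linear E" using E has_derivative_linear by blast
  have "coord_deriv (chart_img c) (\<psi> \<circ> chart_inv c) i x =
      (\<Sum>k\<in>I. ?J $ k $ i *\<^sub>R coord_deriv (chart_img d) (\<psi> \<circ> chart_inv d) k ?y)" if i: "i \<in> I" for i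
  proof -
    have "coord_deriv (chart_img c) (\<psi> \<circ> chart_inv c) i x = E (dtrans c d x (axis i 1))"
      using coord_deriv_eq[OF inward_chart_img[OF c] xc i has_derivative_change_chart[OF c d x E]] by simp
    also have "\<dots> = (\<Sum>k\<in>UNIV. dtrans c d x (axis i 1) $ k *\<^sub>R E (axis k 1))"
      by (rule linear_sum_axis[OF lE])
    also have "\<dots> = (\<Sum>k\<in>I. dtrans c d x (axis i 1) $ k *\<^sub>R E (axis k 1))"
      by (intro sum.mono_neutral_right) (auto simp: dtrans_component[OF c d x i])
    also have "\<dots> = (\<Sum>k\<in>I. ?J $ k $ i *\<^sub>R coord_deriv (chart_img d) (\<psi> \<circ> chart_inv d) k ?y)"
      by (simp add: matrix_def E_def coord_deriv_def)
    finally show ?thesis .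
  qed
  note D = this
  show "induced_metric \<psi> c x $ i $ j =
      (\<Sum>k\<in>I. \<Sum>l\<in>I. ?J $ k $ i * induced_metric \<psi> d ?y $ k $ l * ?J $ l $ j)"
    unfolding induced_metric_def
    by (simp add: D[OF i] D[OF j] lorentz.sum_left lorentz.scaleR_left)
      (simp add: lorentz.sum_right lorentz.scaleR_right sum_distrib_left mult_ac)
qed

text \<open>The Jacobian factor in the change of variables is exactly the factor by which the two
  densities differ.\<close>

lemma chart_measure_consistent:
  assumes c: "c \<in> A" and d: "d \<in> A" and B: "B \<in> sets (restrict_space borel M)" "B \<subseteq> fst c" "B \<subseteq> fst d"
  shows "chart_measure c B = chart_measure d B"
proof -
  let ?\<tau> = "snd d \<circ> chart_inv c" and ?S = "snd c ` B"
  have S: "?S \<subseteq> overlap c d" using B by (auto simp: overlap_def)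
  have img: "?\<tau> ` ?S = snd d ` B"
    using B(2) chart_inv_chart[OF c] by (force simp: image_iff subset_iff)
  \<comment> \<open>\<open>sqrt\<close> of a negative number is negative, and the locale does not
    exclude a negative determinant. \<open>max 0\<close> supplies the sign that the change of
    variables requires and is absorbed by \<open>ennreal\<close>.\<close>
  let ?f = "\<lambda>y. max 0 (indicator (chart_img d) y * dens d y)"
  have key: "indicator ?S x * (\<bar>det (block I (matrix (dtrans c d x)))\<bar> * ?f (?\<tau> x)) =
      max 0 (indicator ?S x * (indicator (chart_img c) x * dens c x))" for x
  proof (cases "x \<in> ?S")
    case True
    then have x: "x \<in> overlap c d" using S by blast
    have "?\<tau> x \<in> chart_img d" "x \<in> chart_img c"
      using transition_mem[OF c d x] overlap_subset[OF d] overlap_subset[OF c] x by blast+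
    then show ?thesis using True by (simp add: dens_transition[OF c d x] max_mult_distrib_left)
  qed simp
  have Sm [measurable]: "?S \<in> sets borel" "snd d ` B \<in> sets borel"
    using chart_image_borel c d B by auto
  have "(\<integral>\<^sup>+y. ennreal (indicator (?\<tau> ` ?S) y * ?f y) \<partial>coord_lborel I) =
    (\<integral>\<^sup>+x. ennreal (indicator ?S x * (\<bar>det (block I (matrix (dtrans c d x)))\<bar> * ?f (?\<tau> x))) \<partial>coord_lborel I)"
  proof (rule nn_integral_coord_change_of_variables)
    fix x assume x: "x \<in> ?S"
    then have xo: "x \<in> overlap c d" using S by blast
    show "coord_proj I x = x"
      using H_proj xo overlap_subset[OF c] chart_img_subset[OF c] by blast
    show "coord_proj I (?\<tau> x) = ?\<tau> x"
      using H_proj transition_mem[OF c d xo] overlap_subset[OF d] chart_img_subset[OF d] by blast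
    show "(?\<tau> has_derivative dtrans c d x) (at x within ?S)"
      using has_derivative_subset[OF has_derivative_transition[OF c d xo] S] .
  next
    show "inj_on ?\<tau> ?S"
    proof (rule inj_onI)
      fix x y assume "x \<in> ?S" "y \<in> ?S" and eq: "?\<tau> x = ?\<tau> y"
      then obtain p q where pq: "p \<in> B" "q \<in> B" "x = snd c p" "y = snd c q" by auto
      have "chart_inv c (snd c p) = p" "chart_inv c (snd c q) = q"
        using chart_inv_chart[OF c] B(2) pq by blast+
      then have "snd d p = snd d q" using eq pq by simp
      then have "p = q" using pq B(3) by (intro inj_onD[OF inj_on_chart[OF d]]) blast+
      then show "x = y" using pq by simp
    qed
    show "(\<lambda>x. indicator ?S x * (\<bar>det (block I (matrix (dtrans c d x)))\<bar> * ?f (?\<tau> x))) \<in> borel_measurable borel"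
      unfolding key using dens_measurable[OF c] by measurable
    show "(\<lambda>y. indicator (?\<tau> ` ?S) y * ?f y) \<in> borel_measurable borel"
      unfolding img using dens_measurable[OF d] by measurable
  qed auto
  moreover have "ennreal (indicator (snd d ` B) y * ?f y) = ennreal (dens d y) * indicator (snd d ` B) y" for y
    using B(3) by (cases "y \<in> snd d ` B") (auto simp: chart_img_def ennreal_max_0)
  moreover have "ennreal (max 0 (indicator ?S x * (indicator (chart_img c) x * dens c x))) = ennreal (dens c x) * indicator ?S x" for x
    using B(2) by (cases "x \<in> ?S") (auto simp: chart_img_def ennreal_max_0)
  ultimately show ?thesis
    unfolding chart_measure_def img key by simp
qed

end

lemma measurable_transfer_sets:
  "f \<in> N \<rightarrow>\<^sub>M L \<Longrightarrow> sets N = sets N' \<Longrightarrow> sets L = sets L' \<Longrightarrow> f \<in> N' \<rightarrow>\<^sub>M L'"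
  using measurable_cong_sets by blast

context compact_patched
begin

section \<open>Existence and uniqueness of the Riemannian measure\<close>

abbreviation sM :: "'m measure" where
  "sM \<equiv> restrict_space borel M"

lemma space_sM: "space sM = M"
  by (simp add: space_restrict_space)

lemma chart_measure_sum:
  assumes c: "c \<in> A" and J: "finite J" and B: "\<And>i. i \<in> J \<Longrightarrow> B i \<in> sets sM" "\<And>i. i \<in> J \<Longrightarrow> B i \<subseteq> fst c"
    and disj: "disjoint_family_on B J"
  shows "(\<Sum>i\<in>J. chart_measure c (B i)) = chart_measure c (\<Union>i\<in>J. B i)"
proof -
  let ?N = "density (coord_lborel I) (\<lambda>x. ennreal (indicator (chart_img c) x * dens c x))"
  have "(\<Sum>i\<in>J. emeasure ?N (snd c ` B i)) = emeasure ?N (\<Union>i\<in>J. snd c ` B i)"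
  proof (rule sum_emeasure)
    show "(\<lambda>i. snd c ` B i) ` J \<subseteq> sets ?N" using chart_image_borel[OF c] B by auto
    show "disjoint_family_on (\<lambda>i. snd c ` B i) J"
      unfolding disjoint_family_on_def
    proof (intro ballI impI)
      fix i j assume ij: "i \<in> J" "j \<in> J" "i \<noteq> j"
      have "snd c ` B i \<inter> snd c ` B j = snd c ` (B i \<inter> B j)"
        using inj_on_image_Int[OF inj_on_chart[OF c] B(2)[OF ij(1)] B(2)[OF ij(2)]] by simp
      also have "B i \<inter> B j = {}" using disj ij by (auto simp: disjoint_family_on_def)
      finally show "snd c ` B i \<inter> snd c ` B j = {}" by simp
    qed
  qed (rule J)
  moreover have "(\<Union>i\<in>J. B i) \<in> sets sM" using B(1) J by (intro sets.finite_UN) auto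
  moreover have "(\<Union>i\<in>J. B i) \<subseteq> fst c" using B(2) by blast
  ultimately show ?thesis
    using B by (simp add: chart_measure_eq[OF c] image_UN)
qed

lemma finite_chart_cover:
  obtains cs where "set cs \<subseteq> A" "M = (\<Union>c\<in>set cs. fst c)"
proof -
  have "\<forall>U\<in>fst ` A. openin (top_of_set M) U" "M \<subseteq> \<Union>(fst ` A)"
    using chart(1) M_eq by auto
  then obtain D where D: "D \<subseteq> fst ` A" "finite D" "M \<subseteq> \<Union>D"
    using compact unfolding compact_eq_openin_cover by meson
  obtain F where F: "F \<subseteq> A" "finite F" "D = fst ` F"
    using finite_subset_image[OF D(2,1)] by blast
  obtain cs where cs: "set cs = F" using finite_list[OF F(2)] by blast
  show thesis
  proof (rule that)
    show "set cs \<subseteq> A" using F cs by simp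
    have "(\<Union>c\<in>F. fst c) \<subseteq> M" using F(1) fst_chart_subset by blast
    then show "M = (\<Union>c\<in>set cs. fst c)" using D(3) F(3) cs by blast
  qed
qed

definition is_riemannian :: "'m measure \<Rightarrow> bool" where
  "is_riemannian \<mu> \<longleftrightarrow> sets \<mu> = sets sM \<and>
     (\<forall>c\<in>A. \<forall>B\<in>sets \<mu>. B \<subseteq> fst c \<longrightarrow> emeasure \<mu> B = chart_measure c B)"

text \<open>This justifies the definite description. A finite chart cover is cut into disjoint
  measurable pieces, each inside one chart; the prescribed values force the measure to be a sum over
  the pieces, and independence of the chart shows that this sum has the prescribed value in every
  chart.\<close>

lemma ex1_riemannian: "\<exists>!\<mu>. is_riemannian \<mu>"
proof -
  obtain cs where cs: "set cs \<subseteq> A" "M = (\<Union>c\<in>set cs. fst c)" using finite_chart_cover by blast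
  define k where "k = length cs"
  \<comment> \<open>Each point is assigned to the first chart in the list that contains it.\<close>
  define E where "E i = fst (cs ! i) - (\<Union>j<i. fst (cs ! j))" for i
  have csA: "cs ! i \<in> A" if "i < k" for i using that cs(1) nth_mem k_def by blast
  have Efst: "E i \<subseteq> fst (cs ! i)" for i by (auto simp: E_def)
  have Em: "E i \<in> sets sM" if "i < k" for i
  proof -
    have "(\<Union>j<i. fst (cs ! j)) \<in> sets sM"
      using that csA by (intro sets.finite_UN) (auto intro!: fst_chart_sets)
    then show ?thesis unfolding E_def using fst_chart_sets[OF csA[OF that]] by (intro sets.Diff)
  qed
  have Edisj: "E i \<inter> E j = {}" if "i \<noteq> j" for i j
    using that by (cases i j rule: linorder_cases) (auto simp: E_def)
  have EM: "(\<Union>i<k. E i) = M"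
  proof
    show "(\<Union>i<k. E i) \<subseteq> M" using Efst csA fst_chart_subset by blast
    show "M \<subseteq> (\<Union>i<k. E i)"
    proof
      fix p assume "p \<in> M"
      then obtain c where "c \<in> set cs" "p \<in> fst c" using cs(2) by auto
      then have "\<exists>i. i < k \<and> p \<in> fst (cs ! i)" unfolding k_def in_set_conv_nth by metis
      then obtain i where i: "i < k \<and> p \<in> fst (cs ! i)" "\<And>j. j < i \<Longrightarrow> \<not> (j < k \<and> p \<in> fst (cs ! j))"
        using exists_least_iff[of "\<lambda>i. i < k \<and> p \<in> fst (cs ! i)"] by blast
      then have "p \<in> E i" by (auto simp: E_def)
      then show "p \<in> (\<Union>i<k. E i)" using i by blast
    qed
  qed
  define m where "m B = (\<Sum>i<k. chart_measure (cs ! i) (B \<inter> E i))" for B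
  have BE: "B \<inter> E i \<in> sets sM" if "B \<in> sets sM" "i < k" for B i using that Em by auto
  have Bsum: "emeasure \<mu> B = m B" if \<mu>: "is_riemannian \<mu>" and B: "B \<in> sets sM" for \<mu> B
  proof -
    have s: "sets \<mu> = sets sM" using \<mu> by (simp add: is_riemannian_def)
    have "B = (\<Union>i<k. B \<inter> E i)" using sets.sets_into_space[OF B] EM by (auto simp: space_sM)
    then have "emeasure \<mu> B = emeasure \<mu> (\<Union>i<k. B \<inter> E i)" by simp
    also have "\<dots> = (\<Sum>i<k. emeasure \<mu> (B \<inter> E i))"
      using BE[OF B] Edisj by (intro sum_emeasure[symmetric]) (auto simp: s disjoint_family_on_def)
    also have "\<dots> = m B"
      unfolding m_def
    proof (intro sum.cong refl)
      fix i assume "i \<in> {..<k}"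
      then have i: "i < k" by simp
      have "B \<inter> E i \<subseteq> fst (cs ! i)" using Efst by blast
      then show "emeasure \<mu> (B \<inter> E i) = chart_measure (cs ! i) (B \<inter> E i)"
        using \<mu> csA[OF i] BE[OF B i] by (simp add: is_riemannian_def)
    qed
    finally show ?thesis .
  qed
  define \<mu> where "\<mu> = measure_of M (sets sM) m"
  have sa: "sigma_algebra M (sets sM)" using sets.sigma_algebra_axioms[of sM] by (simp add: space_sM)
  have sets\<mu>: "sets \<mu> = sets sM"
    unfolding \<mu>_def using sigma_algebra.sets_measure_of_eq[OF sa] .
  have ca: "countably_additive (sets sM) m"
  proof (rule countably_additiveI)
    fix B :: "nat \<Rightarrow> 'm set"
    assume B: "range B \<subseteq> sets sM" "disjoint_family B" "(\<Union>i. B i) \<in> sets sM"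
    have "(\<Sum>n. m (B n)) = (\<Sum>i<k. \<Sum>n. chart_measure (cs ! i) (B n \<inter> E i))"
      unfolding m_def by (rule suminf_sum) (rule summableI)
    also have "\<dots> = m (\<Union>n. B n)"
      unfolding m_def
    proof (intro sum.cong refl)
      fix i assume "i \<in> {..<k}"
      then have i: "i < k" by simp
      have "(\<Sum>n. chart_measure (cs ! i) (B n \<inter> E i)) = chart_measure (cs ! i) (\<Union>n. B n \<inter> E i)"
      proof (rule chart_measure_suminf[OF csA[OF i]])
        show "range (\<lambda>n. B n \<inter> E i) \<subseteq> sets sM" using BE[OF _ i] B(1) by blast
        show "B n \<inter> E i \<subseteq> fst (cs ! i)" for n using Efst by blast
        show "disjoint_family (\<lambda>n. B n \<inter> E i)" using B(2) unfolding disjoint_family_on_def by blast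
      qed
      also have "(\<Union>n. B n \<inter> E i) = (\<Union>n. B n) \<inter> E i" by blast
      finally show "(\<Sum>n. chart_measure (cs ! i) (B n \<inter> E i)) = chart_measure (cs ! i) ((\<Union>n. B n) \<inter> E i)" .
    qed
    finally show "(\<Sum>n. m (B n)) = m (\<Union>n. B n)" .
  qed
  have pos: "positive (sets sM) m"
    by (simp add: positive_def m_def chart_measure_def)
  have em: "emeasure \<mu> B = m B" if "B \<in> sets sM" for B
    unfolding \<mu>_def using emeasure_measure_of_sigma[OF sa pos ca that] .
  have "is_riemannian \<mu>"
    unfolding is_riemannian_def
  proof (intro conjI ballI impI)
    show "sets \<mu> = sets sM" by (rule sets\<mu>)
    fix d B assume d: "d \<in> A" and B: "B \<in> sets \<mu>" "B \<subseteq> fst d"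
    have B': "B \<in> sets sM" using B(1) sets\<mu> by simp
    have "m B = (\<Sum>i<k. chart_measure d (B \<inter> E i))"
      unfolding m_def
    proof (intro sum.cong refl)
      fix i assume "i \<in> {..<k}"
      then have i: "i < k" by simp
      have "B \<inter> E i \<subseteq> fst (cs ! i)" "B \<inter> E i \<subseteq> fst d" using Efst B(2) by blast+
      then show "chart_measure (cs ! i) (B \<inter> E i) = chart_measure d (B \<inter> E i)"
        by (rule chart_measure_consistent[OF csA[OF i] d BE[OF B' i]])
    qed
    also have "\<dots> = chart_measure d (\<Union>i<k. B \<inter> E i)"
    proof (rule chart_measure_sum[OF d])
      show "B \<inter> E i \<in> sets sM" if "i \<in> {..<k}" for i using BE[OF B'] that by simp
      show "B \<inter> E i \<subseteq> fst d" for i using B(2) by blast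
      show "disjoint_family_on (\<lambda>i. B \<inter> E i) {..<k}" using Edisj by (auto simp: disjoint_family_on_def)
    qed simp
    also have "(\<Union>i<k. B \<inter> E i) = B" using sets.sets_into_space[OF B'] EM by (auto simp: space_sM)
    finally show "emeasure \<mu> B = chart_measure d B" using em[OF B'] by simp
  qed
  moreover have "\<mu>' = \<mu>" if "is_riemannian \<mu>'" for \<mu>'
  proof (rule measure_eqI)
    show "sets \<mu>' = sets \<mu>" using that sets\<mu> by (simp add: is_riemannian_def)
    fix B assume "B \<in> sets \<mu>'"
    then have "B \<in> sets sM" using that by (simp add: is_riemannian_def)
    then show "emeasure \<mu>' B = emeasure \<mu> B" using Bsum[OF that] em by simp
  qed
  ultimately show ?thesis by blast
qed

section \<open>Integration in a single chart\<close>

abbreviation vol :: "'m measure" where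
  "vol \<equiv> riemannian_measure I M A \<psi>"

lemma is_riemannian_vol: "is_riemannian vol"
proof -
  have "vol = (THE \<mu>. is_riemannian \<mu>)"
    unfolding riemannian_measure_def is_riemannian_def chart_measure_def ..
  then show ?thesis using theI'[OF ex1_riemannian] by simp
qed

lemma sets_vol: "sets vol = sets sM"
  and emeasure_vol: "c \<in> A \<Longrightarrow> B \<in> sets sM \<Longrightarrow> B \<subseteq> fst c \<Longrightarrow> emeasure vol B = chart_measure c B"
  using is_riemannian_vol by (auto simp: is_riemannian_def)

lemma space_vol: "space vol = M"
  using sets_eq_imp_space_eq[OF sets_vol] by (simp add: space_sM)

text \<open>The prescribed values on sets become an identity of measures, so that integrals can be
  transferred by the rules for \<open>density\<close> and \<open>distr\<close>.\<close>

lemma density_vol_chart: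
  assumes c: "c \<in> A"
  shows "density vol (indicator (fst c)) =
    distr (density (restrict_space (coord_lborel I) (chart_img c)) (\<lambda>x. ennreal (dens c x))) vol (chart_inv c)"
    (is "?L = distr ?N vol (chart_inv c)")
proof (rule measure_eqI)
  have fc: "fst c \<in> sets vol" using fst_chart_sets[OF c] by (simp add: sets_vol)
  fix B assume "B \<in> sets ?L"
  then have B: "B \<in> sets vol" by simp
  then have Bc: "B \<inter> fst c \<in> sets sM" using fc by (simp add: sets_vol)
  have meas: "chart_inv c \<in> ?N \<rightarrow>\<^sub>M vol"
  proof -
    have "chart_inv c \<in> restrict_space borel (chart_img c) \<rightarrow>\<^sub>M sM" by (rule chart_inv_measurable[OF c])
    then show ?thesis
      by (rule measurable_transfer_sets) (simp_all add: sets_vol sets_restrict_space)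
  qed
  have eq: "snd c ` (B \<inter> fst c) = chart_inv c -` B \<inter> chart_img c"
    using chart_image_eq[OF c, of "B \<inter> fst c"] chart_inv_mem[OF c] by auto
  have dm: "(\<lambda>x. ennreal (dens c x)) \<in> borel_measurable (restrict_space (coord_lborel I) (chart_img c))"
  proof -
    have "dens c \<in> borel_measurable (restrict_space borel (chart_img c))"
      by (rule borel_measurable_continuous_on_restrict[OF continuous_dens[OF c]])
    then have "(\<lambda>x. ennreal (dens c x)) \<in> borel_measurable (restrict_space borel (chart_img c))" by measurable
    then show ?thesis by (rule measurable_transfer_sets) (simp_all add: sets_restrict_space)
  qed
  have img: "chart_img c \<in> sets (coord_lborel I)" using chart_img_borel[OF c] by simp
  have mset: "chart_inv c -` B \<inter> chart_img c \<in> sets (restrict_space (coord_lborel I) (chart_img c))"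
    using measurable_sets[OF meas B] by (simp add: space_restrict_space)
  have "emeasure (distr ?N vol (chart_inv c)) B = emeasure ?N (chart_inv c -` B \<inter> chart_img c)"
    using emeasure_distr[OF meas B] by (simp add: space_restrict_space)
  also have "\<dots> = (\<integral>\<^sup>+x. ennreal (dens c x) * indicator (chart_inv c -` B \<inter> chart_img c) x \<partial>restrict_space (coord_lborel I) (chart_img c))"
    by (rule emeasure_density[OF dm mset])
  also have "\<dots> = (\<integral>\<^sup>+x. ennreal (dens c x) * indicator (chart_inv c -` B \<inter> chart_img c) x * indicator (chart_img c) x \<partial>coord_lborel I)"
    using img by (subst nn_integral_restrict_space) simp_all
  also have "\<dots> = (\<integral>\<^sup>+x. ennreal (dens c x) * indicator (chart_inv c -` B \<inter> chart_img c) x \<partial>coord_lborel I)"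
    by (intro nn_integral_cong) (simp add: indicator_def)
  also have "\<dots> = emeasure vol (B \<inter> fst c)"
    using emeasure_vol[OF c Bc] by (simp add: chart_measure_def eq)
  also have "\<dots> = emeasure ?L B"
    using emeasure_density[of "indicator (fst c)" vol B] B fc by (simp add: indicator_inter_arith[symmetric] Int_commute)
  finally show "emeasure ?L B = emeasure (distr ?N vol (chart_inv c)) B" by simp
qed simp

text \<open>As \<open>h\<close> vanishes outside the chart domain, weighting with its indicator
  changes nothing and \<open>density_vol_chart\<close> applies. The sign condition on the density
  lets real integrals pass through \<open>density\<close>.\<close>

lemma
  fixes h :: "'m \<Rightarrow> real"
  assumes c: "c \<in> A" and h: "h \<in> borel_measurable sM" and supp: "\<And>p. p \<in> M - fst c \<Longrightarrow> h p = 0"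
    and dens: "\<And>x. x \<in> chart_img c \<Longrightarrow> 0 \<le> dens c x"
  shows integrable_vol_chart: "integrable vol h \<longleftrightarrow>
      integrable (coord_lborel I) (\<lambda>x. indicator (chart_img c) x * (dens c x * h (chart_inv c x)))"
    and integral_vol_chart: "integral\<^sup>L vol h =
      (\<integral>x. indicator (chart_img c) x * (dens c x * h (chart_inv c x)) \<partial>coord_lborel I)"
proof -
  let ?R = "restrict_space (coord_lborel I) (chart_img c)"
  let ?N = "density ?R (\<lambda>x. ennreal (dens c x))"
  have hv: "h \<in> borel_measurable vol"
    using h by (rule measurable_transfer_sets) (simp_all add: sets_vol)
  have fc: "fst c \<in> sets vol" using fst_chart_sets[OF c] by (simp add: sets_vol)
  have meas: "chart_inv c \<in> ?R \<rightarrow>\<^sub>M vol"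
    using chart_inv_measurable[OF c]
    by (rule measurable_transfer_sets) (simp_all add: sets_vol sets_restrict_space)
  then have meas': "chart_inv c \<in> ?N \<rightarrow>\<^sub>M vol" by simp
  have dm: "dens c \<in> borel_measurable ?R"
    using borel_measurable_continuous_on_restrict[OF continuous_dens[OF c]]
    by (rule measurable_transfer_sets) (simp_all add: sets_restrict_space)
  have hm: "(\<lambda>x. h (chart_inv c x)) \<in> borel_measurable ?R"
    using measurable_compose[OF meas hv] .
  have AE0: "AE x in ?R. 0 \<le> dens c x"
    using dens by (intro AE_I2) (simp add: space_restrict_space)
  have img: "chart_img c \<inter> space (coord_lborel I) \<in> sets (coord_lborel I)" using chart_img_borel[OF c] by simp
  have ind: "indicator (fst c) p *\<^sub>R h p = h p" if "p \<in> space vol" for p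
    using supp[of p] that by (auto simp: space_vol indicator_def)
  have L: "density vol (\<lambda>p. ennreal (indicator (fst c) p)) = distr ?N vol (chart_inv c)"
    using density_vol_chart[OF c] by (simp add: ennreal_indicator)
  have im: "(\<lambda>p. indicator (fst c) p :: real) \<in> borel_measurable vol" using fc by simp
  have "integrable vol h \<longleftrightarrow> integrable vol (\<lambda>p. indicator (fst c) p *\<^sub>R h p)"
    by (rule Bochner_Integration.integrable_cong[OF refl ind[symmetric]])
  also have "\<dots> \<longleftrightarrow> integrable (distr ?N vol (chart_inv c)) h"
    unfolding L[symmetric] using hv im by (subst integrable_density) auto
  also have "\<dots> \<longleftrightarrow> integrable ?N (\<lambda>x. h (chart_inv c x))"
    by (rule integrable_distr_eq[OF meas' hv])
  also have "\<dots> \<longleftrightarrow> integrable ?R (\<lambda>x. dens c x *\<^sub>R h (chart_inv c x))"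
    by (rule integrable_density[OF hm dm AE0])
  also have "\<dots> \<longleftrightarrow> integrable (coord_lborel I) (\<lambda>x. indicator (chart_img c) x *\<^sub>R (dens c x *\<^sub>R h (chart_inv c x)))"
    by (rule integrable_restrict_space[OF img])
  finally show "integrable vol h \<longleftrightarrow>
      integrable (coord_lborel I) (\<lambda>x. indicator (chart_img c) x * (dens c x * h (chart_inv c x)))" by simp
  have "integral\<^sup>L vol h = integral\<^sup>L vol (\<lambda>p. indicator (fst c) p *\<^sub>R h p)"
    by (rule Bochner_Integration.integral_cong[OF refl ind[symmetric]])
  also have "\<dots> = integral\<^sup>L (distr ?N vol (chart_inv c)) h"
    unfolding L[symmetric] using hv im by (subst integral_density) auto
  also have "\<dots> = integral\<^sup>L ?N (\<lambda>x. h (chart_inv c x))"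
    by (rule integral_distr[OF meas' hv])
  also have "\<dots> = integral\<^sup>L ?R (\<lambda>x. dens c x *\<^sub>R h (chart_inv c x))"
    by (rule integral_density[OF hm dm AE0])
  also have "\<dots> = (\<integral>x. indicator (chart_img c) x *\<^sub>R (dens c x *\<^sub>R h (chart_inv c x)) \<partial>coord_lborel I)"
    by (rule integral_restrict_space[OF img])
  finally show "integral\<^sup>L vol h =
      (\<integral>x. indicator (chart_img c) x * (dens c x * h (chart_inv c x)) \<partial>coord_lborel I)" by simp
qed

lemma continuous_on_manifold:
  assumes "\<And>c. c \<in> A \<Longrightarrow> continuous_on (chart_img c) (h \<circ> chart_inv c)"
  shows "continuous_on M h"
  unfolding continuous_on_eq_continuous_within
proof
  fix p assume "p \<in> M"
  then obtain c where c: "c \<in> A" "p \<in> fst c" using M_eq by auto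
  have "continuous_on (fst c) ((h \<circ> chart_inv c) \<circ> snd c)"
  proof (rule continuous_on_compose[OF chart_continuous[OF c(1)]])
    show "continuous_on (snd c ` fst c) (h \<circ> chart_inv c)" using assms[OF c(1)] by (simp add: chart_img_def)
  qed
  then have "continuous_on (fst c) h"
    by (rule continuous_on_eq) (simp add: chart_inv_chart[OF c(1)])
  then have "continuous (at p within fst c) h"
    using c(2) by (simp add: continuous_on_eq_continuous_within)
  then show "continuous (at p within M) h"
    by (simp add: at_within_openin[OF chart(1)[OF c(1)] c(2)])
qed

text \<open>In the chart the integrand is continuous on the compact image of \<open>K\<close> and
  vanishes on the rest of the chart image.\<close>

lemma integrable_vol_compact_support:
  fixes h :: "'m \<Rightarrow> real"
  assumes c: "c \<in> A" and h: "continuous_on M h" and K: "compact K" "K \<subseteq> fst c"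
    and supp: "\<And>p. p \<in> M - K \<Longrightarrow> h p = 0"
    and dens: "\<And>x. x \<in> chart_img c \<Longrightarrow> 0 \<le> dens c x"
  shows "integrable vol h"
proof -
  have hm: "h \<in> borel_measurable sM" by (rule borel_measurable_continuous_on_restrict[OF h])
  have supp': "h p = 0" if "p \<in> M - fst c" for p using supp[of p] that K(2) by blast
  have cK: "compact (snd c ` K)"
    by (rule compact_continuous_image[OF continuous_on_subset[OF chart_continuous[OF c] K(2)] K(1)])
  have sub: "snd c ` K \<subseteq> chart_img c" using K(2) by (auto simp: chart_img_def)
  have "continuous_on (chart_img c) (\<lambda>x. h (chart_inv c x))"
    by (rule continuous_on_compose2[OF h chart_inv_continuous[OF c]])
      (use chart_inv_mem[OF c] fst_chart_subset[OF c] in blast)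
  then have "continuous_on (snd c ` K) (\<lambda>x. dens c x * h (chart_inv c x))"
    by (intro continuous_on_mult continuous_on_subset[OF _ sub] continuous_dens[OF c])
  from integrable_coord_lborel_compact[OF cK this, of I]
  have "integrable (coord_lborel I) (\<lambda>x. indicator (snd c ` K) x * (dens c x * h (chart_inv c x)))" .
  moreover have "indicator (snd c ` K) x * (dens c x * h (chart_inv c x)) =
      indicator (chart_img c) x * (dens c x * h (chart_inv c x))" for x
  proof (cases "x \<in> chart_img c \<and> x \<notin> snd c ` K")
    case True
    then have "chart_inv c x \<notin> K" using chart_chart_inv[OF c] by (metis imageI)
    then have "h (chart_inv c x) = 0"
      using supp True chart_inv_mem[OF c] fst_chart_subset[OF c] by blast
    then show ?thesis by simp
  next
    case False
    then show ?thesis using sub by (auto simp: indicator_def)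
  qed
  ultimately show ?thesis
    using integrable_vol_chart[OF c hm supp' dens] by simp
qed

end

section \<open>The boundary as a manifold\<close>

lemma smooth_on_cong:
  assumes "smooth_on S f" "\<And>x. x \<in> S \<Longrightarrow> g x = f x"
  shows "smooth_on S g"
  unfolding smooth_on_def
proof
  fix x assume "x \<in> S"
  from bspec[OF assms(1)[unfolded smooth_on_def] this]
  obtain W h where "open W" "x \<in> W" "\<forall>k. Ck_on k h W" "\<forall>y\<in>S \<inter> W. f y = h y" by (elim exE conjE)
  with assms(2) show "\<exists>W h. open W \<and> x \<in> W \<and> (\<forall>k. Ck_on k h W) \<and> (\<forall>y\<in>S \<inter> W. g y = h y)"
    by (intro exI[of _ W] exI[of _ h]) auto
qed

lemma block_UNIV [simp]: "block UNIV G = G"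
  by (simp add: block_def)

text \<open>A boundary chart is a chart restricted to a smaller domain. Its \<open>chart_inv\<close>
  is then a different \<open>inv_into\<close>, known to agree with the old inverse on the smaller
  image.\<close>

lemma homeomorphism_inv_into_subset:
  assumes h: "homeomorphism S T f g" and S': "S' \<subseteq> S"
  shows "homeomorphism S' (f ` S') f (inv_into S' f)"
proof -
  have inj: "inj_on f S'" using h S' unfolding homeomorphism_def by (metis inj_on_inverseI inj_on_subset)
  have hom: "homeomorphism S' (f ` S') f g"
    by (rule homeomorphism_of_subsets[OF h S' order_refl refl])
  have eq: "inv_into S' f x = g x" if "x \<in> f ` S'" for x
  proof -
    from that obtain p where p: "p \<in> S'" "x = f p" by (rule imageE)
    then have "inv_into S' f x = p" using inj by simp
    moreover have "g x = p" using h S' p unfolding homeomorphism_def by blast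
    ultimately show ?thesis by simp
  qed
  show ?thesis by (rule homeomorphism_cong[OF hom refl refl refl eq])
qed

text \<open>Compactness of the boundary makes \<open>compact_patched\<close> available for the
  boundary; in the theorem it comes from the diffeomorphism onto the compact
  \<open>\<Sigma>\<close>.\<close>

locale minimal_manifold =
  fixes M :: "'m::t2_space set" and A :: "('m, 'n::finite) chart set"
    and \<psi> :: "'m \<Rightarrow> 'e::euclidean_space \<times> real" and a :: "'e \<times> real"
  assumes atlas: "smooth_atlas half_space M A" and compact_M: "compact M"
    and compact_boundary: "compact (boundary A)"
    and immersion: "immersion_hyp A M \<psi>" and minimal: "minimal A \<psi>"
    and dim: "DIM('e) = CARD('n) + 1" and a: "a \<in> hyperbolic_space"
begin

sublocale compact_patched UNIV half_space M A \<psi>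
  using atlas compact_M immersion model_space_half_space
  by unfold_locales (auto simp: immersion_hyp_def)

lemma minimal_patch_chart:
  assumes c: "c \<in> A"
  shows "minimal_patch (chart_img c) (\<psi> \<circ> chart_inv c) a"
proof -
  interpret P: immersed_patch "chart_img c" "\<psi> \<circ> chart_inv c"
  proof
    show "inward UNIV (chart_img c)" by (rule inward_chart_img[OF c])
    show "smooth_on (chart_img c) (\<psi> \<circ> chart_inv c)" by (rule smooth_\<psi>[OF c])
    show "DIM('e) = CARD('n) + 1" by (rule dim)
    fix x assume x: "x \<in> chart_img c"
    have "\<psi> ` M \<subseteq> hyperbolic_space" using immersion by (simp add: immersion_hyp_def)
    then show "(\<psi> \<circ> chart_inv c) x \<in> hyperbolic_space"
      using chart_inv_mem[OF c x] fst_chart_subset[OF c] by auto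
    show "inj (frechet_derivative (\<psi> \<circ> chart_inv c) (at x within chart_img c))"
      using immersion c x by (simp add: immersion_hyp_def)
  qed
  show ?thesis
  proof
    show "a \<in> hyperbolic_space" by (rule a)
    fix x N
    assume x: "x \<in> chart_img c" and N: "lorentz N N = 1" "lorentz N ((\<psi> \<circ> chart_inv c) x) = 0"
      "\<And>i. lorentz N (P.D i x) = 0"
    have "unit_normal \<psi> c x N" using N by (simp add: unit_normal_def P.D_def)
    then have "mean_curvature \<psi> c N x = 0" using minimal[unfolded minimal_def, rule_format, OF c x] by simp
    then show "trace (matrix_inv (P.G x) ** (\<chi> i j. lorentz (coord_deriv (chart_img c) (P.D j) i x) N)) = 0"
      by (simp add: mean_curvature_def second_fundamental_form_def induced_metric_def P.G_def P.D_def)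
  qed
qed

lemma induced_metric_eq:
  "induced_metric \<psi> c x = immersed_patch.G (chart_img c) (\<psi> \<circ> chart_inv c) x" if "c \<in> A"
proof -
  interpret P: minimal_patch "chart_img c" "\<psi> \<circ> chart_inv c" a by (rule minimal_patch_chart[OF that])
  show ?thesis by (simp add: induced_metric_def P.G_def P.D_def)
qed

lemma dens_eq:
  "dens c x = immersed_patch.dens (chart_img c) (\<psi> \<circ> chart_inv c) x" if "c \<in> A"
proof -
  interpret P: minimal_patch "chart_img c" "\<psi> \<circ> chart_inv c" a by (rule minimal_patch_chart[OF that])
  show ?thesis by (simp add: volume_density_def P.dens_def induced_metric_eq[OF that])
qed

lemma dens_nonneg:
  assumes c: "c \<in> A" and x: "x \<in> chart_img c"
  shows "0 \<le> dens c x"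
proof -
  interpret P: minimal_patch "chart_img c" "\<psi> \<circ> chart_inv c" a by (rule minimal_patch_chart[OF c])
  show ?thesis using P.dens_pos[OF x] by (simp add: dens_eq[OF c])
qed

lemma transition_inverse:
  assumes c: "c \<in> A" and d: "d \<in> A" and x: "x \<in> overlap c d"
  shows "(snd c \<circ> chart_inv d) ((snd d \<circ> chart_inv c) x) = x"
proof -
  obtain p where p: "p \<in> fst c" "p \<in> fst d" "x = snd c p" using x by (auto simp: overlap_def)
  then show ?thesis by (simp add: chart_inv_chart[OF c] chart_inv_chart[OF d])
qed

text \<open>The two transition maps compose to the identity, and derivatives within relatively open
  subsets of the half space are unique.\<close>

lemma dtrans_inverse:
  assumes c: "c \<in> A" and d: "d \<in> A" and x: "x \<in> overlap c d"
  shows "dtrans c d x (dtrans d c ((snd d \<circ> chart_inv c) x) w) = w"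
proof -
  let ?\<tau> = "snd d \<circ> chart_inv c" and ?\<sigma> = "snd c \<circ> chart_inv d"
  let ?y = "?\<tau> x"
  have y: "?y \<in> overlap d c" by (rule transition_mem[OF c d x])
  have \<sigma>y: "?\<sigma> ?y = x" by (rule transition_inverse[OF c d x])
  have "?\<sigma> ` overlap d c \<subseteq> overlap c d" using transition_mem[OF d c] by blast
  then have "(?\<tau> has_derivative dtrans c d x) (at (?\<sigma> ?y) within ?\<sigma> ` overlap d c)"
    unfolding \<sigma>y by (rule has_derivative_subset[OF has_derivative_transition[OF c d x]])
  from diff_chain_within[OF has_derivative_transition[OF d c y] this]
  have 1: "(?\<tau> \<circ> ?\<sigma> has_derivative dtrans c d x \<circ> dtrans d c ?y) (at ?y within overlap d c)" .
  have 2: "(?\<tau> \<circ> ?\<sigma> has_derivative (\<lambda>v. v)) (at ?y within overlap d c)"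
  proof (rule has_derivative_transform[OF y _ has_derivative_ident])
    fix z assume "z \<in> overlap d c"
    then show "(?\<tau> \<circ> ?\<sigma>) z = z" using transition_inverse[OF d c] by simp
  qed
  have "dtrans c d x \<circ> dtrans d c ?y = (\<lambda>v. v)"
    by (rule has_derivative_unique_inward[OF inward_overlap[OF d c] y 1 2])
  then show ?thesis by (metis comp_apply)
qed

text \<open>At an interior point of one chart, the boundary coordinate of another chart would have a minimum,
  so that its derivative would vanish.\<close>

lemma boundary_invariant:
  assumes c: "c \<in> A" and d: "d \<in> A" and p: "p \<in> fst c" "p \<in> fst d" and b: "snd c p $ bd_index = 0"
  shows "snd d p $ bd_index = 0"
proof (rule ccontr)
  assume nz: "snd d p $ bd_index \<noteq> 0"
  let ?x = "snd d p" and ?\<tau> = "snd c \<circ> chart_inv d"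
  have x: "?x \<in> overlap d c" using p by (auto simp: overlap_def)
  have xH: "?x \<in> half_space" using overlap_subset[OF d] chart_img_subset[OF d] x by blast
  then have xpos: "0 < ?x $ bd_index" using nz by (simp add: mem_half_space)
  obtain T where T: "open T" "overlap d c = half_space \<inter> T"
    using openin_overlap[OF d c] by (auto simp: openin_open)
  \<comment> \<open>On this set the overlap is a neighbourhood in \<open>real^'n\<close>, so
    derivatives are two-sided and vanish at a minimum.\<close>
  define S where "S = T \<inter> {x :: real^'n. 0 < x $ bd_index}"
  have "?x \<in> T" using x unfolding T(2) by (rule IntD2)
  then have S: "open S" "?x \<in> S" "S \<subseteq> overlap d c"
    unfolding S_def T(2) using xpos
    by (intro open_Int T(1) open_Collect_less continuous_intros, simp, auto simp: mem_half_space)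
  have at: "at ?x within overlap d c = at ?x"
    by (rule at_within_open_subset[OF S(2,1,3)])
  have der: "((\<lambda>y. ?\<tau> y $ bd_index) has_derivative (\<lambda>v. dtrans d c ?x v $ bd_index)) (at ?x)"
    using bounded_linear.has_derivative[OF bounded_linear_vec_nth has_derivative_transition[OF d c x]]
    unfolding at .
  have \<tau>x: "?\<tau> ?x $ bd_index = 0" using b p by (simp add: chart_inv_chart[OF d])
  have "\<forall>y\<in>S. ?\<tau> ?x $ bd_index \<le> ?\<tau> y $ bd_index"
  proof
    fix y assume "y \<in> S"
    then have "?\<tau> y \<in> overlap c d" using S(3) transition_mem[OF d c] by blast
    then have "?\<tau> y \<in> half_space" using overlap_subset[OF c] chart_img_subset[OF c] by blast
    then show "?\<tau> ?x $ bd_index \<le> ?\<tau> y $ bd_index" unfolding \<tau>x by (simp add: mem_half_space)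
  qed
  from differential_zero_maxmin[OF S(2,1) der disjI2[OF this]]
  have zero: "(\<lambda>v. dtrans d c ?x v $ bd_index) = (\<lambda>v. 0)" .
  \<comment> \<open>The derivative of the transition map is onto, so some vector has an image with
    boundary coordinate 1.\<close>
  have "dtrans d c ?x (dtrans c d (?\<tau> ?x) (axis bd_index 1)) $ bd_index = 1"
    unfolding dtrans_inverse[OF d c x] by simp
  then show False using fun_cong[OF zero] by simp
qed

lemma mem_boundary:
  assumes c: "c \<in> A" "p \<in> fst c"
  shows "p \<in> boundary A \<longleftrightarrow> snd c p $ bd_index = 0"
proof
  assume "p \<in> boundary A"
  then obtain d where "d \<in> A" "p \<in> fst d" "snd d p $ bd_index = 0"
    unfolding boundary_def by (elim CollectE bexE conjE)
  then show "snd c p $ bd_index = 0" using boundary_invariant[OF _ c(1) _ c(2)] by simp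
next
  assume "snd c p $ bd_index = 0"
  then show "p \<in> boundary A" using c unfolding boundary_def by (intro CollectI bexI[of _ c]) simp_all
qed

definition bd_chart :: "('m, 'n) chart \<Rightarrow> ('m, 'n) chart" where
  "bd_chart c = (fst c \<inter> boundary A, snd c)"

lemma boundary_atlas_eq: "boundary_atlas A = bd_chart ` A"
  unfolding boundary_atlas_def bd_chart_def ..

lemma boundary_subset: "boundary A \<subseteq> M"
proof
  fix p assume "p \<in> boundary A"
  then obtain c where "c \<in> A" "p \<in> fst c" unfolding boundary_def by (elim CollectE bexE conjE)
  then show "p \<in> M" using fst_chart_subset by blast
qed

lemma chart_img_bd_chart:
  assumes c: "c \<in> A"
  shows "chart_img (bd_chart c) = chart_img c \<inter> hyperplane"
proof (intro equalityI subsetI)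
  fix x assume "x \<in> chart_img (bd_chart c)"
  then obtain p where p: "p \<in> fst c" "p \<in> boundary A" "x = snd c p" by (auto simp: chart_img_def bd_chart_def)
  then have "snd c p $ bd_index = 0" using mem_boundary[OF c p(1)] by simp
  then show "x \<in> chart_img c \<inter> hyperplane"
    using p chart_mem[OF c p(1)] by (simp add: mem_hyperplane)
next
  fix x assume "x \<in> chart_img c \<inter> hyperplane"
  then obtain p where p: "p \<in> fst c" "x = snd c p" "snd c p $ bd_index = 0"
    by (auto simp: chart_img_def mem_hyperplane)
  then have "p \<in> fst c \<inter> boundary A" using mem_boundary[OF c] by simp
  then show "x \<in> chart_img (bd_chart c)" using p by (auto simp: chart_img_def bd_chart_def)
qed

lemma chart_inv_bd_chart:
  assumes c: "c \<in> A" and x: "x \<in> chart_img (bd_chart c)"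
  shows "chart_inv (bd_chart c) x = chart_inv c x"
proof -
  obtain p where p: "p \<in> fst c \<inter> boundary A" "x = snd c p" using x by (auto simp: chart_img_def bd_chart_def)
  have "inj_on (snd c) (fst c \<inter> boundary A)" using inj_on_chart[OF c] by (rule inj_on_subset) simp
  then have "chart_inv (bd_chart c) x = p" using p by (simp add: chart_inv_def bd_chart_def)
  moreover have "chart_inv c x = p" using p chart_inv_chart[OF c] by simp
  ultimately show ?thesis by simp
qed

lemma smooth_atlas_boundary: "smooth_atlas hyperplane (boundary A) (boundary_atlas A)"
  unfolding smooth_atlas_def
proof (intro conjI ballI)
  show "boundary A = (\<Union>c\<in>boundary_atlas A. fst c)"
    using boundary_subset M_eq by (auto simp: boundary_atlas_eq bd_chart_def)
next
  fix c' assume "c' \<in> boundary_atlas A"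
  then obtain c where c: "c \<in> A" and c': "c' = bd_chart c" by (auto simp: boundary_atlas_eq)
  from chart(1)[OF c] obtain T where T: "open T" "fst c = M \<inter> T" by (auto simp: openin_open)
  have "fst (bd_chart c) = boundary A \<inter> T" using T(2) boundary_subset by (auto simp: bd_chart_def)
  then show "openin (top_of_set (boundary A)) (fst c')" unfolding c' using T(1) by (auto simp: openin_open)
  from chart(2)[OF c] obtain T where T: "open T" "chart_img c = half_space \<inter> T" by (auto simp: openin_open)
  have "chart_img (bd_chart c) = hyperplane \<inter> T"
    unfolding chart_img_bd_chart[OF c] using T(2) by (auto simp: mem_hyperplane mem_half_space)
  then show "openin (top_of_set hyperplane) (chart_img c')" unfolding c' using T(1) by (auto simp: openin_open)
  show "homeomorphism (fst c') (chart_img c') (snd c') (chart_inv c')"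
    using homeomorphism_inv_into_subset[OF chart(3)[OF c], of "fst c \<inter> boundary A"]
    by (simp add: c' bd_chart_def chart_img_def chart_inv_def)
next
  fix c' d' assume "c' \<in> boundary_atlas A" "d' \<in> boundary_atlas A"
  then obtain c d where c: "c \<in> A" and c': "c' = bd_chart c" and d: "d \<in> A" and d': "d' = bd_chart d"
    by (auto simp: boundary_atlas_eq)
  have sub: "snd c' ` (fst c' \<inter> fst d') \<subseteq> overlap c d"
    by (auto simp: c' d' bd_chart_def overlap_def)
  show "smooth_on (snd c' ` (fst c' \<inter> fst d')) (snd d' \<circ> chart_inv c')"
  proof (rule smooth_on_cong[OF smooth_on_subset[OF transition_smooth[OF c d] sub]])
    fix x assume "x \<in> snd c' ` (fst c' \<inter> fst d')"
    then have "x \<in> chart_img (bd_chart c)" by (auto simp: c' chart_img_def)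
    then show "(snd d' \<circ> chart_inv c') x = (snd d \<circ> chart_inv c) x"
      by (simp add: c' d' chart_inv_bd_chart[OF c]) (simp add: bd_chart_def)
  qed
qed

sublocale bd: compact_patched "- {bd_index}" hyperplane "boundary A" "boundary_atlas A" \<psi>
proof
  show "model_space (- {bd_index}) hyperplane" by (rule model_space_hyperplane)
  show "smooth_atlas hyperplane (boundary A) (boundary_atlas A)" by (rule smooth_atlas_boundary)
  show "compact (boundary A)" by (rule compact_boundary)
  fix c' assume "c' \<in> boundary_atlas A"
  then obtain c where c: "c \<in> A" and c': "c' = bd_chart c" by (auto simp: boundary_atlas_eq)
  have sub: "chart_img (bd_chart c) \<subseteq> chart_img c" by (simp add: chart_img_bd_chart[OF c])
  show "smooth_on (chart_img c') (\<psi> \<circ> chart_inv c')"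
    unfolding c'
    by (rule smooth_on_cong[OF smooth_on_subset[OF smooth_\<psi>[OF c] sub]]) (simp add: chart_inv_bd_chart[OF c])
qed

text \<open>Along the hyperplane, derivatives within it and within the full chart image agree. The
  boundary density is therefore the principal minor that occurs in
  \<open>flux_bound\<close>.\<close>

lemma bd_dens_eq:
  assumes c: "c \<in> A" and x: "x \<in> chart_img (bd_chart c)"
  shows "bd.dens (bd_chart c) x = sqrt (det (block (- {bd_index}) (induced_metric \<psi> c x)))"
proof -
  have cb: "bd_chart c \<in> boundary_atlas A" using c by (simp add: boundary_atlas_eq)
  have sub: "chart_img (bd_chart c) \<subseteq> chart_img c" by (simp add: chart_img_bd_chart[OF c])
  have xc: "x \<in> chart_img c" using x sub by blast
  have "coord_deriv (chart_img (bd_chart c)) (\<psi> \<circ> chart_inv (bd_chart c)) i x =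
      coord_deriv (chart_img c) (\<psi> \<circ> chart_inv c) i x" if i: "i \<in> - {bd_index}" for i
  proof -
    let ?E = "frechet_derivative (\<psi> \<circ> chart_inv c) (at x within chart_img c)"
    have "(\<psi> \<circ> chart_inv c has_derivative ?E) (at x within chart_img c)"
      by (rule smooth_on_has_derivative[OF smooth_\<psi>[OF c] xc])
    then have "(\<psi> \<circ> chart_inv c has_derivative ?E) (at x within chart_img (bd_chart c))"
      using sub by (rule has_derivative_subset)
    then have "(\<psi> \<circ> chart_inv (bd_chart c) has_derivative ?E) (at x within chart_img (bd_chart c))"
      by (rule has_derivative_transform[OF x, rotated]) (simp add: chart_inv_bd_chart[OF c])
    from coord_deriv_eq[OF bd.inward_chart_img[OF cb] x i this] show ?thesis by (simp add: coord_deriv_def)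
  qed
  then have "block (- {bd_index}) (induced_metric \<psi> (bd_chart c) x) = block (- {bd_index}) (induced_metric \<psi> c x)"
    by (simp add: block_def induced_metric_def vec_eq_iff)
  then show ?thesis by (simp add: volume_density_def)
qed

end

section \<open>Partition of unity and divergence theorem\<close>

text \<open>By relative openness, derivatives within either piece are derivatives within the union;
  by uniqueness they agree on the intersection.\<close>

lemma C1_on_openin_Un:
  fixes f :: "real^'n::finite \<Rightarrow> 'b::real_normed_vector"
  assumes S: "inward UNIV (U \<union> V)" and U: "openin (top_of_set (U \<union> V)) U" "C1_on U f"
    and V: "openin (top_of_set (U \<union> V)) V" "C1_on V f"
  shows "C1_on (U \<union> V) f"
proof -
  have der: "(f has_derivative f') (at x within U \<union> V)"
    if W: "openin (top_of_set (U \<union> V)) W" "x \<in> W" and "(f has_derivative f') (at x within W)" for W x f'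
    using that by (simp add: at_within_openin[OF W])
  obtain fU where "\<forall>x\<in>U. (f has_derivative fU x) (at x within U)" "\<forall>v. continuous_on U (\<lambda>x. fU x v)"
    using U(2) unfolding C1_on_def by (elim exE conjE)
  note fU = this[rule_format]
  obtain fV where "\<forall>x\<in>V. (f has_derivative fV x) (at x within V)" "\<forall>v. continuous_on V (\<lambda>x. fV x v)"
    using V(2) unfolding C1_on_def by (elim exE conjE)
  note fV = this[rule_format]
  have eq: "fU x = fV x" if "x \<in> U" "x \<in> V" for x
    by (rule has_derivative_unique_inward[OF S _ der[OF U(1) _ fU(1)] der[OF V(1) _ fV(1)]]) (use that in auto)
  show ?thesis
  proof (rule C1_onI[where f' = "\<lambda>x. if x \<in> U then fU x else fV x"])
    fix x assume "x \<in> U \<union> V"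
    then show "(f has_derivative (if x \<in> U then fU x else fV x)) (at x within U \<union> V)"
      using der[OF U(1) _ fU(1), of x] der[OF V(1) _ fV(1), of x] by (cases "x \<in> U") auto
  next
    fix v
    have "continuous_on U (\<lambda>x. (if x \<in> U then fU x else fV x) v)"
      by (rule continuous_on_eq[OF fU(2)[of v]]) simp
    moreover have "continuous_on V (\<lambda>x. (if x \<in> U then fU x else fV x) v)"
      by (rule continuous_on_eq[OF fV(2)[of v]]) (simp add: eq)
    ultimately show "continuous_on (U \<union> V) (\<lambda>x. (if x \<in> U then fU x else fV x) v)"
      by (rule continuous_on_Un_local_open[OF U(1) V(1)])
  qed
qed

lemma C1_on_compose:
  fixes \<tau> :: "'a::real_normed_vector \<Rightarrow> real^'n::finite" and f :: "real^'n \<Rightarrow> 'b::real_normed_vector"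
  assumes \<tau>: "C1_on S \<tau>" and f: "C1_on T f" and sub: "\<tau> ` S \<subseteq> T"
  shows "C1_on S (f \<circ> \<tau>)"
proof -
  obtain \<tau>' where "\<forall>x\<in>S. (\<tau> has_derivative \<tau>' x) (at x within S)" "\<forall>v. continuous_on S (\<lambda>x. \<tau>' x v)"
    using \<tau> unfolding C1_on_def by (elim exE conjE)
  note \<tau>' = this[rule_format]
  obtain f' where "\<forall>x\<in>T. (f has_derivative f' x) (at x within T)" "\<forall>v. continuous_on T (\<lambda>x. f' x v)"
    using f unfolding C1_on_def by (elim exE conjE)
  note f' = this[rule_format]
  show ?thesis
  proof (rule C1_onI[where f' = "\<lambda>x. f' (\<tau> x) \<circ> \<tau>' x"])
    fix x assume x: "x \<in> S"
    then have "\<tau> x \<in> T" using sub by blast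
    from has_derivative_subset[OF f'(1)[OF this] sub]
    show "(f \<circ> \<tau> has_derivative f' (\<tau> x) \<circ> \<tau>' x) (at x within S)"
      by (rule diff_chain_within[OF \<tau>'(1)[OF x]])
  next
    fix v
    \<comment> \<open>\<open>C1_on\<close> provides continuity one fixed direction at a time, so the
      varying direction \<open>\<tau>' x v\<close> is expanded in the axes.\<close>
    have "continuous_on S (\<lambda>x. \<Sum>i\<in>UNIV. \<tau>' x v $ i *\<^sub>R f' (\<tau> x) (axis i 1))"
      by (intro continuous_on_sum continuous_on_scaleR continuous_on_component \<tau>'
          continuous_on_compose2[OF f'(2) C1_on_continuous[OF \<tau>] sub])
    then show "continuous_on S (\<lambda>x. (f' (\<tau> x) \<circ> \<tau>' x) v)"
    proof (rule continuous_on_eq)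
      fix x assume "x \<in> S"
      then have "\<tau> x \<in> T" using sub by blast
      from has_derivative_linear[OF f'(1)[OF this]]
      show "(\<Sum>i\<in>UNIV. \<tau>' x v $ i *\<^sub>R f' (\<tau> x) (axis i 1)) = (f' (\<tau> x) \<circ> \<tau>' x) v"
        unfolding comp_apply by (rule linear_sum_axis[symmetric])
    qed
  qed
qed

text \<open>The square of the positive part is continuously differentiable. For
  \<open>s = r\<^sup>2\<close> with \<open>r > 0\<close> the composite is positive exactly on the
  open ball of radius \<open>r\<close> about \<open>y\<close>.\<close>

lemma C1_on_bump: "C1_on S (\<lambda>x :: 'a::euclidean_space. (max 0 (s - (x - y) \<bullet> (x - y)))\<^sup>2)"
proof (rule C1_on_compose_real[where h = "\<lambda>t. (max 0 t)\<^sup>2" and h' = "\<lambda>t. 2 * max 0 t"])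
  show "C1_on S (\<lambda>x. s - (x - y) \<bullet> (x - y))"
    by (rule C1_onI[where f' = "\<lambda>x v. - (2 * ((x - y) \<bullet> v))"])
      (auto intro!: derivative_eq_intros continuous_intros simp: inner_commute)
  show "continuous_on ((\<lambda>x. s - (x - y) \<bullet> (x - y)) ` S) (\<lambda>t. 2 * max 0 t)"
    by (intro continuous_intros)
  have "((\<lambda>t. (max 0 t)\<^sup>2) has_real_derivative 2 * max 0 t) (at t)" for t :: real
  proof (cases t "0::real" rule: linorder_cases)
    case less
    have "((\<lambda>t. 0) has_real_derivative 0) (at t)" by simp
    then have "((\<lambda>t. (max 0 t)\<^sup>2) has_real_derivative 0) (at t)"
      by (rule has_field_derivative_transform_within_open[where S = "{..<0}"]) (use less in auto)
    then show ?thesis using less by simp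
  next
    case greater
    have "((\<lambda>t. t\<^sup>2) has_real_derivative 2 * t) (at t)" by (auto intro!: derivative_eq_intros)
    then have "((\<lambda>t. (max 0 t)\<^sup>2) has_real_derivative 2 * t) (at t)"
      by (rule has_field_derivative_transform_within_open[where S = "{0<..}"]) (use greater in auto)
    then show ?thesis using greater by simp
  next
    case equal
    \<comment> \<open>At 0, where the two branches meet, the difference quotient is bounded by
      \<open>\<bar>h\<bar>\<close>.\<close>
    have "((\<lambda>h. ((max 0 (0 + h))\<^sup>2 - (max 0 0)\<^sup>2) / h) \<longlongrightarrow> 0) (at (0::real))"
    proof (rule Lim_null_comparison)
      show "\<forall>\<^sub>F h in at (0::real). norm (((max 0 (0 + h))\<^sup>2 - (max 0 0)\<^sup>2) / h) \<le> \<bar>h\<bar>"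
        by (intro always_eventually allI) (auto simp: max_def power2_eq_square)
      show "((\<lambda>h. \<bar>h\<bar>) \<longlongrightarrow> 0) (at (0::real))" by (auto intro!: tendsto_eq_intros)
    qed
    then show ?thesis using equal by (simp add: DERIV_def)
  qed
  then show "((\<lambda>t. (max 0 t)\<^sup>2) has_real_derivative 2 * max 0 (s - (x - y) \<bullet> (x - y))) (at (s - (x - y) \<bullet> (x - y)))" for x .
qed

context minimal_manifold
begin

section \<open>C1 functions on the manifold and their derivative along the gradient\<close>

definition C1_manifold :: "('m \<Rightarrow> real) \<Rightarrow> bool" where
  "C1_manifold u \<longleftrightarrow> (\<forall>c\<in>A. C1_on (chart_img c) (u \<circ> chart_inv c))"

definition grad :: "('m, 'n) chart \<Rightarrow> real^'n \<Rightarrow> real^'n" where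
  "grad c = minimal_patch.X (chart_img c) (\<psi> \<circ> chart_inv c) a"

text \<open>By \<open>grad_deriv_chart\<close> below, the value does not depend on the chart picked by \<open>SOME\<close>.\<close>

definition grad_deriv :: "('m \<Rightarrow> real) \<Rightarrow> 'm \<Rightarrow> real" where
  "grad_deriv u p = (let c = (SOME c. c \<in> A \<and> p \<in> fst c) in
     frechet_derivative (u \<circ> chart_inv c) (at (snd c p) within chart_img c) (grad c (snd c p)))"

text \<open>The gradient is determined by inner products alone. Its image under the transition map
  satisfies the equation that characterises the gradient in the other chart.\<close>

lemma grad_transition:
  assumes c: "c \<in> A" and d: "d \<in> A" and x: "x \<in> overlap c d"
  shows "dtrans c d x (grad c x) = grad d ((snd d \<circ> chart_inv c) x)"
proof -
  let ?y = "(snd d \<circ> chart_inv c) x"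
  interpret C: minimal_patch "chart_img c" "\<psi> \<circ> chart_inv c" a by (rule minimal_patch_chart[OF c])
  interpret D: minimal_patch "chart_img d" "\<psi> \<circ> chart_inv d" a by (rule minimal_patch_chart[OF d])
  have xc: "x \<in> chart_img c" using overlap_subset[OF c] x by blast
  have yd: "?y \<in> chart_img d" using transition_mem[OF c d x] overlap_subset[OF d] by blast
  have chain: "C.d\<Psi> x v = D.d\<Psi> ?y (dtrans c d x v)" for v
    using has_derivative_unique_inward[OF C.U xc C.has_derivative_\<Psi>[OF xc]
        has_derivative_change_chart[OF c d x D.has_derivative_\<Psi>[OF yd]]] by simp
  have "dtrans c d x (C.X x) = D.X ?y"
  proof (rule D.X_unique[OF yd])
    fix w
    \<comment> \<open>The derivative of the transition map is onto, so every test vector comes from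
      the first chart.\<close>
    have "w = dtrans c d x (dtrans d c ?y w)" using dtrans_inverse[OF c d x, of w] by simp
    then have "D.d\<Psi> ?y w = C.d\<Psi> x (dtrans d c ?y w)" by (metis chain)
    then show "lorentz (D.d\<Psi> ?y (dtrans c d x (C.X x))) (D.d\<Psi> ?y w) = - lorentz a (D.d\<Psi> ?y w)"
      using C.X_gradient[OF xc, of "dtrans d c ?y w"] by (simp add: chain)
  qed
  then show ?thesis by (simp add: grad_def)
qed

lemma C1_manifoldD: "C1_manifold u \<Longrightarrow> c \<in> A \<Longrightarrow> C1_on (chart_img c) (u \<circ> chart_inv c)"
  by (simp add: C1_manifold_def)

lemma grad_deriv_chart:
  assumes u: "C1_manifold u" and c: "c \<in> A" and x: "x \<in> chart_img c"
  shows "grad_deriv u (chart_inv c x) =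
    frechet_derivative (u \<circ> chart_inv c) (at x within chart_img c) (grad c x)"
proof -
  let ?p = "chart_inv c x"
  have pc: "?p \<in> fst c" by (rule chart_inv_mem[OF c x])
  define d where "d = (SOME d. d \<in> A \<and> ?p \<in> fst d)"
  have "d \<in> A \<and> ?p \<in> fst d" unfolding d_def by (rule someI[of _ c]) (use c pc in simp)
  then have d: "d \<in> A" and pd: "?p \<in> fst d" by auto
  have xo: "x \<in> overlap c d"
    unfolding overlap_def using pc pd chart_chart_inv[OF c x] by (intro image_eqI[of _ _ ?p]) auto
  let ?y = "(snd d \<circ> chart_inv c) x"
  have yd: "?y \<in> chart_img d" using transition_mem[OF c d xo] overlap_subset[OF d] by blast
  let ?E = "frechet_derivative (u \<circ> chart_inv d) (at ?y within chart_img d)"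
  have "(u \<circ> chart_inv d has_derivative ?E) (at ?y within chart_img d)"
    by (rule C1_on_has_derivative[OF C1_manifoldD[OF u d] yd])
  from has_derivative_change_chart[OF c d xo this]
  have "frechet_derivative (u \<circ> chart_inv c) (at x within chart_img c) = ?E \<circ> dtrans c d x"
    by (rule frechet_derivative_inward[OF inward_chart_img[OF c] x])
  then show ?thesis
    unfolding grad_deriv_def Let_def d_def[symmetric] using grad_transition[OF c d xo] by simp
qed

text \<open>The gradient is \<open>Y\<close> divided by the positive density, and both are of class
  C1.\<close>

lemma grad_continuous:
  assumes c: "c \<in> A"
  shows "continuous_on (chart_img c) (\<lambda>x. grad c x $ i)"
proof -
  interpret P: minimal_patch "chart_img c" "\<psi> \<circ> chart_inv c" a by (rule minimal_patch_chart[OF c])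
  have "continuous_on (chart_img c) (\<lambda>x. P.Y i x / P.dens x)"
    using P.dens_pos by (intro continuous_on_divide C1_on_continuous P.C1_Y P.C1_dens) (auto simp: less_imp_neq[symmetric])
  then show ?thesis
  proof (rule continuous_on_eq)
    show "P.Y i x / P.dens x = grad c x $ i" if "x \<in> chart_img c" for x
      using P.dens_pos[OF that] by (simp add: P.Y_eq grad_def)
  qed
qed

lemma grad_deriv_continuous:
  assumes u: "C1_manifold u"
  shows "continuous_on M (grad_deriv u)"
proof (rule continuous_on_manifold)
  fix c assume c: "c \<in> A"
  have "continuous_on (chart_img c) (\<lambda>x. \<Sum>i\<in>UNIV. grad c x $ i *\<^sub>R coord_deriv (chart_img c) (u \<circ> chart_inv c) i x)"
    by (intro continuous_on_sum continuous_on_scaleR grad_continuous[OF c]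
        C1_on_coord_deriv_continuous[OF inward_chart_img[OF c] C1_manifoldD[OF u c]])
  then show "continuous_on (chart_img c) (grad_deriv u \<circ> chart_inv c)"
  proof (rule continuous_on_eq)
    fix x assume x: "x \<in> chart_img c"
    note l = has_derivative_linear[OF C1_on_has_derivative[OF C1_manifoldD[OF u c] x]]
    show "(\<Sum>i\<in>UNIV. grad c x $ i *\<^sub>R coord_deriv (chart_img c) (u \<circ> chart_inv c) i x) = (grad_deriv u \<circ> chart_inv c) x"
      unfolding comp_apply[of "grad_deriv u"] grad_deriv_chart[OF u c x] coord_deriv_def
      by (rule linear_sum_axis[OF l, symmetric])
  qed
qed

lemma C1_manifold_continuous: "C1_manifold u \<Longrightarrow> continuous_on M u"
  by (rule continuous_on_manifold) (rule C1_on_continuous[OF C1_manifoldD])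

text \<open>The complement of a compact set is open, so \<open>u\<close> vanishes near
  \<open>p\<close> and has derivative zero there.\<close>

lemma grad_deriv_zero:
  assumes u: "C1_manifold u" and K: "compact K" and supp: "\<And>p. p \<in> M - K \<Longrightarrow> u p = 0" and p: "p \<in> M - K"
  shows "grad_deriv u p = 0"
proof -
  obtain c where c: "c \<in> A" "p \<in> fst c" using p M_eq by auto
  let ?x = "snd c p" and ?V = "chart_img c \<inter> chart_inv c -` (- K)"
  have x: "?x \<in> chart_img c" and px: "chart_inv c ?x = p"
    using chart_mem[OF c] chart_inv_chart[OF c] by auto
  have V: "openin (top_of_set (chart_img c)) ?V"
    using continuous_openin_preimage_gen[OF chart_inv_continuous[OF c(1)]] compact_imp_closed[OF K] by blast
  have xV: "?x \<in> ?V" using x px p by simp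
  have "(u \<circ> chart_inv c has_derivative (\<lambda>v. 0)) (at ?x within ?V)"
  proof (rule has_derivative_transform[OF xV _ has_derivative_const[of 0]])
    fix y assume "y \<in> ?V"
    then show "(u \<circ> chart_inv c) y = 0"
      using supp chart_inv_mem[OF c(1)] fst_chart_subset[OF c(1)] by auto
  qed
  then have "(u \<circ> chart_inv c has_derivative (\<lambda>v. 0)) (at ?x within chart_img c)"
    by (simp add: at_within_openin[OF V xV])
  then have "frechet_derivative (u \<circ> chart_inv c) (at ?x within chart_img c) = (\<lambda>v. 0)"
    by (rule frechet_derivative_inward[OF inward_chart_img[OF c(1)] x])
  then show ?thesis using grad_deriv_chart[OF u c(1) x] px by simp
qed

text \<open>The constant sum is differentiated in a chart. For this reason the terms with
  derivatives of cut-off functions disappear after summation.\<close>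

lemma grad_deriv_sum_const:
  assumes u: "\<And>k. k \<in> P \<Longrightarrow> C1_manifold (u k)" and sum: "\<And>p. p \<in> M \<Longrightarrow> (\<Sum>k\<in>P. u k p) = 1" and p: "p \<in> M"
  shows "(\<Sum>k\<in>P. grad_deriv (u k) p) = 0"
proof -
  obtain c where c: "c \<in> A" "p \<in> fst c" using p M_eq by auto
  let ?x = "snd c p"
  have x: "?x \<in> chart_img c" and px: "chart_inv c ?x = p"
    using chart_mem[OF c] chart_inv_chart[OF c] by auto
  let ?E = "\<lambda>k. frechet_derivative (u k \<circ> chart_inv c) (at ?x within chart_img c)"
  have 1: "((\<lambda>y. \<Sum>k\<in>P. (u k \<circ> chart_inv c) y) has_derivative (\<lambda>v. \<Sum>k\<in>P. ?E k v)) (at ?x within chart_img c)"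
    by (intro has_derivative_sum C1_on_has_derivative[OF C1_manifoldD[OF u c(1)] x])
  have 2: "((\<lambda>y. \<Sum>k\<in>P. (u k \<circ> chart_inv c) y) has_derivative (\<lambda>v. 0)) (at ?x within chart_img c)"
  proof (rule has_derivative_transform[OF x _ has_derivative_const[of 1]])
    fix y assume "y \<in> chart_img c"
    then show "(\<Sum>k\<in>P. (u k \<circ> chart_inv c) y) = 1"
      using sum chart_inv_mem[OF c(1)] fst_chart_subset[OF c(1)] by auto
  qed
  have "(\<lambda>v. \<Sum>k\<in>P. ?E k v) = (\<lambda>v. 0)"
    by (rule has_derivative_unique_inward[OF inward_chart_img[OF c(1)] x 1 2])
  then have "(\<Sum>k\<in>P. ?E k (grad c ?x)) = 0" by (rule fun_cong)
  moreover have "grad_deriv (u k) p = ?E k (grad c ?x)" if "k \<in> P" for k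
    using grad_deriv_chart[OF u[OF that] c(1) x] px by simp
  ultimately show ?thesis by simp
qed

end

context minimal_manifold
begin

text \<open>\<open>K\<close> is compact, hence closed, so its complement is open in every chart, and
  there the bump vanishes. Together with the overlap with \<open>c\<close>, where the bump is
  composed with a transition map, this covers each chart image.\<close>

lemma C1_manifold_bump:
  assumes c: "c \<in> A" and r: "cball y r \<inter> half_space \<subseteq> chart_img c" "0 \<le> r"
  defines "K \<equiv> chart_inv c ` (cball y r \<inter> half_space)"
  defines "\<eta> \<equiv> \<lambda>p. if p \<in> fst c then (max 0 (r\<^sup>2 - (snd c p - y) \<bullet> (snd c p - y)))\<^sup>2 else 0"
  shows "compact K" "K \<subseteq> fst c" "\<And>p. p \<in> M - K \<Longrightarrow> \<eta> p = 0" "C1_manifold \<eta>"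
proof -
  have "compact (cball y r \<inter> half_space)"
    by (intro compact_Int_closed compact_cball closed_half_space)
  then show K: "compact K"
    unfolding K_def
    by (intro compact_continuous_image continuous_on_subset[OF chart_inv_continuous[OF c] r(1)])
  show Kc: "K \<subseteq> fst c" unfolding K_def using r(1) chart_inv_mem[OF c] by blast
  have zero: "\<eta> p = 0" if p: "p \<notin> K" for p
  proof (cases "p \<in> fst c")
    case True
    have "snd c p \<notin> cball y r"
    proof
      assume "snd c p \<in> cball y r"
      moreover have "snd c p \<in> half_space" using chart_mem[OF c True] chart_img_subset[OF c] by blast
      ultimately have "chart_inv c (snd c p) \<in> K" unfolding K_def by blast
      then show False using p chart_inv_chart[OF c True] by simp
    qed
    then have "r < norm (snd c p - y)" by (simp add: dist_norm norm_minus_commute)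
    then have "r\<^sup>2 < (norm (snd c p - y))\<^sup>2" using r(2) by (intro power_strict_mono) auto
    then have "r\<^sup>2 - (snd c p - y) \<bullet> (snd c p - y) \<le> 0" by (simp add: dot_square_norm)
    then show ?thesis by (simp add: \<eta>_def max_absorb1)
  qed (simp add: \<eta>_def)
  then show "\<eta> p = 0" if "p \<in> M - K" for p using that by blast
  show "C1_manifold \<eta>"
    unfolding C1_manifold_def
  proof
    fix d assume d: "d \<in> A"
    let ?V = "chart_img d \<inter> chart_inv d -` (- K)"
    have V: "openin (top_of_set (chart_img d)) ?V"
      by (rule continuous_openin_preimage_gen[OF chart_inv_continuous[OF d]])
        (use compact_imp_closed[OF K] in \<open>simp add: open_Compl\<close>)
    have O: "openin (top_of_set (chart_img d)) (overlap d c)"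
      using openin_overlap[OF d c] overlap_subset[OF d] chart_img_subset[OF d] by (rule openin_subset_trans)
    have cover: "overlap d c \<union> ?V = chart_img d"
    proof (intro equalityI subsetI)
      fix x assume x: "x \<in> chart_img d"
      show "x \<in> overlap d c \<union> ?V"
      proof (cases "chart_inv d x \<in> fst c")
        case True
        then have "x \<in> overlap d c"
          unfolding overlap_def using chart_chart_inv[OF d x] chart_inv_mem[OF d x]
          by (intro image_eqI[of _ _ "chart_inv d x"]) auto
        then show ?thesis by blast
      next
        case False
        then show ?thesis using x Kc by blast
      qed
    qed (use overlap_subset[OF d] in blast)
    let ?\<tau> = "snd c \<circ> chart_inv d"
    let ?g = "\<lambda>x :: real^'n. (max 0 (r\<^sup>2 - (x - y) \<bullet> (x - y)))\<^sup>2"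
    have "C1_on (overlap d c) (?g \<circ> ?\<tau>)"
      by (rule C1_on_compose[OF smooth_on_C1_on[OF inward_overlap[OF d c] transition_smooth[OF d c]]
            C1_on_bump subset_UNIV])
    then have 1: "C1_on (overlap d c) (\<eta> \<circ> chart_inv d)"
    proof (rule C1_on_cong)
      fix x assume "x \<in> overlap d c"
      then obtain p where "p \<in> fst d" "p \<in> fst c" "x = snd d p" by (auto simp: overlap_def)
      then show "(\<eta> \<circ> chart_inv d) x = (?g \<circ> ?\<tau>) x" by (simp add: \<eta>_def chart_inv_chart[OF d])
    qed
    have 2: "C1_on ?V (\<eta> \<circ> chart_inv d)"
      by (rule C1_on_cong[OF C1_on_const[of _ 0]]) (simp add: zero)
    have "C1_on (overlap d c \<union> ?V) (\<eta> \<circ> chart_inv d)"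
    proof (rule C1_on_openin_Un)
      show "inward UNIV (overlap d c \<union> ?V)" unfolding cover by (rule inward_chart_img[OF d])
      show "openin (top_of_set (overlap d c \<union> ?V)) (overlap d c)" unfolding cover by (rule O)
      show "openin (top_of_set (overlap d c \<union> ?V)) ?V" unfolding cover by (rule V)
    qed (rule 1 2)+
    then show "C1_on (chart_img d) (\<eta> \<circ> chart_inv d)" unfolding cover .
  qed
qed

text \<open>Compactness leaves finitely many bumps whose sum is positive on \<open>M\<close>;
  division by the sum normalises them. The index of a bump is the point at which it is
  centred.\<close>

lemma partition_of_unity:
  "\<exists>P c K \<phi>. finite (P :: 'm set) \<and> (\<forall>k\<in>P. c k \<in> A \<and> compact (K k) \<and> K k \<subseteq> fst (c k) \<and>
      C1_manifold (\<phi> k) \<and> (\<forall>p\<in>M - K k. \<phi> k p = 0) \<and> (\<forall>p\<in>M. 0 \<le> \<phi> k p)) \<and>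
    (\<forall>p\<in>M. (\<Sum>k\<in>P. \<phi> k p) = 1)"
proof -
  have "\<forall>p\<in>M. \<exists>c r. c \<in> A \<and> p \<in> fst c \<and> 0 < r \<and> cball (snd c p) r \<inter> half_space \<subseteq> chart_img c"
  proof
    fix p assume "p \<in> M"
    then obtain c where c: "c \<in> A" "p \<in> fst c" using M_eq by auto
    obtain T where T: "open T" "chart_img c = half_space \<inter> T" using chart(2)[OF c(1)] by (auto simp: openin_open)
    have "snd c p \<in> T" using chart_mem[OF c] T(2) by blast
    then obtain r where "0 < r" "cball (snd c p) r \<subseteq> T" using T(1) open_contains_cball by blast
    then show "\<exists>c r. c \<in> A \<and> p \<in> fst c \<and> 0 < r \<and> cball (snd c p) r \<inter> half_space \<subseteq> chart_img c"
      using c T(2) by (intro exI[of _ c] exI[of _ r]) auto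
  qed
  then obtain c r where "\<forall>p\<in>M. c p \<in> A \<and> p \<in> fst (c p) \<and> 0 < r p \<and>
      cball (snd (c p) p) (r p) \<inter> half_space \<subseteq> chart_img (c p)"
    by metis
  then have c: "c k \<in> A" "k \<in> fst (c k)" "0 < r k" "cball (snd (c k) k) (r k) \<inter> half_space \<subseteq> chart_img (c k)"
    if "k \<in> M" for k using that by simp_all
  define x where "x k = snd (c k) k" for k
  \<comment> \<open>The set on which the bump centred at \<open>k\<close> is positive; the support
    lies in the image of the closed ball, which is still inside the chart.\<close>
  define W where "W k = fst (c k) \<inter> snd (c k) -` ball (x k) (r k)" for k
  have W: "openin (top_of_set M) (W k)" if "k \<in> M" for k
  proof -
    have "openin (top_of_set (fst (c k))) (W k)"
      unfolding W_def by (rule continuous_openin_preimage_gen[OF chart_continuous[OF c(1)[OF that]] open_ball])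
    then show ?thesis using chart(1)[OF c(1)[OF that]] by (rule openin_trans)
  qed
  have kW: "k \<in> W k" if "k \<in> M" for k using c[OF that] by (simp add: W_def x_def)
  have "\<forall>U\<in>W ` M. openin (top_of_set M) U" "M \<subseteq> \<Union>(W ` M)" using W kW by auto
  then obtain \<D> where \<D>: "\<D> \<subseteq> W ` M" "finite \<D>" "M \<subseteq> \<Union>\<D>"
    using compact unfolding compact_eq_openin_cover by meson
  obtain P where P: "P \<subseteq> M" "finite P" "\<D> = W ` P" using finite_subset_image[OF \<D>(2,1)] by blast
  define K where "K k = chart_inv (c k) ` (cball (x k) (r k) \<inter> half_space)" for k
  define \<eta> where "\<eta> k = (\<lambda>p. if p \<in> fst (c k) then
      (max 0 ((r k)\<^sup>2 - (snd (c k) p - x k) \<bullet> (snd (c k) p - x k)))\<^sup>2 else 0)" for k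
  have bump: "compact (K k)" "K k \<subseteq> fst (c k)" "\<And>p. p \<in> M - K k \<Longrightarrow> \<eta> k p = 0" "C1_manifold (\<eta> k)" if "k \<in> P" for k
  proof -
    have k: "k \<in> M" using that P by blast
    note * = C1_manifold_bump[OF c(1)[OF k] c(4)[OF k] less_imp_le[OF c(3)[OF k]]]
    show "compact (K k)" "K k \<subseteq> fst (c k)" "C1_manifold (\<eta> k)"
      using *(1,2,4) unfolding K_def \<eta>_def x_def by simp_all
    show "\<eta> k p = 0" if "p \<in> M - K k" for p
      using *(3)[of p] that unfolding K_def \<eta>_def x_def by simp
  qed
  have \<eta>0: "0 \<le> \<eta> k p" for k p by (simp add: \<eta>_def)
  define S where "S p = (\<Sum>k\<in>P. \<eta> k p)" for p
  have S: "0 < S p" if p: "p \<in> M" for p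
  proof -
    obtain k where k: "k \<in> P" "p \<in> W k" using p \<D>(3) P(3) by blast
    have "norm (snd (c k) p - x k) < r k"
      using k(2) by (simp add: W_def dist_norm norm_minus_commute)
    then have "(norm (snd (c k) p - x k))\<^sup>2 < (r k)\<^sup>2" by (intro power_strict_mono) auto
    then have "0 < (r k)\<^sup>2 - (snd (c k) p - x k) \<bullet> (snd (c k) p - x k)" by (simp add: dot_square_norm)
    then have "0 < \<eta> k p" using k(2) by (simp add: \<eta>_def W_def max_absorb2)
    then show ?thesis unfolding S_def using k(1) P(2) \<eta>0 by (intro sum_pos2[of P k]) auto
  qed
  define \<phi> where "\<phi> k p = \<eta> k p * inverse (S p)" for k p
  show ?thesis
  proof (intro exI[of _ P] exI[of _ c] exI[of _ K] exI[of _ \<phi>] conjI ballI)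
    show "finite P" by (rule P)
    show "c k \<in> A" if "k \<in> P" for k using c(1) that P(1) by blast
    show "compact (K k)" "K k \<subseteq> fst (c k)" if "k \<in> P" for k using bump that by blast+
    show "\<phi> k p = 0" if "k \<in> P" "p \<in> M - K k" for k p using bump(3)[OF that] by (simp add: \<phi>_def)
    show "0 \<le> \<phi> k p" if "k \<in> P" "p \<in> M" for k p using \<eta>0 S[OF that(2)] by (simp add: \<phi>_def)
    show "(\<Sum>k\<in>P. \<phi> k p) = 1" if "p \<in> M" for p
      using S[OF that] unfolding \<phi>_def sum_distrib_right[symmetric] S_def[symmetric] by simp
    show "C1_manifold (\<phi> k)" if k: "k \<in> P" for k
      unfolding C1_manifold_def
    proof
      fix d assume d: "d \<in> A"
      have nz: "(\<Sum>k\<in>P. (\<eta> k \<circ> chart_inv d) x) \<noteq> 0" if x: "x \<in> chart_img d" for x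
      proof -
        have "chart_inv d x \<in> M" using chart_inv_mem[OF d x] fst_chart_subset[OF d] by blast
        from S[OF this] show ?thesis by (simp add: S_def)
      qed
      have "C1_on (chart_img d) (\<lambda>x. (\<eta> k \<circ> chart_inv d) x * inverse (\<Sum>k\<in>P. (\<eta> k \<circ> chart_inv d) x))"
        by (intro C1_on_mult C1_on_inverse C1_on_sum C1_manifoldD[OF bump(4) d] k nz)
      then show "C1_on (chart_img d) (\<phi> k \<circ> chart_inv d)"
        by (rule C1_on_cong) (simp add: \<phi>_def S_def)
    qed
  qed
qed

section \<open>The divergence theorem with the flux estimate\<close>

definition ch_dist :: "'m \<Rightarrow> real" where
  "ch_dist p = - lorentz a (\<psi> p)"

lemma ch_dist_continuous: "continuous_on M ch_dist"
proof -
  have "continuous_on M \<psi>"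
    by (rule continuous_on_manifold) (rule smooth_on_continuous[OF smooth_\<psi>])
  then show ?thesis
    unfolding ch_dist_def[abs_def] by (intro continuous_on_minus lorentz.continuous_on continuous_on_const)
qed

text \<open>\<open>h\<close> is the divergence of \<open>u\<close> times the gradient of
  \<open>ch_dist\<close>. In the chart only the boundary coordinate leaves a term, with a minus sign
  because the half space lies on its positive side; that term is estimated by
  \<open>flux_bound\<close>, where \<open>ch_dist\<close> equals \<open>cosh \<rho>\<close>.\<close>

lemma
  fixes u :: "'m \<Rightarrow> real"
  assumes c: "c \<in> A" and u: "C1_manifold u" and K: "compact K" "K \<subseteq> fst c"
    and supp: "\<And>p. p \<in> M - K \<Longrightarrow> u p = 0" and nonneg: "\<And>p. p \<in> M \<Longrightarrow> 0 \<le> u p"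
    and \<rho>: "0 < \<rho>" "\<And>p. p \<in> boundary A \<Longrightarrow> ch_dist p = cosh \<rho>"
  defines "h \<equiv> \<lambda>p. real CARD('n) * ch_dist p * u p + grad_deriv u p"
  shows integrable_divergence: "integrable vol h"
    and integrable_bump: "integrable vol u"
    and integrable_boundary_bump: "integrable bd.vol u"
    and divergence_le: "integral\<^sup>L vol h \<le> sinh \<rho> * integral\<^sup>L bd.vol u"
proof -
  interpret P: minimal_patch "chart_img c" "\<psi> \<circ> chart_inv c" a by (rule minimal_patch_chart[OF c])
  let ?U = "chart_img c" and ?c = "bd_chart c" and ?b = "bd_index :: 'n"
  define v where "v = u \<circ> chart_inv c"
  have v: "C1_on ?U v" unfolding v_def by (rule C1_manifoldD[OF u c])
  have inM: "chart_inv c x \<in> M" if "x \<in> ?U" for x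
    using chart_inv_mem[OF c that] fst_chart_subset[OF c] by blast
  have v0: "0 \<le> v x" if "x \<in> ?U" for x using nonneg[OF inM[OF that]] by (simp add: v_def)
  have hcont: "continuous_on M h"
    unfolding h_def
    by (intro continuous_on_add continuous_on_mult continuous_on_const ch_dist_continuous
        C1_manifold_continuous[OF u] grad_deriv_continuous[OF u])
  have hsupp: "h p = 0" if "p \<in> M - K" for p
    using supp[OF that] grad_deriv_zero[OF u K(1) supp that] by (simp add: h_def)
  show "integrable vol h"
    by (rule integrable_vol_compact_support[OF c hcont K hsupp dens_nonneg[OF c]])
  show "integrable vol u"
    by (rule integrable_vol_compact_support[OF c C1_manifold_continuous[OF u] K supp dens_nonneg[OF c]])
  define K' where "K' = snd c ` K"
  have K': "compact K'" "K' \<subseteq> ?U"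
    unfolding K'_def using K(2)
    by (auto intro!: compact_continuous_image[OF continuous_on_subset[OF chart_continuous[OF c]]] K(1) chart_mem[OF c])
  have vsupp: "v x = 0" if x: "x \<in> ?U - K'" for x
  proof -
    have "chart_inv c x \<notin> K" using x chart_chart_inv[OF c, of x] unfolding K'_def by (metis DiffD1 DiffD2 imageI)
    then show ?thesis using supp inM[of x] x by (simp add: v_def)
  qed
  \<comment> \<open>The components of the cut-off gradient, with the density included, so that the
    divergence is a sum of partial derivatives with compact support.\<close>
  define w where "w i = (\<lambda>x. v x * P.Y i x)" for i
  have w: "C1_on ?U (w i)" for i unfolding w_def by (intro C1_on_mult v P.C1_Y)
  have wsupp: "w i x = 0" if "x \<in> ?U - K'" for i x using vsupp[OF that] by (simp add: w_def)
  note ibp = integrable_coord_deriv_half_space[OF chart(2)[OF c] w K' wsupp]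
    integral_coord_deriv_half_space[OF chart(2)[OF c] w K' wsupp]
  have eq: "indicator ?U x * (dens c x * h (chart_inv c x)) = (\<Sum>i\<in>UNIV. indicator ?U x * coord_deriv ?U (w i) i x)" for x
  proof (cases "x \<in> ?U")
    case True
    have "h (chart_inv c x) = real CARD('n) * P.ch x * v x + frechet_derivative v (at x within ?U) (P.X x)"
      using grad_deriv_chart[OF u c True] by (simp add: h_def v_def ch_dist_def P.ch_def grad_def)
    then have "dens c x * h (chart_inv c x) = (\<Sum>i\<in>UNIV. coord_deriv ?U (w i) i x)"
      using P.divergence_mult_Y[OF True v] by (simp add: dens_eq[OF c] w_def)
    then show ?thesis using True by simp
  qed simp
  have hm: "h \<in> borel_measurable sM" by (rule borel_measurable_continuous_on_restrict[OF hcont])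
  have hsupp': "h p = 0" if "p \<in> M - fst c" for p using hsupp that K(2) by blast
  have "integral\<^sup>L vol h = (\<integral>x. indicator ?U x * (dens c x * h (chart_inv c x)) \<partial>coord_lborel UNIV)"
    by (rule integral_vol_chart[OF c hm hsupp' dens_nonneg[OF c]])
  also have "\<dots> = (\<integral>x. (\<Sum>i\<in>UNIV. indicator ?U x * coord_deriv ?U (w i) i x) \<partial>lborel)"
    by (simp only: eq coord_lborel_UNIV)
  also have "\<dots> = (\<Sum>i\<in>UNIV. \<integral>x. indicator ?U x * coord_deriv ?U (w i) i x \<partial>lborel)"
    by (rule Bochner_Integration.integral_sum) (rule ibp(1))
  also have "\<dots> = (\<Sum>i\<in>UNIV. if i = ?b then - (\<integral>x. indicator ?U x * w i x \<partial>coord_lborel (- {?b})) else 0)"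
    by (rule sum.cong[OF refl]) (rule ibp(2))
  also have "\<dots> = (\<integral>x. - (indicator ?U x * w ?b x) \<partial>coord_lborel (- {?b}))"
    by simp
  finally have vol_eq: "integral\<^sup>L vol h = (\<integral>x. - (indicator ?U x * w ?b x) \<partial>coord_lborel (- {?b}))" .
  have cb: "?c \<in> boundary_atlas A" using c by (simp add: boundary_atlas_eq)
  have sub: "chart_img ?c \<subseteq> ?U" by (simp add: chart_img_bd_chart[OF c])
  have flux: "\<bar>P.Y ?b x\<bar> \<le> sinh \<rho> * bd.dens ?c x" if x: "x \<in> chart_img ?c" for x
  proof -
    have xU: "x \<in> ?U" using x sub by blast
    have "chart_inv c x \<in> boundary A"
      using bd.chart_inv_mem[OF cb x] chart_inv_bd_chart[OF c x] by (simp add: bd_chart_def)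
    then have "P.ch x = cosh \<rho>" using \<rho>(2) by (simp add: P.ch_def ch_dist_def)
    then have "sqrt ((P.ch x)\<^sup>2 - 1) = sinh \<rho>"
      using \<rho>(1) by (simp add: cosh_square_eq real_sqrt_abs)
    then show ?thesis
      using P.flux_bound[OF xU, of ?b] by (simp add: bd_dens_eq[OF c x] induced_metric_eq[OF c])
  qed
  \<comment> \<open>The sign is read off from the flux bound: an absolute value is at most
    \<open>sinh \<rho>\<close> times the density, and \<open>sinh \<rho>\<close> is
    positive.\<close>
  have bd_dens0: "0 \<le> bd.dens ?c x" if x: "x \<in> chart_img ?c" for x
  proof -
    have "0 \<le> sinh \<rho> * bd.dens ?c x" using flux[OF x] by linarith
    then show ?thesis using \<rho>(1) by (simp add: zero_le_mult_iff)
  qed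
  have ucont: "continuous_on (boundary A) u"
    by (rule continuous_on_subset[OF C1_manifold_continuous[OF u] boundary_subset])
  have Kb: "compact (K \<inter> boundary A)"
    using K(1) compact_imp_closed[OF compact_boundary] by (rule compact_Int_closed)
  have Kb': "K \<inter> boundary A \<subseteq> fst ?c" using K(2) by (auto simp: bd_chart_def)
  have usupp: "u p = 0" if "p \<in> boundary A - K \<inter> boundary A" for p
    using supp that boundary_subset by blast
  show int_bd: "integrable bd.vol u"
    by (rule bd.integrable_vol_compact_support[OF cb ucont Kb Kb' usupp bd_dens0])
  have um: "u \<in> borel_measurable bd.sM" by (rule borel_measurable_continuous_on_restrict[OF ucont])
  have usupp': "u p = 0" if "p \<in> boundary A - fst ?c" for p using usupp that Kb' by blast
  note bd_int = bd.integrable_vol_chart[OF cb um usupp' bd_dens0] bd.integral_vol_chart[OF cb um usupp' bd_dens0]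
  let ?f = "\<lambda>x. indicator (chart_img ?c) x * (bd.dens ?c x * u (chart_inv ?c x))"
  have "(\<integral>x. - (indicator ?U x * w ?b x) \<partial>coord_lborel (- {?b})) \<le> (\<integral>x. sinh \<rho> * ?f x \<partial>coord_lborel (- {?b}))"
  proof (rule integral_mono_AE)
    have "indicator ?U x * w ?b x = indicator K' x * w ?b x" for x
      using wsupp[of x] K'(2) by (auto simp: indicator_def)
    then have "(\<lambda>x. indicator ?U x * w ?b x) = (\<lambda>x. indicator K' x * w ?b x)" by (rule ext)
    then show "integrable (coord_lborel (- {?b})) (\<lambda>x. - (indicator ?U x * w ?b x))"
      using integrable_coord_lborel_compact[OF K'(1) continuous_on_subset[OF C1_on_continuous[OF w] K'(2)]]
      by (simp only: Bochner_Integration.integrable_minus)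
    show "integrable (coord_lborel (- {?b})) (\<lambda>x. sinh \<rho> * ?f x)"
      using bd_int(1) int_bd by (intro integrable_mult_right) simp
    show "AE x in coord_lborel (- {?b}). - (indicator ?U x * w ?b x) \<le> sinh \<rho> * ?f x"
      using AE_coord_lborel[of "- {?b}"]
    proof eventually_elim
      fix x :: "real^'n" assume "\<forall>i. i \<notin> - {?b} \<longrightarrow> x $ i = 0"
      then have xb: "x \<in> hyperplane" by (simp add: mem_hyperplane)
      show "- (indicator ?U x * w ?b x) \<le> sinh \<rho> * ?f x"
      proof (cases "x \<in> ?U")
        case True
        then have xc: "x \<in> chart_img ?c" using xb by (simp add: chart_img_bd_chart[OF c])
        have "- w ?b x \<le> v x * \<bar>P.Y ?b x\<bar>"
          using v0[OF True] abs_ge_minus_self[of "P.Y ?b x"] mult_left_mono[of "- P.Y ?b x" "\<bar>P.Y ?b x\<bar>" "v x"]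
          by (simp add: w_def)
        also have "\<dots> \<le> v x * (sinh \<rho> * bd.dens ?c x)"
          by (rule mult_left_mono[OF flux[OF xc] v0[OF True]])
        finally show ?thesis using True xc by (simp add: v_def chart_inv_bd_chart[OF c xc] mult_ac)
      next
        case False
        then have "x \<notin> chart_img ?c" using sub by blast
        then show ?thesis using False by simp
      qed
    qed
  qed
  also have "\<dots> = sinh \<rho> * (\<integral>x. ?f x \<partial>coord_lborel (- {?b}))" by (rule integral_mult_right_zero)
  also have "(\<integral>x. ?f x \<partial>coord_lborel (- {?b})) = integral\<^sup>L bd.vol u" by (rule bd_int(2)[symmetric])
  finally show "integral\<^sup>L vol h \<le> sinh \<rho> * integral\<^sup>L bd.vol u" unfolding vol_eq .
qed

lemma ch_dist_ge_1:
  assumes "p \<in> M"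
  shows "1 \<le> ch_dist p"
proof -
  have "\<psi> p \<in> hyperbolic_space" using immersion assms by (auto simp: immersion_hyp_def)
  then show ?thesis unfolding ch_dist_def by (rule hyperbolic_cosh_ge_1[OF a])
qed

text \<open>Summed over the partition of unity, the divergences give n times \<open>ch_dist\<close>,
  which is at least n at every point, and the boundary terms add up to the boundary volume.\<close>

lemma volume_le:
  assumes \<rho>: "0 < \<rho>" "\<And>p. p \<in> boundary A \<Longrightarrow> ch_dist p = cosh \<rho>"
  shows "real CARD('n) * measure vol M \<le> sinh \<rho> * measure bd.vol (boundary A)"
proof -
  obtain P c K \<phi> where P: "finite (P :: 'm set)"
    and *: "\<forall>k\<in>P. c k \<in> A \<and> compact (K k) \<and> K k \<subseteq> fst (c k) \<and>
      C1_manifold (\<phi> k) \<and> (\<forall>p\<in>M - K k. \<phi> k p = 0) \<and> (\<forall>p\<in>M. 0 \<le> \<phi> k p)"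
    and sum_\<phi>: "\<forall>p\<in>M. (\<Sum>k\<in>P. \<phi> k p) = 1"
    using partition_of_unity by (elim exE conjE)
  have c: "c k \<in> A" and K: "compact (K k)" "K k \<subseteq> fst (c k)" and C: "C1_manifold (\<phi> k)"
    and supp: "\<And>p. p \<in> M - K k \<Longrightarrow> \<phi> k p = 0" and nonneg: "\<And>p. p \<in> M \<Longrightarrow> 0 \<le> \<phi> k p"
    if "k \<in> P" for k
    using bspec[OF * that] by simp_all
  define h where "h k = (\<lambda>p. real CARD('n) * ch_dist p * \<phi> k p + grad_deriv (\<phi> k) p)" for k
  have div: "integrable vol (h k)" "integrable vol (\<phi> k)" "integrable bd.vol (\<phi> k)"
    "integral\<^sup>L vol (h k) \<le> sinh \<rho> * integral\<^sup>L bd.vol (\<phi> k)" if k: "k \<in> P" for k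
    unfolding h_def
    using integrable_divergence[OF c[OF k] C[OF k] K[OF k] supp[OF k] nonneg[OF k] \<rho>]
      integrable_bump[OF c[OF k] C[OF k] K[OF k] supp[OF k] nonneg[OF k] \<rho>]
      integrable_boundary_bump[OF c[OF k] C[OF k] K[OF k] supp[OF k] nonneg[OF k] \<rho>]
      divergence_le[OF c[OF k] C[OF k] K[OF k] supp[OF k] nonneg[OF k] \<rho>] by simp_all
  have sum_h: "(\<Sum>k\<in>P. h k p) = real CARD('n) * ch_dist p" if p: "p \<in> M" for p
  proof -
    have "(\<Sum>k\<in>P. grad_deriv (\<phi> k) p) = 0"
      by (rule grad_deriv_sum_const[OF C _ p]) (use sum_\<phi> in simp_all)
    moreover have "(\<Sum>k\<in>P. real CARD('n) * ch_dist p * \<phi> k p) = real CARD('n) * ch_dist p"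
      unfolding sum_distrib_left[symmetric] using sum_\<phi> p by simp
    ultimately show ?thesis by (simp add: h_def sum.distrib)
  qed
  \<comment> \<open>The constant 1 is a finite sum of integrable functions, so the volume is finite
    and \<open>measure\<close> is its true value.\<close>
  have "integrable vol (\<lambda>p. \<Sum>k\<in>P. \<phi> k p)" by (rule Bochner_Integration.integrable_sum) (rule div(2))
  then have int1: "integrable vol (\<lambda>p. 1 :: real)"
    by (rule Bochner_Integration.integrable_cong[OF refl, THEN iffD1, rotated]) (simp add: space_vol sum_\<phi>)
  have "real CARD('n) * measure vol M = (\<integral>p. real CARD('n) \<partial>vol)" by (simp add: space_vol)
  also have "\<dots> \<le> (\<integral>p. (\<Sum>k\<in>P. h k p) \<partial>vol)"
  proof (rule integral_mono)
    show "integrable vol (\<lambda>p. real CARD('n))" using integrable_mult_right[OF int1, of "real CARD('n)"] by simp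
    show "integrable vol (\<lambda>p. \<Sum>k\<in>P. h k p)" by (rule Bochner_Integration.integrable_sum) (rule div(1))
    show "real CARD('n) \<le> (\<Sum>k\<in>P. h k p)" if "p \<in> space vol" for p
      using that ch_dist_ge_1[of p] by (simp add: space_vol sum_h)
  qed
  also have "\<dots> = (\<Sum>k\<in>P. integral\<^sup>L vol (h k))"
    by (rule Bochner_Integration.integral_sum) (rule div(1))
  also have "\<dots> \<le> (\<Sum>k\<in>P. sinh \<rho> * integral\<^sup>L bd.vol (\<phi> k))"
    by (rule sum_mono) (rule div(4))
  also have "\<dots> = sinh \<rho> * (\<integral>p. (\<Sum>k\<in>P. \<phi> k p) \<partial>bd.vol)"
    by (subst Bochner_Integration.integral_sum) (simp_all add: div(3) sum_distrib_left)
  also have "(\<integral>p. (\<Sum>k\<in>P. \<phi> k p) \<partial>bd.vol) = (\<integral>p. 1 \<partial>bd.vol)"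
    by (rule Bochner_Integration.integral_cong[OF refl])
      (use sum_\<phi> boundary_subset in \<open>auto simp: bd.space_vol\<close>)
  also have "\<dots> = measure bd.vol (boundary A)" by (simp add: bd.space_vol)
  finally show ?thesis .
qed

end

theorem corollary8p5:
  fixes a :: "'e::euclidean_space \<times> real" and \<rho> :: real
    and \<Sigma> :: "('e \<times> real) set" and B :: "('e \<times> real, 'n::finite) chart set"
    and M :: "'m::t2_space set" and A :: "('m, 'n) chart set"
    and \<psi> :: "'m \<Rightarrow> 'e \<times> real"
  assumes dim: "DIM('e) = CARD('n) + 1"
    and center: "a \<in> hyperbolic_space" and radius: "0 < \<rho>"
    and \<Sigma>_sphere: "\<Sigma> \<subseteq> geodesic_sphere a \<rho>"
    and \<Sigma>_submanifold: "submanifold hyperplane \<Sigma> B"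
    and \<Sigma>_compact: "compact \<Sigma>" and \<Sigma>_orientable: "orientable (- {bd_index}) B"
    and M_manifold: "smooth_atlas half_space M A"
    and M_compact: "compact M" and M_connected: "connected M"
    and M_orientable: "orientable UNIV A"
    and immersion: "immersion_hyp A M \<psi>"
    and boundary: "diffeomorphism (boundary A) (boundary_atlas A) \<Sigma> B \<psi>"
    and minimal: "minimal A \<psi>"
  shows "riemannian_volume UNIV M A \<psi> \<le>
    sinh \<rho> / real CARD('n) * riemannian_volume (- {bd_index}) (boundary A) (boundary_atlas A) \<psi>"
proof -
  have bij: "bij_betw \<psi> (boundary A) \<Sigma>"
    and inv: "continuous_on \<Sigma> (inv_into (boundary A) \<psi>)"
    using boundary by (auto simp: diffeomorphism_def smooth_map_def)
  \<comment> \<open>Compactness is carried from \<open>\<Sigma>\<close> to the boundary by the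
    continuous inverse of \<open>\<psi>\<close>.\<close>
  have "compact (inv_into (boundary A) \<psi> ` \<Sigma>)"
    by (rule compact_continuous_image[OF inv \<Sigma>_compact])
  moreover have "inv_into (boundary A) \<psi> ` \<Sigma> = boundary A"
    using bij_betw_inv_into[OF bij] by (rule bij_betw_imp_surj_on)
  ultimately have "compact (boundary A)" by simp
  then interpret minimal_manifold M A \<psi> a
    using assms by unfold_locales
  have "ch_dist p = cosh \<rho>" if p: "p \<in> boundary A" for p
  proof -
    have "\<psi> p \<in> geodesic_sphere a \<rho>" using bij_betwE[OF bij] p \<Sigma>_sphere by blast
    then have "\<psi> p \<in> hyperbolic_space" "arcosh (ch_dist p) = \<rho>"
      by (simp_all add: geodesic_sphere_def hyp_dist_def ch_dist_def)
    \<comment> \<open>The lower bound 1 is what allows \<open>cosh\<close> to undo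
      \<open>arcosh\<close>.\<close>
    moreover have "1 \<le> ch_dist p" by (rule ch_dist_ge_1) (use p boundary_subset in blast)
    ultimately show ?thesis using cosh_arcosh_real[of "ch_dist p"] by simp
  qed
  from volume_le[OF radius this]
  show ?thesis
    by (simp add: riemannian_volume_def field_simps)
qed

end
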